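(* Let $\mathtt B$ be a bounded set in $C_b^{\ell,\beta-\ell}(\mathbb R^{\mathsf d})$, let $\mathcal X\subset\mathbb R^{\mathsf d}$ be compact and $\hat{\mathcal X}\subset\mathbb R^{\mathsf d}$ open with $\mathcal X\subset\hat{\mathcal X}$, let $m\in\mathbb N$, $\mathsf d_D\in\mathbb N$, $\epsilon>0$, and let $(d_n)$ be positive numbers with $d_n\to0$. Let $\psi:\mathbb R^{\mathsf d}\to\mathbb R$ be a nonnegative bounded measurable function. Let $D_n=(D_n^{(i)})_{1\le i\le\mathsf d_D}$ ($n\in\mathbb N$) be collections of $\mathtt B$-valued random fields with $\mathrm{supp}\,D_n^{(i)}\subset\mathcal X$ a.s. for all $n$ and $i$. Let $\xi_n=(\xi_{n,j})_{j=1,\dots,n}$ and $\xi'_n=(\xi'_{n,j})_{j=1,\dots,n}$ be collections of $\mathbb R^{\mathsf d}$-valued random variables (all random elements are defined on the same probability space and may be arbitrarily dependent) such that $\xi_n$ and $\xi'_n$ have the same distribution for every $n\in\mathbb N$. With $\mathbb R_n(\cdot)$ and $Q_{1,n}(a)$ as defined in the context, there exists a constant $C$ such that for all $n\in\mathbb N$ $$\mathbb R_n(\xi'_n)\le C\Big[\mathbb R_n(\xi_n)+d_n^{2m\beta}+d_n^{-\mathsf d}\sup_{a\in\hat{\mathcal X}}Q_{1,n}(a)\Big].$$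
   Context: Let $\beta>0$ and $\ell$ the largest integer with $\ell<\beta$. $C_b^{\ell,\beta-\ell}(\mathbb R^{\mathsf d})$ is the space of $\ell$-times continuously differentiable $f:\mathbb R^{\mathsf d}\to\mathbb R$ with finite norm $\sum_{i=0}^\ell\sup_x|\partial^if(x)|+\sup_{x\ne y}|\partial^\ell f(x)-\partial^\ell f(y)|/|x-y|^{\beta-\ell}$, equipped with its Borel $\sigma$-field. $\mathtt K_0\in C^\infty(\mathbb R;\mathbb R)$ is a fixed symmetric kernel whose Fourier transform $\widehat{\mathtt K}_0(u)=\int e^{iux}\mathtt K_0(x)dx$ is in $C^\infty(\mathbb R;\mathbb R)$, has support in $[-1,1]$ and equals $1$ on $[-1/2,1/2]$. For $\eta>0$, $\varphi_{0,\eta}(x)=\eta^{-\mathsf d}\prod_{i=1}^{\mathsf d}\mathtt K_0(\eta^{-1}x_i)$, $x\in\mathbb R^{\mathsf d}$. For a collection $\zeta_n=(\zeta_{n,j})_{j\le n}$: $\mathbb R_n(\zeta_n)=E\big[n^{-1}\sum_{j=1}^n|D_n(\zeta_{n,j})|^{2m}\psi(\zeta_{n,j})\big]$, where $|\cdot|$ is the Euclidean norm on $\mathbb R^{\mathsf d_D}$. $Q_{1,n}(a)=P\Big[\big|n^{-1}\sum_{j=1}^n\{\varphi_{0,d_n/(4m)}(\xi_{n,j}-a)\psi(\xi_{n,j})-E[\varphi_{0,d_n/(4m)}(\xi_{n,j}-a)\psi(\xi_{n,j})]\}\big|\ge\frac{\epsilon}{2(1+\epsilon)}n^{-1}\sum_{j=1}^nE[\varphi_{0,d_n/(4m)}(\xi_{n,j}-a)\psi(\xi_{n,j})]\Big]$.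 *)

theory Defs
  imports "HOL-Probability.Probability"
begin

definition partial :: "'d::finite \<Rightarrow> (real ^ 'd \<Rightarrow> real) \<Rightarrow> real ^ 'd \<Rightarrow> real" where
  "partial i f x = frechet_derivative f (at x) (axis i 1)"

primrec partials :: "'d::finite list \<Rightarrow> (real ^ 'd \<Rightarrow> real) \<Rightarrow> real ^ 'd \<Rightarrow> real" where
  "partials [] f = f"
| "partials (i # is) f = partials is (partial i f)"

primrec Ck :: "nat \<Rightarrow> (real ^ 'd::finite \<Rightarrow> real) \<Rightarrow> bool" where
  "Ck 0 f \<longleftrightarrow> continuous_on UNIV f"
| "Ck (Suc k) f \<longleftrightarrow> (\<forall>x. f differentiable (at x)) \<and> (\<forall>i. Ck k (partial i f))"

text \<open>The \<open>k\<close>-th derivative at a point is the tensor of all partial derivatives indexed by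
  lists of \<open>k\<close> coordinates, measured in the Euclidean norm. The norm takes values in the extended
  nonnegative reals, so that suprema of unbounded sets are infinite; it is only meaningful on
  functions satisfying \<open>Ck l\<close>.\<close>

definition holder_norm :: "nat \<Rightarrow> real \<Rightarrow> (real ^ 'd::finite \<Rightarrow> real) \<Rightarrow> ennreal" where
  "holder_norm l \<gamma> f =
     (\<Sum>k\<le>l. SUP x. ennreal (L2_set (\<lambda>is. partials is f x) {is. length is = k}))
     + (SUP (x, y) \<in> {(x, y). x \<noteq> y}.
          ennreal (L2_set (\<lambda>is. partials is f x - partials is f y) {is. length is = l}
                   / norm (x - y) powr \<gamma>))"

definition holder_space :: "nat \<Rightarrow> real \<Rightarrow> (real ^ 'd::finite \<Rightarrow> real) set" where
  "holder_space l \<gamma> = {f. Ck l f \<and> holder_norm l \<gamma> f < \<infinity>}"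

definition holder_bounded :: "nat \<Rightarrow> real \<Rightarrow> (real ^ 'd::finite \<Rightarrow> real) set \<Rightarrow> bool" where
  "holder_bounded l \<gamma> B \<longleftrightarrow>
     B \<subseteq> holder_space l \<gamma> \<and> (\<exists>c::real. \<forall>f\<in>B. holder_norm l \<gamma> f \<le> ennreal c)"

definition holder_open :: "nat \<Rightarrow> real \<Rightarrow> (real ^ 'd::finite \<Rightarrow> real) set \<Rightarrow> bool" where
  "holder_open l \<gamma> U \<longleftrightarrow> U \<subseteq> holder_space l \<gamma> \<and>
     (\<forall>f\<in>U. \<exists>r>0. \<forall>g\<in>holder_space l \<gamma>.
        holder_norm l \<gamma> (\<lambda>x. g x - f x) < ennreal r \<longrightarrow> g \<in> U)"

definition holder_borel :: "nat \<Rightarrow> real \<Rightarrow> (real ^ 'd::finite \<Rightarrow> real) measure" where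
  "holder_borel l \<gamma> = sigma (holder_space l \<gamma>) {U. holder_open l \<gamma> U}"

definition supp :: "('a::topological_space \<Rightarrow> real) \<Rightarrow> 'a set" where
  "supp f = closure {x. f x \<noteq> 0}"

definition smooth_real :: "(real \<Rightarrow> real) \<Rightarrow> bool" where
  "smooth_real f \<longleftrightarrow> (\<forall>k x. (deriv ^^ k) f differentiable (at x))"

definition fourier :: "(real \<Rightarrow> real) \<Rightarrow> real \<Rightarrow> complex" where
  "fourier f u = (CLINT x|lborel. iexp (u * x) * complex_of_real (f x))"

definition flat_top_kernel :: "(real \<Rightarrow> real) \<Rightarrow> bool" where
  "flat_top_kernel K \<longleftrightarrow> smooth_real K \<and> (\<forall>x. K (- x) = K x) \<and> integrable lborel K \<and>
     (\<exists>h. (\<forall>u. fourier K u = complex_of_real (h u)) \<and> smooth_real h \<and>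
          supp h \<subseteq> {-1..1} \<and> (\<forall>u\<in>{-1/2..1/2}. h u = 1))"

definition kernel_scaled :: "(real \<Rightarrow> real) \<Rightarrow> real \<Rightarrow> real ^ 'd::finite \<Rightarrow> real" where
  "kernel_scaled K \<eta> x = 1 / \<eta> ^ CARD('d) * (\<Prod>i\<in>UNIV. K (x $ i / \<eta>))"

text \<open>In the following definitions the sample size \<open>n\<close> is fixed, and the collection of design
  variables \<open>\<zeta>\<close> is only used at the indices from \<open>1\<close> to \<open>n\<close>. The same outcome \<open>\<omega>\<close>
  selects both the field and the point where it is evaluated.\<close>

definition emp_risk :: "'w measure \<Rightarrow> ('e::finite \<Rightarrow> 'w \<Rightarrow> real ^ 'd::finite \<Rightarrow> real) \<Rightarrow>
    nat \<Rightarrow> (real ^ 'd \<Rightarrow> real) \<Rightarrow> nat \<Rightarrow> (nat \<Rightarrow> 'w \<Rightarrow> real ^ 'd) \<Rightarrow> real" where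
  "emp_risk M D m \<psi> n \<zeta> =
     (LINT \<omega>|M. 1 / real n *
        (\<Sum>j=1..n. norm (\<chi> i. D i \<omega> (\<zeta> j \<omega>)) ^ (2 * m) * \<psi> (\<zeta> j \<omega>)))"

definition deviation_prob :: "'w measure \<Rightarrow> (real ^ 'd::finite \<Rightarrow> real) \<Rightarrow> real \<Rightarrow>
    nat \<Rightarrow> (nat \<Rightarrow> 'w \<Rightarrow> real ^ 'd) \<Rightarrow> real" where
  "deviation_prob M w \<epsilon> n \<xi> =
     measure M {\<omega> \<in> space M.
       \<bar>1 / real n * (\<Sum>j=1..n. w (\<xi> j \<omega>) - (LINT \<omega>'|M. w (\<xi> j \<omega>')))\<bar>
       \<ge> \<epsilon> / (2 * (1 + \<epsilon>)) * (1 / real n * (\<Sum>j=1..n. (LINT \<omega>'|M. w (\<xi> j \<omega>'))))}"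

definition Q1 :: "'w measure \<Rightarrow> (real \<Rightarrow> real) \<Rightarrow> (real ^ 'd::finite \<Rightarrow> real) \<Rightarrow> nat \<Rightarrow> real \<Rightarrow>
    real \<Rightarrow> nat \<Rightarrow> (nat \<Rightarrow> 'w \<Rightarrow> real ^ 'd) \<Rightarrow> real ^ 'd \<Rightarrow> real" where
  "Q1 M K \<psi> m \<epsilon> \<delta> n \<xi> a =
     deviation_prob M (\<lambda>x. kernel_scaled K (\<delta> / (4 * real m)) (x - a) * \<psi> x) \<epsilon> n \<xi>"

end

theory Submission
  imports Defs
begin

text \<open>Convolve the fields with the product kernel at bandwidth \<open>d\<close>: since the moments of the
  kernel of positive order vanish, the result \<open>D * \<phi>\<close> differs from \<open>D\<close> by \<open>O(d powr \<beta>)\<close>.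
  Its Fourier transform lives in \<open>[-1/d, 1/d]\<close> in every coordinate, that of
  \<open>G = norm (D * \<phi>) ^ (2 m)\<close> in \<open>[-2m/d, 2m/d]\<close>, where the transform of the kernel of bandwidth
  \<open>d / (4 m)\<close> equals \<open>1\<close>. Hence convolution with that kernel reproduces \<open>G\<close>, and the weighted
  average of \<open>G\<close> over a sample is the integral of \<open>G a\<close> against the kernel density estimate at
  \<open>a\<close>. Where the density estimates of both samples are within the relative error of their
  common mean, one is at most \<open>1 + \<epsilon>\<close> times the other. The remaining \<open>a\<close> near \<open>X\<close> are
  controlled by the deviation probability and those far from \<open>X\<close> by the fast decay of the
  kernel.\<close>

section \<open>Product integrals and affine substitutions\<close>

text \<open>The fields may depend on both samples, so an expectation cannot be taken with the fields
  frozen. The comparison is therefore made outcome by outcome: for fixed \<omega> it involves two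
  point configurations and fixed functions, and the randomness returns through the Lebesgue measure
  of the set of bad \<open>a\<close>, whose expectation Fubini turns into an integral of deviation
  probabilities. Equality of the laws enters twice: both density estimates have the same mean, and
  both bad sets obey the same bound.

  The kernel changes sign, so a density estimate may be negative; the inequality between the two
  estimates survives integration because it is multiplied by G \<ge> 0. The even exponent 2 m makes
  G a polynomial in the smoothed coordinates, which keeps its spectrum bounded. The relative error e
  = \<epsilon> / (2 (1 + \<epsilon>)) is small enough for 1 + e \<le> (1 + \<epsilon>) (1 - e). The
  negative power of d in front of the deviation probability is the size of the rescaled kernel, paid
  wherever no comparison is possible.\<close>

lemma lborel_integrable_affine:
  fixes f :: "'a::euclidean_space \<Rightarrow> 'b::{banach, second_countable_topology}"
  assumes f: "integrable lborel f" and c: "c \<noteq> 0"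
  shows "integrable lborel (\<lambda>x. f (t + c *\<^sub>R x))"
proof -
  have [measurable]: "f \<in> borel_measurable borel"
    using f by simp
  have "integrable (density (distr lborel borel (\<lambda>x. t + c *\<^sub>R x)) (\<lambda>_. ennreal (\<bar>c\<bar> ^ DIM('a)))) f"
    using f lborel_affine[OF c, of t] by (simp add: ennreal_power)
  then have "integrable lborel (\<lambda>x. \<bar>c\<bar> ^ DIM('a) *\<^sub>R f (t + c *\<^sub>R x))"
    by (subst (asm) integrable_density, simp, simp, simp) (subst (asm) integrable_distr_eq, auto)
  then have "integrable lborel (\<lambda>x. (1 / \<bar>c\<bar> ^ DIM('a)) *\<^sub>R (\<bar>c\<bar> ^ DIM('a) *\<^sub>R f (t + c *\<^sub>R x)))"
    by (rule integrable_scaleR_right)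
  then show ?thesis
    using c by simp
qed

lemma lborel_integral_affine:
  fixes f :: "'a::euclidean_space \<Rightarrow> 'b::{banach, second_countable_topology}"
  assumes [measurable]: "f \<in> borel_measurable borel" and c: "c \<noteq> 0"
  shows "(\<integral>x. f x \<partial>lborel) = \<bar>c\<bar> ^ DIM('a) *\<^sub>R (\<integral>x. f (t + c *\<^sub>R x) \<partial>lborel)"
proof -
  have "(\<integral>x. f x \<partial>lborel) =
      (\<integral>x. f x \<partial>(density (distr lborel borel (\<lambda>x. t + c *\<^sub>R x)) (\<lambda>_. ennreal (\<bar>c\<bar> ^ DIM('a)))))"
    using lborel_affine[OF c, of t] by (simp add: ennreal_power)
  also have "\<dots> = (\<integral>x. \<bar>c\<bar> ^ DIM('a) *\<^sub>R f (t + c *\<^sub>R x) \<partial>lborel)"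
    by (subst integral_density, simp, simp, simp) (subst integral_distr, auto)
  finally show ?thesis
    by simp
qed

text \<open>\<open>lborel\<close> on a Euclidean space is the image of a product measure indexed by
  \<open>Basis\<close>; the work is to move between coordinates \<open>i\<close> and basis vectors
  \<open>axis i 1\<close>. The values lie in a normed field because complex exponentials are
  integrated as well as kernels.\<close>

lemma lborel_vec_prod:
  fixes f :: "'d::finite \<Rightarrow> real \<Rightarrow> 'b::{real_normed_field, banach, second_countable_topology}"
  assumes f: "\<And>i. integrable lborel (f i)"
  shows "integrable lborel (\<lambda>x::real^'d. \<Prod>i\<in>UNIV. f i (x $ i))"
    and "(\<integral>x. (\<Prod>i\<in>UNIV. f i ((x::real^'d) $ i)) \<partial>lborel) = (\<Prod>i\<in>UNIV. integral\<^sup>L lborel (f i))"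
proof -
  interpret product_sigma_finite "\<lambda>_::real^'d. lborel :: real measure" ..
  define e where "e = (\<lambda>i. axis i 1 :: real^'d)"
  have inj: "inj e"
    by (auto simp: inj_def e_def axis_eq_axis)
  have Basis: "(Basis :: (real^'d) set) = e ` UNIV"
    by (auto simp: Basis_vec_def e_def)
  define T where "T = (\<lambda>y::real^'d \<Rightarrow> real. \<Sum>b\<in>Basis. y b *\<^sub>R b)"
  have T: "T y $ i = y (e i)" for y i
  proof -
    have "T y \<bullet> e i = y (e i)"
      unfolding T_def using Basis by (intro inner_sum_left_Basis) auto
    then show ?thesis
      by (simp add: e_def inner_axis)
  qed
  have [measurable]: "f i \<in> borel_measurable borel" for i
    using f[of i] by simp
  define g where "g = (\<lambda>b. f (inv e b))"
  have g: "(\<Prod>i\<in>UNIV. f i (T y $ i)) = (\<Prod>b\<in>Basis. g b (y b))" for y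
    unfolding Basis T using inj by (subst prod.reindex) (auto simp: inj_def g_def inv_f_f[OF inj])
  have int: "integrable lborel (g b)" for b
    using f by (simp add: g_def)
  have lb: "(lborel :: (real^'d) measure) = distr (\<Pi>\<^sub>M b\<in>Basis. lborel) borel T"
    unfolding T_def by (rule lborel_eq)
  have [measurable]: "T \<in> (\<Pi>\<^sub>M b\<in>Basis. lborel) \<rightarrow>\<^sub>M borel"
    unfolding T_def by measurable
  show "integrable lborel (\<lambda>x::real^'d. \<Prod>i\<in>UNIV. f i (x $ i))"
    unfolding lb by (subst integrable_distr_eq) (auto simp: g intro!: product_integrable_prod int)
  have "(\<integral>x. (\<Prod>i\<in>UNIV. f i ((x::real^'d) $ i)) \<partial>lborel) =
      (\<integral>y. (\<Prod>b\<in>Basis. g b (y b)) \<partial>(\<Pi>\<^sub>M b\<in>Basis. lborel))"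
    unfolding lb by (subst integral_distr) (auto simp: g)
  also have "\<dots> = (\<Prod>b\<in>Basis. integral\<^sup>L lborel (g b))"
    by (intro product_integral_prod int) auto
  also have "\<dots> = (\<Prod>i\<in>UNIV. integral\<^sup>L lborel (f i))"
    unfolding Basis using inj by (subst prod.reindex) (auto simp: g_def inv_f_f[OF inj])
  finally show "(\<integral>x. (\<Prod>i\<in>UNIV. f i ((x::real^'d) $ i)) \<partial>lborel) = (\<Prod>i\<in>UNIV. integral\<^sup>L lborel (f i))" .
qed

section \<open>Fourier inversion\<close>

text \<open>Up to normalisation the Gaussian is its own transform, which makes it the natural
  damping factor in the inversion formula below.\<close>

lemma std_normal_fourier:
  "(CLBINT u. complex_of_real (std_normal_density u) * iexp (t * u)) =
     complex_of_real (sqrt (2 * pi) * std_normal_density t)"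
proof -
  have "char std_normal_distribution t = (CLBINT u. std_normal_density u *\<^sub>R iexp (t * u))"
    unfolding char_def by (subst integral_density) auto
  then have "(CLBINT u. complex_of_real (std_normal_density u) * iexp (t * u)) =
      char std_normal_distribution t"
    by (simp add: scaleR_conv_of_real)
  also have "\<dots> = complex_of_real (sqrt (2 * pi) * std_normal_density t)"
    by (subst char_std_normal_distribution) (simp add: std_normal_density_def)
  finally show ?thesis .
qed

text \<open>\<open>K\<close> is continuous and integrable, but no global bound is given, so two
  regions are dominated differently. Within distance 1 of \<open>x\<close>, compactness bounds
  \<open>K\<close> and the substitution \<open>y = x + z / s\<close> gives a Gaussian majorant;
  farther away the scaled Gaussian is at most \<open>2 / s\<close> and a multiple of
  \<open>\<bar>K\<bar>\<close> dominates.\<close>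

lemma gauss_mollification_tendsto:
  fixes K :: "real \<Rightarrow> real"
  assumes K: "integrable lborel K" and cont: "\<And>x. isCont K x"
  shows "(\<lambda>n. \<integral>y. K y * (real (Suc n) * std_normal_density (real (Suc n) * (y - x))) \<partial>lborel)
    \<longlonglongrightarrow> K x"
proof -
  let ?s = "\<lambda>n. real (Suc n)" and ?\<rho> = std_normal_density
  have [measurable]: "K \<in> borel_measurable borel"
    using K by simp
  \<comment> \<open>From \<open>1 + t \<le> exp t\<close> at \<open>t = (s w)^2 / 2\<close>: the
    Gaussian factor is at most \<open>2 / s^2\<close>, which beats the prefactor
    \<open>s\<close>.\<close>
  have \<rho>: "?s n * ?\<rho> (?s n * w) \<le> 2 / ?s n" if "\<bar>w\<bar> \<ge> 1" for n w
  proof -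
    have "1 + (?s n * w)\<^sup>2 / 2 \<le> exp ((?s n * w)\<^sup>2 / 2)"
      by (rule exp_ge_add_one_self)
    moreover have "(?s n)\<^sup>2 * 1 \<le> (?s n)\<^sup>2 * w\<^sup>2"
      using that by (intro mult_left_mono) (auto simp: abs_le_square_iff[of 1, simplified])
    ultimately have e: "(?s n)\<^sup>2 / 2 \<le> exp ((?s n * w)\<^sup>2 / 2)"
      unfolding power_mult_distrib by linarith
    have "?\<rho> (?s n * w) = (1 / sqrt (2 * pi)) * exp (- ((?s n * w)\<^sup>2 / 2))"
      by (simp add: std_normal_density_def)
    also have "\<dots> \<le> 1 * exp (- ((?s n * w)\<^sup>2 / 2))"
      using pi_gt3 by (intro mult_right_mono) (auto simp: field_simps)
    also have "\<dots> = 1 / exp ((?s n * w)\<^sup>2 / 2)"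
      by (simp add: exp_minus field_simps)
    also have "\<dots> \<le> 1 / ((?s n)\<^sup>2 / 2)"
      using e by (intro divide_left_mono) auto
    finally have "?s n * ?\<rho> (?s n * w) \<le> ?s n * (1 / ((?s n)\<^sup>2 / 2))"
      by (intro mult_left_mono) auto
    also have "?s n * (1 / ((?s n)\<^sup>2 / 2)) = 2 / ?s n"
      by (simp add: power2_eq_square del: of_nat_Suc)
    finally show ?thesis .
  qed
  have s0: "(\<lambda>n. 2 / ?s n) \<longlonglongrightarrow> 0"
    by real_asymp
  define far where "far = (\<lambda>n y. (if \<bar>y - x\<bar> \<ge> 1 then K y else 0) * (?s n * ?\<rho> (?s n * (y - x))))"
  define near where "near = (\<lambda>n y. (if \<bar>y - x\<bar> \<ge> 1 then 0 else K y) * (?s n * ?\<rho> (?s n * (y - x))))"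
  have far_bound: "\<bar>far n y\<bar> \<le> \<bar>K y\<bar> * (2 / ?s n)" for n y
    using mult_left_mono[OF \<rho>[of "y - x" n], of "\<bar>K y\<bar>"] by (auto simp: far_def abs_mult simp del: of_nat_Suc)
  have far_bound': "\<bar>far n y\<bar> \<le> \<bar>K y\<bar> * 2" for n y
    using far_bound[of n y] by (rule order_trans) (auto intro!: mult_left_mono simp: field_simps)
  have [measurable]: "far n \<in> borel_measurable borel" "near n \<in> borel_measurable borel" for n
    unfolding far_def near_def by measurable
  have far_int: "integrable lborel (far n)" for n
    by (rule Bochner_Integration.integrable_bound[where f="\<lambda>y. K y * 2"]) (auto simp: abs_mult K intro!: far_bound')
  have far: "(\<lambda>n. \<integral>y. far n y \<partial>lborel) \<longlonglongrightarrow> (\<integral>y. 0 \<partial>(lborel :: real measure))"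
  proof (rule integral_dominated_convergence[where w="\<lambda>y. \<bar>K y\<bar> * 2"])
    show "AE y in lborel. (\<lambda>n. far n y) \<longlonglongrightarrow> 0"
    proof (intro AE_I2)
      fix y
      have "(\<lambda>n. \<bar>K y\<bar> * (2 / ?s n)) \<longlonglongrightarrow> 0"
        by (rule tendsto_mult_right_zero[OF s0])
      moreover have "\<forall>\<^sub>F n in sequentially. norm (far n y) \<le> \<bar>K y\<bar> * (2 / ?s n)"
        unfolding real_norm_def by (intro always_eventually allI far_bound)
      ultimately show "(\<lambda>n. far n y) \<longlonglongrightarrow> 0"
        by (rule Lim_null_comparison[rotated])
    qed
    show "AE y in lborel. norm (far n y) \<le> \<bar>K y\<bar> * 2" for n
      by (auto intro: far_bound')
    show "far n \<in> borel_measurable lborel" for n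
      by measurable
    show "integrable lborel (\<lambda>y. \<bar>K y\<bar> * 2)"
      using K by (intro integrable_mult_left integrable_abs)
  qed simp
  define g where "g = (\<lambda>n z. (if \<bar>z / ?s n\<bar> \<ge> 1 then 0 else K (x + z / ?s n)) * ?\<rho> z)"
  have g_near: "near n (x + (1 / ?s n) * z) = ?s n * g n z" for n z
    by (auto simp: near_def g_def)
  have near_eq: "(\<integral>y. near n y \<partial>lborel) = (\<integral>z. g n z \<partial>lborel)" for n
    by (subst lborel_integral_real_affine[where c="1 / ?s n" and t=x]) (simp_all only: g_near, simp_all del: of_nat_Suc)
  obtain b where b: "\<And>y. y \<in> cball x 1 \<Longrightarrow> \<bar>K y\<bar> \<le> b"
  proof -
    have "compact (K ` cball x 1)"
      by (intro compact_continuous_image continuous_at_imp_continuous_on) (use cont in auto)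
    then have "bounded (K ` cball x 1)"
      by (rule compact_imp_bounded)
    then obtain a where "\<forall>z\<in>K ` cball x 1. norm z \<le> a"
      unfolding bounded_iff by blast
    then show ?thesis
      using that[of a] by simp
  qed
  have g_bound: "\<bar>g n z\<bar> \<le> b * ?\<rho> z" for n z
  proof -
    have b0: "0 \<le> b"
      using b[of x] by auto
    show ?thesis
      using b[of "x + z / ?s n"] b0
      by (auto simp: g_def abs_mult dist_real_def intro!: mult_right_mono)
  qed
  have [measurable]: "g n \<in> borel_measurable borel" for n
    unfolding g_def by measurable
  have b\<rho>: "integrable lborel (\<lambda>z. b * ?\<rho> z)"
    by (intro integrable_mult_right integrable_normal_density) simp_all
  have "integrable lborel (g n)" for n
    by (rule Bochner_Integration.integrable_bound[OF b\<rho>]) (auto intro: order_trans[OF g_bound abs_ge_self])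
  then have "integrable lborel (\<lambda>z. ?s n * g n z)" for n
    by simp
  then have near_int: "integrable lborel (near n)" for n
    by (subst lborel_integrable_real_affine_iff[where c="1 / ?s n" and t=x, symmetric])
      (simp_all only: g_near, simp_all del: of_nat_Suc)
  have "(\<lambda>n. \<integral>z. g n z \<partial>lborel) \<longlonglongrightarrow> (\<integral>z. K x * ?\<rho> z \<partial>lborel)"
  proof (rule integral_dominated_convergence[where w="\<lambda>z. b * ?\<rho> z"])
    show "AE z in lborel. (\<lambda>n. g n z) \<longlonglongrightarrow> K x * ?\<rho> z"
    proof (intro AE_I2)
      fix z :: real
      have z0: "(\<lambda>n. z / ?s n) \<longlonglongrightarrow> 0"
        by real_asymp
      have "eventually (\<lambda>n. \<bar>z / ?s n\<bar> < 1) sequentially"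
        using tendsto_rabs[OF z0] by (rule order_tendstoD) simp
      then have ev: "eventually (\<lambda>n. K (x + z / ?s n) * ?\<rho> z = g n z) sequentially"
        by eventually_elim (auto simp: g_def)
      have "(\<lambda>n. K (x + z / ?s n)) \<longlonglongrightarrow> K (x + 0)"
        by (rule isCont_tendsto_compose[OF cont]) (intro tendsto_add tendsto_const z0)
      then have "(\<lambda>n. K (x + z / ?s n) * ?\<rho> z) \<longlonglongrightarrow> K x * ?\<rho> z"
        by (intro tendsto_mult tendsto_const) simp
      then show "(\<lambda>n. g n z) \<longlonglongrightarrow> K x * ?\<rho> z"
        using ev by (rule Lim_transform_eventually)
    qed
    show "AE z in lborel. norm (g n z) \<le> b * ?\<rho> z" for n
      by (auto intro: g_bound)
    show "g n \<in> borel_measurable lborel" for n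
      by measurable
  qed (simp_all only: b\<rho>, simp)
  then have near: "(\<lambda>n. \<integral>y. near n y \<partial>lborel) \<longlonglongrightarrow> K x"
    by (simp add: near_eq)
  have "(\<integral>y. K y * (?s n * ?\<rho> (?s n * (y - x))) \<partial>lborel) =
      (\<integral>y. far n y \<partial>lborel) + (\<integral>y. near n y \<partial>lborel)" for n
    by (subst Bochner_Integration.integral_add[symmetric, OF far_int near_int])
      (auto simp: far_def near_def intro!: Bochner_Integration.integral_cong)
  then show ?thesis
    using tendsto_add[OF far near] by simp
qed

text \<open>The inversion integral is damped by a Gaussian in \<open>u\<close>. Fubini then applies,
  and integrating over \<open>u\<close> first turns the damped integral into a Gaussian average of
  \<open>K\<close> around \<open>x\<close> at scale \<open>1 / s\<close>. Letting the damping
  disappear gives \<open>K x\<close> on one side and the inversion integral on the other.\<close>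

lemma fourier_inversion:
  fixes K :: "real \<Rightarrow> real" and h :: "real \<Rightarrow> complex"
  assumes K: "integrable lborel K" and cont: "\<And>x. isCont K x"
    and h: "\<And>u. fourier K u = h u" and h_int: "integrable lborel h"
  shows "complex_of_real (K x) = (CLBINT u. h u / (2 * pi) * iexp (- (u * x)))"
proof -
  let ?s = "\<lambda>n. real (Suc n)" and ?\<rho> = std_normal_density
  have [measurable]: "K \<in> borel_measurable borel" "h \<in> borel_measurable borel"
    using K h_int by simp_all
  define A where "A = (\<lambda>n. CLBINT u. h u * iexp (- (u * x)) * ?\<rho> (u / ?s n))"
  have A: "A n = sqrt (2 * pi) * (\<integral>y. K y * (?s n * ?\<rho> (?s n * (y - x))) \<partial>lborel)" for n
  proof -
    have \<rho>_int: "integrable lborel (\<lambda>u. ?\<rho> (u / ?s n))"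
    proof -
      have "integrable lborel (\<lambda>u. ?\<rho> (0 + (1 / ?s n) * u))"
        by (rule lborel_integrable_real_affine) auto
      then show ?thesis
        by (simp only: add_0 mult_1 times_divide_eq_left)
    qed
    have int: "integrable (lborel \<Otimes>\<^sub>M lborel)
        (\<lambda>(y, u). complex_of_real (K y) * (iexp (u * (y - x)) * ?\<rho> (u / ?s n)))"
    proof (rule lborel_pair.Fubini_integrable)
      have "(\<lambda>y. LBINT u. cmod (complex_of_real (K y) * (iexp (u * (y - x)) * ?\<rho> (u / ?s n)))) =
          (\<lambda>y. \<bar>K y\<bar> * (LBINT u. ?\<rho> (u / ?s n)))"
        by (simp add: norm_mult)
      then show "integrable lborel
          (\<lambda>y. LBINT u. cmod (case (y, u) of (y, u) \<Rightarrow>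
             complex_of_real (K y) * (iexp (u * (y - x)) * ?\<rho> (u / ?s n))))"
        using K by (simp del: of_nat_Suc)
      show "AE y in lborel. integrable lborel (\<lambda>u. case (y, u) of (y, u) \<Rightarrow>
          complex_of_real (K y) * (iexp (u * (y - x)) * ?\<rho> (u / ?s n)))"
      proof (intro AE_I2)
        fix y
        have "integrable lborel (\<lambda>u. K y * ?\<rho> (u / ?s n))"
          using \<rho>_int by (rule integrable_mult_right)
        then show "integrable lborel (\<lambda>u. case (y, u) of (y, u) \<Rightarrow>
            complex_of_real (K y) * (iexp (u * (y - x)) * ?\<rho> (u / ?s n)))"
          by (rule Bochner_Integration.integrable_bound) (auto simp: norm_mult abs_mult)
      qed
    qed measurable
    have "A n = (CLBINT u. CLBINT y. complex_of_real (K y) * (iexp (u * (y - x)) * ?\<rho> (u / ?s n)))"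
      unfolding A_def
    proof (rule Bochner_Integration.integral_cong[OF refl])
      fix u
      have "(CLBINT y. complex_of_real (K y) * (iexp (u * (y - x)) * ?\<rho> (u / ?s n))) =
          (CLBINT y. (iexp (u * y) * complex_of_real (K y)) * (iexp (- (u * x)) * ?\<rho> (u / ?s n)))"
        by (intro Bochner_Integration.integral_cong) (auto simp: ring_distribs exp_diff exp_minus field_simps)
      also have "\<dots> = fourier K u * (iexp (- (u * x)) * ?\<rho> (u / ?s n))"
        by (simp add: fourier_def)
      finally show "h u * iexp (- (u * x)) * ?\<rho> (u / ?s n) =
          (CLBINT y. complex_of_real (K y) * (iexp (u * (y - x)) * ?\<rho> (u / ?s n)))"
        by (simp add: h)
    qed
    also have "\<dots> = (CLBINT y. CLBINT u. complex_of_real (K y) * (iexp (u * (y - x)) * ?\<rho> (u / ?s n)))"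
      by (rule lborel_pair.Fubini_integral[OF int])
    also have "\<dots> = (CLBINT y. complex_of_real (sqrt (2 * pi) * (K y * (?s n * ?\<rho> (?s n * (y - x))))))"
    proof (rule Bochner_Integration.integral_cong[OF refl])
      fix y
      have "(CLBINT u. iexp (u * (y - x)) * ?\<rho> (u / ?s n)) =
          ?s n *\<^sub>R (CLBINT u. ?\<rho> u * iexp ((?s n * (y - x)) * u))"
        by (subst lborel_integral_real_affine[where c="?s n" and t=0])
          (auto simp: mult_ac simp del: of_nat_Suc intro!: Bochner_Integration.integral_cong)
      also have "\<dots> = complex_of_real (?s n * (sqrt (2 * pi) * ?\<rho> (?s n * (y - x))))"
        by (subst std_normal_fourier) (simp only: scaleR_conv_of_real of_real_mult)
      finally show "(CLBINT u. complex_of_real (K y) * (iexp (u * (y - x)) * ?\<rho> (u / ?s n))) =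
          complex_of_real (sqrt (2 * pi) * (K y * (?s n * ?\<rho> (?s n * (y - x)))))"
        by (simp only: integral_mult_right_zero) (simp add: mult_ac)
    qed
    also have "\<dots> = complex_of_real (\<integral>y. sqrt (2 * pi) * (K y * (?s n * ?\<rho> (?s n * (y - x)))) \<partial>lborel)"
      by (rule integral_complex_of_real)
    finally show ?thesis
      by simp
  qed
  have "(\<lambda>n. A n) \<longlonglongrightarrow> sqrt (2 * pi) * complex_of_real (K x)"
    unfolding A of_real_mult
    by (intro tendsto_mult tendsto_const tendsto_of_real gauss_mollification_tendsto K cont)
  moreover have "A \<longlonglongrightarrow> (CLBINT u. h u * iexp (- (u * x)) * ?\<rho> 0)"
    unfolding A_def
  proof (rule integral_dominated_convergence[where w="\<lambda>u. cmod (h u)"])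
    show "AE u in lborel. (\<lambda>n. h u * iexp (- (u * x)) * ?\<rho> (u / ?s n))
        \<longlonglongrightarrow> h u * iexp (- (u * x)) * ?\<rho> 0"
    proof (intro AE_I2 tendsto_mult tendsto_const tendsto_of_real)
      fix u :: real
      have "(\<lambda>n. u / ?s n) \<longlonglongrightarrow> 0"
        by real_asymp
      then show "(\<lambda>n. ?\<rho> (u / ?s n)) \<longlonglongrightarrow> ?\<rho> 0"
        by (intro isCont_tendsto_compose[where g="?\<rho>"])
          (auto simp: normal_density_def[abs_def] intro!: continuous_intros)
    qed
    have "?\<rho> w \<le> 1" for w
    proof -
      have "?\<rho> w \<le> 1 * 1"
        unfolding std_normal_density_def using pi_gt3 by (intro mult_mono) (auto simp: field_simps)
      then show ?thesis
        by simp
    qed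
    then show "AE u in lborel. cmod (h u * iexp (- (u * x)) * ?\<rho> (u / ?s n)) \<le> cmod (h u)" for n
      by (auto simp: norm_mult mult_left_le)
  qed (use h_int in auto)
  ultimately have "sqrt (2 * pi) * complex_of_real (K x) = (CLBINT u. h u * iexp (- (u * x)) * ?\<rho> 0)"
    by (rule LIMSEQ_unique)
  also have "\<dots> = (CLBINT u. h u * iexp (- (u * x))) / sqrt (2 * pi)"
    by (simp add: std_normal_density_def)
  finally have eq: "sqrt (2 * pi) * complex_of_real (K x) = (CLBINT u. h u * iexp (- (u * x))) / sqrt (2 * pi)" .
  \<comment> \<open>One factor \<open>sqrt (2 * pi)\<close> stems from the transform of the
    Gaussian, the other from its value \<open>1 / sqrt (2 * pi)\<close> at 0; together they give
    \<open>2 * pi\<close>.\<close>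
  define c where "c = complex_of_real (sqrt (2 * pi))"
  have "c * c = complex_of_real (2 * pi)"
    unfolding c_def of_real_mult[symmetric] by simp
  moreover have "c \<noteq> 0"
    by (simp add: c_def)
  moreover have "c * complex_of_real (K x) = (CLBINT u. h u * iexp (- (u * x))) / c"
    using eq unfolding c_def .
  then have "complex_of_real (K x) = (CLBINT u. h u * iexp (- (u * x))) / (c * c)"
    using \<open>c \<noteq> 0\<close> by (simp add: field_simps)
  ultimately have "complex_of_real (K x) = (CLBINT u. h u * iexp (- (u * x))) / complex_of_real (2 * pi)"
    by (simp only:)
  then show ?thesis
    by simp
qed

section \<open>The flat-top kernel\<close>

lemma smooth_real_higher:
  assumes "smooth_real h"
  shows "((deriv ^^ k) h has_field_derivative (deriv ^^ Suc k) h x) (at x)"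
    and "continuous_on A ((deriv ^^ k) h)"
proof -
  have *: "(deriv ^^ k) h differentiable (at x)" for x
    using assms unfolding smooth_real_def by auto
  then show "((deriv ^^ k) h has_field_derivative (deriv ^^ Suc k) h x) (at x)"
    by (simp add: DERIV_deriv_iff_real_differentiable)
  show "continuous_on A ((deriv ^^ k) h)"
    using * by (intro differentiable_imp_continuous_on) (auto simp: differentiable_on_def intro: differentiable_at_withinI)
qed

lemma higher_deriv_zero_outside:
  assumes "\<And>u. \<bar>u\<bar> > 1 \<Longrightarrow> h u = 0" and "\<bar>u\<bar> > 1"
  shows "(deriv ^^ k) h u = (0::real)"
  using assms(2)
proof (induction k arbitrary: u)
  case 0
  then show ?case
    using assms(1) by simp
next
  case (Suc k)
  have "open {u::real. \<bar>u\<bar> > 1}"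
    by (intro open_Collect_less continuous_intros)
  then have "eventually (\<lambda>u. u \<in> {u::real. \<bar>u\<bar> > 1}) (nhds u)"
    using Suc.prems by (intro eventually_nhds_in_open) auto
  then have "eventually (\<lambda>u. (deriv ^^ k) h u = 0) (nhds u)"
    by eventually_elim (use Suc.IH in auto)
  then have "deriv ((deriv ^^ k) h) u = deriv (\<lambda>_. 0) u"
    by (intro deriv_cong_ev) auto
  then show ?case
    by simp
qed

lemma integrable_continuous_compact_support:
  fixes f :: "real \<Rightarrow> 'a::{banach, second_countable_topology}"
  assumes "continuous_on UNIV f" and "\<And>u. \<bar>u\<bar> > 1 \<Longrightarrow> f u = 0"
  shows "integrable lborel f"
proof -
  have "integrable lborel (\<lambda>u. indicator {-1..1} u *\<^sub>R f u)"
    using assms(1) by (intro borel_integrable_compact) (auto intro: continuous_on_subset)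
  also have "(\<lambda>u. indicator {-1..1} u *\<^sub>R f u) = f"
    using assms(2) by (auto simp: indicator_def fun_eq_iff)
  finally show ?thesis .
qed

lemma fourier_by_parts:
  fixes h :: "real \<Rightarrow> real"
  assumes h: "smooth_real h" and h0: "\<And>u. \<bar>u\<bar> > 1 \<Longrightarrow> h u = 0"
  shows "(CLBINT u. (deriv ^^ Suc k) h u * iexp (- (u * x))) =
     \<i> * x * (CLBINT u. (deriv ^^ k) h u * iexp (- (u * x)))"
proof -
  let ?h = "\<lambda>k. (deriv ^^ k) h"
  have zero: "?h k u = 0" if "\<bar>u\<bar> > 1" for k u
    using higher_deriv_zero_outside[OF h0 that] .
  have cont: "continuous_on A (?h k)" for A k
    by (rule smooth_real_higher(2)[OF h])
  define F where "F = (\<lambda>u. complex_of_real (?h k u) * iexp (- (u * x)))"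
  define f where "f = (\<lambda>k u. complex_of_real (?h k u) * iexp (- (u * x)))"
  have int: "integrable lborel (f k)" for k
    unfolding f_def
    by (intro integrable_continuous_compact_support continuous_intros cont) (simp add: zero)
  have "(F has_vector_derivative (f (Suc k) u - \<i> * x * f k u)) (at u within {-2..2})" for u
  proof -
    have "((\<lambda>u. complex_of_real (?h k u)) has_vector_derivative complex_of_real (?h (Suc k) u)) (at u within {-2..2})"
      using smooth_real_higher(1)[OF h, of k u]
      by (intro has_vector_derivative_of_real)
        (simp add: has_real_derivative_iff_has_vector_derivative has_vector_derivative_at_within)
    moreover have "((\<lambda>u. iexp (- (u * x))) has_vector_derivative (- (\<i> * x) * iexp (- (u * x)))) (at u within {-2..2})"
      by (auto intro!: derivative_eq_intros has_vector_derivative_real_field)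
    ultimately show ?thesis
      unfolding F_def f_def
      by (rule has_vector_derivative_mult[THEN has_vector_derivative_eq_rhs])
        (simp add: algebra_simps)
  qed
  \<comment> \<open>\<open>h\<close> is assumed to vanish for \<open>\<bar>u\<bar> > 1\<close>, so
    the endpoints are taken at -2 and 2, where the boundary terms are zero.\<close>
  then have "(CLBINT u. indicator {-2..2} u *\<^sub>R (f (Suc k) u - \<i> * x * f k u)) = F 2 - F (-2)"
    by (intro integral_FTC_atLeastAtMost)
      (auto simp: f_def simp del: funpow.simps intro!: continuous_intros cont)
  also have "F 2 - F (-2) = 0"
    by (simp add: F_def zero)
  also have "(\<lambda>u. indicator {-2..2} u *\<^sub>R (f (Suc k) u - \<i> * x * f k u)) = (\<lambda>u. f (Suc k) u - \<i> * x * f k u)"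
    by (auto simp: indicator_def fun_eq_iff f_def zero simp del: funpow.simps)
  finally have "(CLBINT u. f (Suc k) u) - \<i> * x * (CLBINT u. f k u) = 0"
    using int by simp
  then show ?thesis
    by (simp add: f_def)
qed

lemma flat_top_kernel_fourier_pair:
  assumes "flat_top_kernel K"
  obtains h where "\<And>x. isCont K x" "integrable lborel K" "\<And>u. fourier K u = complex_of_real (h u)"
    "smooth_real h" "\<And>u. \<bar>u\<bar> > 1 \<Longrightarrow> h u = 0" "\<And>u. \<bar>u\<bar> \<le> 1 / 2 \<Longrightarrow> h u = 1"
proof -
  obtain h where h: "\<And>u. fourier K u = complex_of_real (h u)" "smooth_real h" "supp h \<subseteq> {-1..1}"
      "\<And>u. u \<in> {-1/2..1/2} \<Longrightarrow> h u = 1" and K: "smooth_real K" "integrable lborel K"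
    using assms unfolding flat_top_kernel_def by blast
  have "h u = 0" if "\<bar>u\<bar> > 1" for u
  proof (rule ccontr)
    assume "h u \<noteq> 0"
    then have "u \<in> supp h"
      unfolding supp_def by (intro closure_subset[THEN subsetD]) simp
    then have "u \<in> {-1..1}"
      using h(3) by blast
    then show False
      using that by auto
  qed
  moreover have "h u = 1" if "\<bar>u\<bar> \<le> 1 / 2" for u
    using that by (intro h(4)) (auto simp: abs_le_iff)
  moreover have "isCont K x" for x
    using smooth_real_higher(1)[OF K(1), of 0 x] by (intro DERIV_isCont) auto
  ultimately show ?thesis
    using h K by (intro that[of h]) auto
qed

lemma flat_top_kernel_cont:
  assumes "flat_top_kernel K"
  shows "continuous_on A K"
  using flat_top_kernel_fourier_pair[OF assms] by (metis continuous_at_imp_continuous_on)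

lemma flat_top_kernel_measurable [measurable_dest]:
  assumes "flat_top_kernel K"
  shows "K \<in> borel_measurable borel"
  by (intro borel_measurable_continuous_onI flat_top_kernel_cont assms)

lemma flat_top_kernel_inversion:
  assumes "flat_top_kernel K"
  obtains H :: "real \<Rightarrow> complex" where "integrable lborel H" "\<And>u. \<bar>u\<bar> > 1 \<Longrightarrow> H u = 0"
    "\<And>x. complex_of_real (K x) = (CLBINT u. H u * iexp (- (u * x)))"
proof -
  obtain h where h: "\<And>x. isCont K x" "integrable lborel K" "\<And>u. fourier K u = complex_of_real (h u)"
    "smooth_real h" "\<And>u. \<bar>u\<bar> > 1 \<Longrightarrow> h u = 0" "\<And>u. \<bar>u\<bar> \<le> 1 / 2 \<Longrightarrow> h u = 1"
    using flat_top_kernel_fourier_pair[OF assms] by blast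
  have "integrable lborel h"
    using smooth_real_higher(2)[OF h(4), of UNIV 0] h(5)
    by (intro integrable_continuous_compact_support) auto
  then have int: "integrable lborel (\<lambda>u. complex_of_real (h u))"
    by simp
  then show ?thesis
    using fourier_inversion[OF h(2,1,3) int] h(5)
    by (intro that[of "\<lambda>u. h u / (2 * pi)"]) auto
qed

text \<open>By inversion \<open>K\<close> is the transform of a smooth function with compact
  support. Integrating by parts \<open>k\<close> times expresses \<open>x ^ k * K x\<close>, up to a
  power of the imaginary unit, through the \<open>k\<close>-th derivative of that function, whose L1
  norm over \<open>2 * pi\<close> is the bound.\<close>

lemma flat_top_kernel_decay:
  assumes "flat_top_kernel K"
  shows "\<exists>C. \<forall>x. \<bar>x\<bar> ^ k * \<bar>K x\<bar> \<le> C"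
proof -
  obtain h where h: "\<And>x. isCont K x" "integrable lborel K" "\<And>u. fourier K u = complex_of_real (h u)"
    "smooth_real h" "\<And>u. \<bar>u\<bar> > 1 \<Longrightarrow> h u = 0" "\<And>u. \<bar>u\<bar> \<le> 1 / 2 \<Longrightarrow> h u = 1"
    using flat_top_kernel_fourier_pair[OF assms] by blast
  define I where "I = (\<lambda>k x. CLBINT u. (deriv ^^ k) h u * iexp (- (u * x)))"
  have int: "integrable lborel ((deriv ^^ k) h)" for k
    by (intro integrable_continuous_compact_support smooth_real_higher(2) higher_deriv_zero_outside h)
  then have int': "integrable lborel (\<lambda>u. complex_of_real (h u))"
    using int[of 0] by simp
  have Suc: "I (Suc k) x = \<i> * x * I k x" for k x
    unfolding I_def by (rule fourier_by_parts[OF h(4,5)])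
  have I: "I k x = (\<i> * x) ^ k * I 0 x" for k x
    by (induction k) (simp_all add: Suc)
  have K: "complex_of_real (K x) = I 0 x / (2 * pi)" for x
    by (simp add: fourier_inversion[OF h(2,1,3) int'] I_def)
  have "\<bar>x\<bar> ^ k * \<bar>K x\<bar> \<le> (LBINT u. \<bar>(deriv ^^ k) h u\<bar>) / (2 * pi)" for x
  proof -
    have "\<bar>x\<bar> ^ k * \<bar>K x\<bar> = cmod ((\<i> * x) ^ k * complex_of_real (K x))"
      by (simp add: norm_mult norm_power)
    also have "(\<i> * x) ^ k * complex_of_real (K x) = I k x / (2 * pi)"
      by (simp only: K I[of k] times_divide_eq_right)
    also have "cmod \<dots> = cmod (I k x) / (2 * pi)"
      by (simp add: norm_divide norm_mult)
    also have "cmod (I k x) \<le> (LBINT u. cmod ((deriv ^^ k) h u * iexp (- (u * x))))"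
      unfolding I_def by (rule integral_norm_bound)
    also have "\<dots> = (LBINT u. \<bar>(deriv ^^ k) h u\<bar>)"
      by (simp add: norm_mult)
    finally show ?thesis
      by (simp add: divide_right_mono)
  qed
  then show ?thesis
    by blast
qed

text \<open>Decay of orders \<open>k\<close> and \<open>k + 2\<close> together gives the integrable
  majorant \<open>(C + C') / (1 + x^2)\<close>.\<close>

lemma flat_top_kernel_integrable_moment:
  assumes "flat_top_kernel K"
  shows "integrable lborel (\<lambda>x. \<bar>x\<bar> ^ k * K x)"
proof -
  obtain C where C: "\<bar>x\<bar> ^ k * \<bar>K x\<bar> \<le> C" for x
    using flat_top_kernel_decay[OF assms] by blast
  obtain C' where C': "\<bar>x\<bar> ^ (k + 2) * \<bar>K x\<bar> \<le> C'" for x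
    using flat_top_kernel_decay[OF assms] by blast
  have [measurable]: "K \<in> borel_measurable borel"
    using assms by (rule flat_top_kernel_measurable)
  have "integrable lborel (\<lambda>x. (C + C') * inverse (1 + x\<^sup>2))"
    using integrable_inverse_1_plus_square by (intro integrable_mult_right) (simp add: set_integrable_def)
  then show ?thesis
  proof (rule Bochner_Integration.integrable_bound)
    show "AE x in lborel. norm (\<bar>x\<bar> ^ k * K x) \<le> norm ((C + C') * inverse (1 + x\<^sup>2))"
    proof (intro AE_I2)
      fix x :: real
      have "\<bar>x\<bar> ^ k * \<bar>K x\<bar> * (1 + x\<^sup>2) = \<bar>x\<bar> ^ k * \<bar>K x\<bar> + \<bar>x\<bar> ^ (k + 2) * \<bar>K x\<bar>"
        by (simp add: algebra_simps power_add power2_eq_square)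
      also have "\<dots> \<le> C + C'"
        by (intro add_mono C C')
      finally have *: "\<bar>x\<bar> ^ k * \<bar>K x\<bar> * (1 + x\<^sup>2) \<le> C + C'" .
      have "0 < 1 + x\<^sup>2"
        by (simp add: add_pos_nonneg)
      then have "\<bar>x\<bar> ^ k * \<bar>K x\<bar> \<le> (C + C') * inverse (1 + x\<^sup>2)"
        using * by (simp add: field_simps)
      also have "\<dots> \<le> norm ((C + C') * inverse (1 + x\<^sup>2))"
        by simp
      finally show "norm (\<bar>x\<bar> ^ k * K x) \<le> norm ((C + C') * inverse (1 + x\<^sup>2))"
        by (simp add: abs_mult)
    qed
  qed measurable
qed

section \<open>Vanishing moments of the kernel\<close>

lemma flat_top_kernel_fourier_one:
  assumes "flat_top_kernel K" and "\<bar>u\<bar> \<le> 1 / 2"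
  shows "(CLBINT x. iexp (u * x) * K x) = 1"
proof -
  obtain h where "fourier K u = complex_of_real (h u)" "h u = 1"
    using flat_top_kernel_fourier_pair[OF assms(1)] assms(2) by metis
  then show ?thesis
    by (simp add: fourier_def)
qed

text \<open>The binomial expansion produces characters of frequencies
  \<open>0, u, ..., k * u\<close>, all in the flat part of the transform, so each of their integrals
  is 1 and the alternating binomial sum is \<open>(1 - 1) ^ k\<close>. This is a finite difference
  of a constant stretch of the transform.\<close>

lemma integral_kernel_finite_difference:
  assumes K: "flat_top_kernel K" and k: "k > 0" and u: "real k * \<bar>u\<bar> \<le> 1 / 2"
  shows "(CLBINT x. (iexp (u * x) - 1) ^ k * K x) = 0"
proof -
  have [measurable]: "K \<in> borel_measurable borel"
    using K by (rule flat_top_kernel_measurable)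
  have int: "integrable lborel (\<lambda>x. iexp (v * x) * complex_of_real (K x))" for v
    using flat_top_kernel_integrable_moment[OF K, of 0]
    by (rule Bochner_Integration.integrable_bound) (auto simp: norm_mult)
  have "(iexp (u * x) - 1) ^ k * K x =
      (\<Sum>j\<le>k. (of_nat (k choose j) * (-1) ^ (k - j)) * (iexp ((j * u) * x) * K x))" for x
  proof -
    have "(iexp (u * x) - 1) ^ k = (\<Sum>j\<le>k. of_nat (k choose j) * iexp (u * x) ^ j * (-1) ^ (k - j))"
      using binomial_ring[of "iexp (u * x)" "-1" k] by simp
    also have "\<dots> = (\<Sum>j\<le>k. of_nat (k choose j) * iexp ((j * u) * x) * (-1) ^ (k - j))"
      by (simp add: exp_of_nat_mult[symmetric] mult_ac)
    finally show ?thesis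
      by (simp add: sum_distrib_right sum_distrib_left mult_ac)
  qed
  then have "(CLBINT x. (iexp (u * x) - 1) ^ k * K x) =
      (CLBINT x. (\<Sum>j\<le>k. (of_nat (k choose j) * (-1) ^ (k - j)) * (iexp ((j * u) * x) * K x)))"
    by (simp only:)
  also have "\<dots> = (\<Sum>j\<le>k. CLBINT x. (of_nat (k choose j) * (-1) ^ (k - j)) * (iexp ((j * u) * x) * K x))"
    by (rule Bochner_Integration.integral_sum) (intro integrable_mult_right int)
  also have "\<dots> = (\<Sum>j\<le>k. (of_nat (k choose j) * (-1) ^ (k - j)) * (CLBINT x. iexp ((j * u) * x) * K x))"
    by (simp only: integral_mult_right_zero)
  \<comment> \<open>\<open>1 ^ j\<close> is kept to match the binomial formula that sums this to
    \<open>(1 + (-1)) ^ k\<close>.\<close>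
  also have "\<dots> = (\<Sum>j\<le>k. of_nat (k choose j) * 1 ^ j * (-1) ^ (k - j))"
  proof (intro sum.cong refl)
    fix j assume "j \<in> {..k}"
    then have "real j * \<bar>u\<bar> \<le> real k * \<bar>u\<bar>"
      by (intro mult_right_mono) auto
    then have "\<bar>j * u\<bar> \<le> 1 / 2"
      using u by (simp add: abs_mult)
    then have "(CLBINT x. iexp ((j * u) * x) * K x) = 1"
      by (rule flat_top_kernel_fourier_one[OF K])
    then show "(of_nat (k choose j) * (-1) ^ (k - j)) * (CLBINT x. iexp ((j * u) * x) * K x) =
        of_nat (k choose j) * 1 ^ j * (-1) ^ (k - j)"
      by (simp only:) simp
  qed
  also have "\<dots> = (1 + (-1)) ^ k"
    by (rule binomial_ring[symmetric])
  finally show ?thesis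
    using k by simp
qed

text \<open>Up to powers of the imaginary unit the moments are derivatives of the transform at 0.
  They are obtained as limits of the vanishing finite differences divided by \<open>s ^ k\<close>,
  dominated by \<open>\<bar>x\<bar> ^ k * \<bar>K x\<bar>\<close>.\<close>

lemma flat_top_kernel_moment:
  assumes K: "flat_top_kernel K"
  shows "integrable lborel (\<lambda>x. x ^ k * K x)" and "(LBINT x. x ^ k * K x) = (if k = 0 then 1 else 0)"
proof -
  have [measurable]: "K \<in> borel_measurable borel"
    using K by (rule flat_top_kernel_measurable)
  show int: "integrable lborel (\<lambda>x. x ^ k * K x)"
    using flat_top_kernel_integrable_moment[OF K, of k]
    by (rule Bochner_Integration.integrable_bound) (auto simp: abs_mult power_abs)
  show "(LBINT x. x ^ k * K x) = (if k = 0 then 1 else 0)"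
  proof (cases "k = 0")
    case True
    have "complex_of_real (LBINT x. K x) = (CLBINT x. iexp (0 * x) * K x)"
      by simp
    also have "\<dots> = 1"
      by (rule flat_top_kernel_fourier_one[OF K]) simp
    finally show ?thesis
      using True by simp
  next
    case False
    \<comment> \<open>Step sizes tending to 0 for which all frequencies up to \<open>k * s n\<close>
      stay in the flat part \<open>[-1/2, 1/2]\<close>; \<open>n = 0\<close> attains the
      edge.\<close>
    define s where "s = (\<lambda>n. 1 / (2 * real k * real (Suc n)))"
    have s: "0 < s n" "real k * \<bar>s n\<bar> \<le> 1 / 2" for n
    proof -
      show "0 < s n"
        using False by (simp add: s_def)
      have "real k * \<bar>s n\<bar> = 1 / (2 * real (Suc n))"
        using False by (simp add: s_def abs_mult)
      also have "\<dots> \<le> 1 / 2"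
        by (simp add: field_simps)
      finally show "real k * \<bar>s n\<bar> \<le> 1 / 2" .
    qed
    have s0: "s \<longlonglongrightarrow> 0"
      unfolding s_def using False by real_asymp
    define f where "f = (\<lambda>n x. ((iexp (s n * x) - 1) / s n) ^ k * complex_of_real (K x))"
    have f0: "(CLBINT x. f n x) = 0" for n
    proof -
      have "f n x = (1 / complex_of_real (s n) ^ k) * ((iexp (s n * x) - 1) ^ k * K x)" for x
        by (simp add: f_def power_divide)
      then show ?thesis
        using integral_kernel_finite_difference[OF K, of k "s n"] s False by simp
    qed
    have "(\<lambda>n. CLBINT x. f n x) \<longlonglongrightarrow> (CLBINT x. (\<i> * x) ^ k * K x)"
    proof (rule integral_dominated_convergence[where w="\<lambda>x. \<bar>x\<bar> ^ k * \<bar>K x\<bar>"])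
      show "AE x in lborel. (\<lambda>n. f n x) \<longlonglongrightarrow> (\<i> * x) ^ k * K x"
      proof (intro AE_I2)
        fix x :: real
        have "cmod ((iexp (s n * x) - 1) / s n - \<i> * x) \<le> s n * x\<^sup>2" for n
        proof -
          have "cmod (iexp (s n * x) - 1 - \<i> * (s n * x)) \<le> (s n * x)\<^sup>2 / 2"
            using iexp_approx1[of "s n * x" 1] by (simp add: power2_eq_square diff_diff_eq)
          also have "\<dots> \<le> (s n * x)\<^sup>2"
            by simp
          finally have *: "cmod (iexp (s n * x) - 1 - \<i> * (s n * x)) \<le> (s n * x)\<^sup>2" .
          have "(iexp (s n * x) - 1) / s n - \<i> * x = (iexp (s n * x) - 1 - \<i> * (s n * x)) / s n"
            using s(1)[of n] by (simp add: field_simps)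
          also have "cmod \<dots> = cmod (iexp (s n * x) - 1 - \<i> * (s n * x)) / s n"
            using s(1)[of n] by (simp add: norm_divide)
          also have "\<dots> \<le> (s n * x)\<^sup>2 / s n"
            using * s(1)[of n] by (intro divide_right_mono) auto
          also have "\<dots> = s n * x\<^sup>2"
            using s(1)[of n] by (simp add: power2_eq_square)
          finally show ?thesis .
        qed
        then have "\<forall>\<^sub>F n in sequentially. cmod ((iexp (s n * x) - 1) / s n - \<i> * x) \<le> s n * x\<^sup>2"
          by (intro always_eventually allI)
        then have "(\<lambda>n. (iexp (s n * x) - 1) / s n - \<i> * x) \<longlonglongrightarrow> 0"
          using tendsto_mult_left_zero[OF s0, of "x\<^sup>2"] by (rule Lim_null_comparison)
        then have "(\<lambda>n. (iexp (s n * x) - 1) / s n) \<longlonglongrightarrow> \<i> * x"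
          by (rule LIM_zero_cancel)
        then show "(\<lambda>n. f n x) \<longlonglongrightarrow> (\<i> * x) ^ k * K x"
          unfolding f_def by (intro tendsto_mult tendsto_power tendsto_const)
      qed
      show "AE x in lborel. cmod (f n x) \<le> \<bar>x\<bar> ^ k * \<bar>K x\<bar>" for n
      proof (intro AE_I2)
        fix x :: real
        have "cmod (iexp (s n * x) - 1) \<le> s n * \<bar>x\<bar>"
          using iexp_approx1[of "s n * x" 0] s(1)[of n] by (simp add: abs_mult)
        then have "cmod ((iexp (s n * x) - 1) / s n) \<le> \<bar>x\<bar>"
          using s(1)[of n] by (simp add: norm_divide field_simps)
        then show "cmod (f n x) \<le> \<bar>x\<bar> ^ k * \<bar>K x\<bar>"
          unfolding f_def norm_mult norm_power by (intro mult_mono power_mono) auto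
      qed
      show "f n \<in> borel_measurable lborel" for n
        unfolding f_def by measurable
      show "(\<lambda>x. (\<i> * complex_of_real x) ^ k * complex_of_real (K x)) \<in> borel_measurable lborel"
        by measurable
      show "integrable lborel (\<lambda>x. \<bar>x\<bar> ^ k * \<bar>K x\<bar>)"
        using integrable_abs[OF flat_top_kernel_integrable_moment[OF K, of k]] by (simp add: abs_mult)
    qed
    then have "(CLBINT x. (\<i> * x) ^ k * K x) = 0"
      by (simp add: f0 LIMSEQ_const_iff)
    moreover have "(\<lambda>x. (\<i> * complex_of_real x) ^ k * complex_of_real (K x)) =
        (\<lambda>x. \<i> ^ k * complex_of_real (x ^ k * K x))"
      by (auto simp: power_mult_distrib fun_eq_iff)
    ultimately have "\<i> ^ k * complex_of_real (LBINT x. x ^ k * K x) = 0"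
      by (simp only: integral_mult_right_zero integral_complex_of_real)
    then show ?thesis
      using False by simp
  qed
qed

section \<open>Reproduction of band-limited functions\<close>

text \<open>The two factors may have different codomains, since a real kernel or field is paired
  with a complex spectral density.\<close>

lemma integrable_pair_bound:
  fixes f :: "'a::euclidean_space \<times> 'b::euclidean_space \<Rightarrow> 'c::{banach, second_countable_topology}"
    and a :: "'a \<Rightarrow> 'e::{banach, second_countable_topology}"
    and b :: "'b \<Rightarrow> 'f::{banach, second_countable_topology}"
  assumes a: "integrable lborel a" and b: "integrable lborel b"
    and f: "f \<in> borel_measurable (lborel \<Otimes>\<^sub>M lborel)"
    and bound: "\<And>x y. norm (f (x, y)) \<le> C * (norm (a x) * norm (b y))"
  shows "integrable (lborel \<Otimes>\<^sub>M lborel) f"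
proof -
  have [measurable]: "a \<in> borel_measurable borel" "b \<in> borel_measurable borel"
    using a b by simp_all
  have "integrable (lborel \<Otimes>\<^sub>M lborel) (\<lambda>(x, y). norm (a x) * norm (b y))"
    using integrable_norm[OF a] integrable_norm[OF b]
    by (intro lborel_pair.Fubini_integrable) auto
  then have "integrable (lborel \<Otimes>\<^sub>M lborel) (\<lambda>p. C * (case p of (x, y) \<Rightarrow> norm (a x) * norm (b y)))"
    by (rule integrable_mult_right)
  then show ?thesis
  proof (rule Bochner_Integration.integrable_bound[OF _ f], intro AE_I2)
    fix p :: "'a \<times> 'b"
    show "norm (f p) \<le> norm (C * (case p of (x, y) \<Rightarrow> norm (a x) * norm (b y)))"
      using order_trans[OF bound abs_ge_self, of "fst p" "snd p"] by (simp add: case_prod_unfold)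
  qed
qed

section \<open>The product kernel: integrability, moments, Fourier representation\<close>

definition kernel_nd :: "(real \<Rightarrow> real) \<Rightarrow> real ^ 'd::finite \<Rightarrow> real" where
  "kernel_nd K z = (\<Prod>i\<in>UNIV. K (z $ i))"

lemma kernel_nd_measurable [measurable]:
  assumes "flat_top_kernel K"
  shows "kernel_nd K \<in> borel_measurable borel"
proof -
  have [measurable]: "K \<in> borel_measurable borel"
    using assms by (rule flat_top_kernel_measurable)
  show ?thesis
    unfolding kernel_nd_def by measurable
qed

lemma kernel_nd_integrable:
  assumes "flat_top_kernel K"
  shows "integrable lborel (kernel_nd K :: real^'d::finite \<Rightarrow> real)"
  unfolding kernel_nd_def using flat_top_kernel_moment(1)[OF assms, of 0]
  by (intro lborel_vec_prod(1)) simp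

lemma kernel_nd_bounded:
  assumes "flat_top_kernel K"
  obtains C where "C > 0" "\<And>z :: real^'d::finite. \<bar>kernel_nd K z\<bar> \<le> C"
proof -
  obtain c where c: "\<bar>K x\<bar> \<le> c" for x
    using flat_top_kernel_decay[OF assms, of 0] by auto
  have *: "\<bar>kernel_nd K z\<bar> \<le> c ^ CARD('d)" for z :: "real^'d"
    unfolding kernel_nd_def abs_prod using prod_mono[of UNIV "\<lambda>i. \<bar>K (z $ i)\<bar>" "\<lambda>_. c"] c by simp
  then show ?thesis
    by (intro that[of "\<bar>c ^ CARD('d)\<bar> + 1"]) (simp_all add: add_increasing2 order_trans[OF * abs_ge_self])
qed

lemma prod_list_count:
  fixes f :: "'i::finite \<Rightarrow> 'a::comm_monoid_mult"
  shows "prod_list (map f js) = (\<Prod>i\<in>UNIV. f i ^ count_list js i)"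
proof (induction js)
  case (Cons j js)
  have "(\<Prod>i\<in>UNIV. f i ^ count_list (j # js) i) = (\<Prod>i\<in>UNIV. (if i = j then f i else 1) * f i ^ count_list js i)"
    by (intro prod.cong) auto
  also have "\<dots> = f j * (\<Prod>i\<in>UNIV. f i ^ count_list js i)"
    by (simp add: prod.distrib)
  finally show ?case
    using Cons by simp
qed simp

text \<open>Grouping equal coordinates lets the integral factorise into one-dimensional moments. A
  nonempty list contains its head at least once, so one factor is a moment of positive order and
  vanishes.\<close>

lemma kernel_nd_moment:
  fixes js :: "'d::finite list"
  assumes K: "flat_top_kernel K"
  shows "integrable lborel (\<lambda>z::real^'d. prod_list (map (($) z) js) * kernel_nd K z)"
    and "(LBINT z. prod_list (map (($) (z::real^'d)) js) * kernel_nd K z) = (if js = [] then 1 else 0)"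
proof -
  have eq: "prod_list (map (($) z) js) * kernel_nd K z = (\<Prod>i\<in>UNIV. (z $ i) ^ count_list js i * K (z $ i))"
    for z :: "real^'d"
    by (simp add: prod_list_count kernel_nd_def prod.distrib)
  show "integrable lborel (\<lambda>z::real^'d. prod_list (map (($) z) js) * kernel_nd K z)"
    unfolding eq by (intro lborel_vec_prod(1) flat_top_kernel_moment K)
  have "(LBINT z. prod_list (map (($) (z::real^'d)) js) * kernel_nd K z) =
      (\<Prod>i\<in>UNIV. LBINT x. x ^ count_list js i * K x)"
    unfolding eq by (intro lborel_vec_prod(2) flat_top_kernel_moment K)
  also have "\<dots> = (\<Prod>i\<in>UNIV. if count_list js i = 0 then 1 else 0)"
    by (simp add: flat_top_kernel_moment(2)[OF K])
  also have "\<dots> = (if js = [] then 1 else 0)"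
    by (cases js) (auto intro!: prod_zero)
  finally show "(LBINT z. prod_list (map (($) (z::real^'d)) js) * kernel_nd K z) = (if js = [] then 1 else 0)" .
qed

lemma norm_power_le_sum:
  fixes z :: "real^'d::finite"
  shows "norm z ^ N \<le> real CARD('d) ^ N * (\<Sum>i\<in>UNIV. \<bar>z $ i\<bar> ^ N)"
proof -
  have "Max (range (\<lambda>i. \<bar>z $ i\<bar>)) \<in> range (\<lambda>i. \<bar>z $ i\<bar>)"
    by (intro Max_in) auto
  then obtain i where "Max (range (\<lambda>i. \<bar>z $ i\<bar>)) = \<bar>z $ i\<bar>"
    by (rule rangeE)
  then have i: "\<bar>z $ j\<bar> \<le> \<bar>z $ i\<bar>" for j
    using Max_ge[of "range (\<lambda>i. \<bar>z $ i\<bar>)" "\<bar>z $ j\<bar>"] by simp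
  have "norm z \<le> (\<Sum>j\<in>UNIV. \<bar>z $ j\<bar>)"
    by (rule norm_le_l1_cart)
  also have "\<dots> \<le> real CARD('d) * \<bar>z $ i\<bar>"
    using sum_bounded_above[of UNIV "\<lambda>j. \<bar>z $ j\<bar>" "\<bar>z $ i\<bar>"] i by simp
  finally have "norm z ^ N \<le> (real CARD('d) * \<bar>z $ i\<bar>) ^ N"
    by (intro power_mono) auto
  also have "\<dots> = real CARD('d) ^ N * \<bar>z $ i\<bar> ^ N"
    by (rule power_mult_distrib)
  also have "\<dots> \<le> real CARD('d) ^ N * (\<Sum>i\<in>UNIV. \<bar>z $ i\<bar> ^ N)"
    by (intro mult_left_mono member_le_sum) auto
  finally show ?thesis .
qed

lemma kernel_nd_norm_moment:
  assumes K: "flat_top_kernel K"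
  shows "integrable lborel (\<lambda>z::real^'d::finite. norm z ^ N * kernel_nd K z)"
proof -
  note [measurable] = kernel_nd_measurable[OF K]
  have *: "integrable lborel (\<lambda>z::real^'d. \<bar>z $ i\<bar> ^ N * kernel_nd K z)" for i
  proof -
    have "\<bar>z $ i\<bar> ^ N * kernel_nd K z = (\<Prod>j\<in>UNIV. \<bar>z $ j\<bar> ^ (if j = i then N else 0) * K (z $ j))"
      for z :: "real^'d"
    proof -
      have "(\<Prod>j\<in>UNIV. \<bar>z $ j\<bar> ^ (if j = i then N else 0)) = (\<Prod>j\<in>UNIV. if j = i then \<bar>z $ i\<bar> ^ N else 1)"
        by (intro prod.cong) auto
      then show ?thesis
        by (simp add: prod.distrib kernel_nd_def)
    qed
    then show ?thesis
      by (simp only:) (intro lborel_vec_prod(1) flat_top_kernel_integrable_moment K)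
  qed
  have "integrable lborel (\<lambda>z::real^'d. real CARD('d) ^ N * (\<Sum>i\<in>UNIV. \<bar>\<bar>z $ i\<bar> ^ N * kernel_nd K z\<bar>))"
    using * by (intro integrable_mult_right Bochner_Integration.integrable_sum integrable_abs)
  then show ?thesis
  proof (rule Bochner_Integration.integrable_bound)
    show "AE z::real^'d in lborel. norm (norm z ^ N * kernel_nd K z) \<le>
        norm (real CARD('d) ^ N * (\<Sum>i\<in>UNIV. \<bar>\<bar>z $ i\<bar> ^ N * kernel_nd K z\<bar>))"
    proof (intro AE_I2)
      fix z :: "real^'d"
      have "norm (norm z ^ N * kernel_nd K z) = norm z ^ N * \<bar>kernel_nd K z\<bar>"
        by (simp add: abs_mult)
      also have "\<dots> \<le> real CARD('d) ^ N * (\<Sum>i\<in>UNIV. \<bar>z $ i\<bar> ^ N) * \<bar>kernel_nd K z\<bar>"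
        by (intro mult_right_mono norm_power_le_sum) auto
      also have "\<dots> = real CARD('d) ^ N * (\<Sum>i\<in>UNIV. \<bar>\<bar>z $ i\<bar> ^ N * kernel_nd K z\<bar>)"
        by (simp add: sum_distrib_right abs_mult mult.assoc)
      also have "\<dots> \<le> norm (real CARD('d) ^ N * (\<Sum>i\<in>UNIV. \<bar>\<bar>z $ i\<bar> ^ N * kernel_nd K z\<bar>))"
        by simp
      finally show "norm (norm z ^ N * kernel_nd K z) \<le>
        norm (real CARD('d) ^ N * (\<Sum>i\<in>UNIV. \<bar>\<bar>z $ i\<bar> ^ N * kernel_nd K z\<bar>))" .
    qed
  qed measurable
qed

lemma iexp_inner:
  fixes u z :: "real^'d::finite"
  shows "iexp (u \<bullet> z) = (\<Prod>i\<in>UNIV. iexp (u $ i * z $ i))"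
  by (simp add: inner_vec_def exp_sum[symmetric] sum_distrib_left)

lemma kernel_nd_fourier_one:
  fixes v :: "real^'d::finite"
  assumes K: "flat_top_kernel K" and v: "\<And>i. \<bar>v $ i\<bar> \<le> 1 / 2"
  shows "(CLBINT z. iexp (v \<bullet> z) * kernel_nd K z) = 1"
proof -
  have [measurable]: "K \<in> borel_measurable borel"
    using K by (rule flat_top_kernel_measurable)
  have int: "integrable lborel (\<lambda>x. iexp (c * x) * complex_of_real (K x))" for c
    using flat_top_kernel_integrable_moment[OF K, of 0]
    by (rule Bochner_Integration.integrable_bound) (auto simp: norm_mult)
  have "(CLBINT z. iexp (v \<bullet> z) * kernel_nd K z) =
      (CLBINT z. (\<Prod>i\<in>UNIV. iexp (v $ i * (z::real^'d) $ i) * complex_of_real (K (z $ i))))"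
    unfolding iexp_inner kernel_nd_def by (simp add: prod.distrib)
  also have "\<dots> = (\<Prod>i\<in>UNIV. CLBINT x. iexp (v $ i * x) * complex_of_real (K x))"
    by (intro lborel_vec_prod(2) int)
  also have "\<dots> = (\<Prod>i\<in>(UNIV::'d set). 1)"
    by (intro prod.cong refl flat_top_kernel_fourier_one K v)
  finally show ?thesis
    by simp
qed

lemma kernel_nd_inversion:
  assumes K: "flat_top_kernel K"
  obtains H :: "real^'d::finite \<Rightarrow> complex"
  where "integrable lborel H" "\<And>u i. \<bar>u $ i\<bar> > 1 \<Longrightarrow> H u = 0"
    "\<And>z. complex_of_real (kernel_nd K z) = (CLBINT u. H u * iexp (- (u \<bullet> z)))"
proof -
  obtain H1 :: "real \<Rightarrow> complex" where H1: "integrable lborel H1" "\<And>u. \<bar>u\<bar> > 1 \<Longrightarrow> H1 u = 0"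
    "\<And>x. complex_of_real (K x) = (CLBINT u. H1 u * iexp (- (u * x)))"
    using flat_top_kernel_inversion[OF K] by blast
  have [measurable]: "H1 \<in> borel_measurable borel"
    using H1(1) by simp
  have int: "integrable lborel (\<lambda>u. H1 u * iexp (- (u * x)))" for x
    using H1(1) by (rule Bochner_Integration.integrable_bound) (auto simp: norm_mult)
  show ?thesis
  proof (rule that[of "\<lambda>u. \<Prod>i\<in>UNIV. H1 (u $ i)"])
    show "integrable lborel (\<lambda>u::real^'d. \<Prod>i\<in>UNIV. H1 (u $ i))"
      by (intro lborel_vec_prod(1) H1)
    show "(\<Prod>i\<in>UNIV. H1 (u $ i)) = 0" if "\<bar>u $ i\<bar> > 1" for u :: "real^'d" and i
      using H1(2)[OF that] by (auto intro!: prod_zero)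
    fix z :: "real^'d"
    have "complex_of_real (kernel_nd K z) = (\<Prod>i\<in>UNIV. CLBINT u. H1 u * iexp (- (u * z $ i)))"
      by (simp add: kernel_nd_def H1(3))
    also have "\<dots> = (CLBINT u. (\<Prod>i\<in>UNIV. H1 ((u::real^'d) $ i) * iexp (- (u $ i * z $ i))))"
      by (intro lborel_vec_prod(2)[symmetric] int)
    also have "\<dots> = (CLBINT u. (\<Prod>i\<in>UNIV. H1 (u $ i)) * iexp (- (u \<bullet> z)))"
      using iexp_inner[of "- _" z] by (simp add: prod.distrib)
    finally show "complex_of_real (kernel_nd K z) = (CLBINT u. (\<Prod>i\<in>UNIV. H1 (u $ i)) * iexp (- (u \<bullet> z)))" .
  qed
qed

text \<open>Convolution at unit bandwidth. A general bandwidth reduces to it by dilation, so one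
  smoothed factor occupies frequencies up to 1 in each coordinate.\<close>

definition mollify :: "(real \<Rightarrow> real) \<Rightarrow> (real ^ 'd::finite \<Rightarrow> real) \<Rightarrow> real ^ 'd \<Rightarrow> real" where
  "mollify K f x = (LBINT z. f (x - z) * kernel_nd K z)"

text \<open>The spectral density of the convolution is the product of \<open>H\<close> with the
  transform of \<open>f\<close>. Only the kernel is inverted: its representation is inserted into
  the convolution and the integrals are exchanged. The transform of \<open>f\<close> is bounded by
  the L1 norm, so integrability of \<open>F\<close> is inherited from \<open>H\<close>.\<close>

lemma mollify_band_limited:
  fixes f :: "real^'d::finite \<Rightarrow> real"
  assumes K: "flat_top_kernel K" and f: "integrable lborel f"
  obtains F :: "real^'d \<Rightarrow> complex" where "integrable lborel F" "\<And>u i. \<bar>u $ i\<bar> > 1 \<Longrightarrow> F u = 0"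
    "\<And>x. complex_of_real (mollify K f x) = (CLBINT u. F u * iexp (- (u \<bullet> x)))"
proof -
  obtain H :: "real^'d \<Rightarrow> complex" where H: "integrable lborel H" "\<And>u i. \<bar>u $ i\<bar> > 1 \<Longrightarrow> H u = 0"
    "\<And>z. complex_of_real (kernel_nd K z) = (CLBINT u. H u * iexp (- (u \<bullet> z)))"
    using kernel_nd_inversion[OF K] by blast
  have [measurable]: "H \<in> borel_measurable borel" "f \<in> borel_measurable borel"
      "kernel_nd K \<in> borel_measurable (borel :: (real^'d) measure)"
    using H(1) f kernel_nd_measurable[OF K] by simp_all
  define F where "F = (\<lambda>u. H u * (CLBINT y. f y * iexp (u \<bullet> y)))"
  have meas: "(\<lambda>u. CLBINT y. f y * iexp (u \<bullet> y)) \<in> borel_measurable borel"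
    by measurable
  have F: "integrable lborel F"
  proof (rule Bochner_Integration.integrable_bound)
    show "integrable lborel (\<lambda>u. H u * complex_of_real (LBINT y. \<bar>f y\<bar>))"
      using H(1) by simp
    show "AE u in lborel. norm (F u) \<le> norm (H u * complex_of_real (LBINT y. \<bar>f y\<bar>))"
    proof (intro AE_I2)
      fix u
      have "cmod (CLBINT y. f y * iexp (u \<bullet> y)) \<le> (LBINT y. cmod (f y * iexp (u \<bullet> y)))"
        by (rule integral_norm_bound)
      also have "\<dots> = (LBINT y. \<bar>f y\<bar>)"
        by (simp add: norm_mult)
      finally show "norm (F u) \<le> norm (H u * complex_of_real (LBINT y. \<bar>f y\<bar>))"
        unfolding F_def norm_mult by (intro mult_left_mono) (auto intro: order_trans)
    qed
    show "F \<in> borel_measurable lborel"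
      unfolding F_def using meas by measurable
  qed
  show ?thesis
  proof (rule that[OF F])
    show "F u = 0" if "\<bar>u $ i\<bar> > 1" for u i
      using H(2)[OF that] by (simp add: F_def)
    fix x :: "real^'d"
    have int: "integrable (lborel \<Otimes>\<^sub>M lborel) (\<lambda>(u, y). f y * (H u * iexp (- (u \<bullet> (x - y)))))"
      by (rule integrable_pair_bound[OF H(1) f, where C=1]) (auto simp: norm_mult)
    have "mollify K f x = (LBINT y. f (x + (-1) *\<^sub>R y) * kernel_nd K (x - (x + (-1) *\<^sub>R y)))"
      by (simp add: mollify_def)
    also have "\<dots> = (LBINT y. f y * kernel_nd K (x - y))"
      by (subst lborel_integral_affine[where c="-1" and t=x and f="\<lambda>y. f y * kernel_nd K (x - y)"]) auto
    finally have "complex_of_real (mollify K f x) = (CLBINT y. complex_of_real (f y * kernel_nd K (x - y)))"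
      by (simp only: integral_complex_of_real)
    also have "\<dots> = (CLBINT y. CLBINT u. f y * (H u * iexp (- (u \<bullet> (x - y)))))"
      by (simp add: H(3))
    also have "\<dots> = (CLBINT u. CLBINT y. f y * (H u * iexp (- (u \<bullet> (x - y)))))"
      by (rule lborel_pair.Fubini_integral[OF int])
    also have "\<dots> = (CLBINT u. F u * iexp (- (u \<bullet> x)))"
    proof (rule Bochner_Integration.integral_cong[OF refl])
      fix u
      have "f y * (H u * iexp (- (u \<bullet> (x - y)))) = H u * iexp (- (u \<bullet> x)) * (f y * iexp (u \<bullet> y))" for y
        by (simp add: inner_diff_right exp_diff exp_minus field_simps)
      then show "(CLBINT y. f y * (H u * iexp (- (u \<bullet> (x - y))))) = F u * iexp (- (u \<bullet> x))"
        by (simp only: integral_mult_right_zero F_def) (simp add: mult_ac)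
    qed
    finally show "complex_of_real (mollify K f x) = (CLBINT u. F u * iexp (- (u \<bullet> x)))" .
  qed
qed

text \<open>A spectral condition that avoids a transform of \<open>g\<close>: every product of
  \<open>g\<close> with a character of frequency in the cube of radius \<open>R\<close> is a fixed
  point of convolution with the kernel at bandwidth \<open>\<eta>\<close>. This covers constants and
  is stable under products; \<open>R\<close> is the frequency budget left for further
  factors.\<close>

definition reproduced :: "(real \<Rightarrow> real) \<Rightarrow> real \<Rightarrow> real \<Rightarrow> (real ^ 'd::finite \<Rightarrow> real) \<Rightarrow> bool" where
  "reproduced K \<eta> R g \<longleftrightarrow> g \<in> borel_measurable borel \<and> bounded (range g) \<and>
     (\<forall>v x. (\<forall>i. \<bar>v $ i\<bar> \<le> R) \<longrightarrow>
       (CLBINT z. g (x - \<eta> *\<^sub>R z) * iexp (- (v \<bullet> (x - \<eta> *\<^sub>R z))) * kernel_nd K z) = g x * iexp (- (v \<bullet> x)))"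

text \<open>Convolution multiplies a character by the kernel transform at
  \<open>\<eta> *\<^sub>R v\<close>, which is 1 as long as that frequency stays in the flat
  part.\<close>

lemma reproduced_one:
  assumes K: "flat_top_kernel K" and R: "\<bar>\<eta>\<bar> * R \<le> 1 / 2"
  shows "reproduced K \<eta> R (\<lambda>_ :: real^'d::finite. 1)"
proof -
  have "(CLBINT z. iexp (- (v \<bullet> (x - \<eta> *\<^sub>R z))) * kernel_nd K z) = iexp (- (v \<bullet> x))"
    if v: "\<And>i. \<bar>v $ i\<bar> \<le> R" for v x :: "real^'d"
  proof -
    have "\<bar>(\<eta> *\<^sub>R v) $ i\<bar> \<le> 1 / 2" for i
      using mult_left_mono[OF v[of i], of "\<bar>\<eta>\<bar>"] R by (simp add: abs_mult)
    then have "(CLBINT z. iexp ((\<eta> *\<^sub>R v) \<bullet> z) * kernel_nd K z) = 1"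
      by (rule kernel_nd_fourier_one[OF K])
    moreover have "iexp (- (v \<bullet> (x - \<eta> *\<^sub>R z))) * kernel_nd K z =
        iexp (- (v \<bullet> x)) * (iexp ((\<eta> *\<^sub>R v) \<bullet> z) * kernel_nd K z)" for z
      by (simp add: inner_diff_right exp_diff exp_minus field_simps)
    ultimately show ?thesis
      by (simp only: integral_mult_right_zero) simp
  qed
  then show ?thesis
    by (simp add: reproduced_def)
qed

text \<open>\<open>mollify K f\<close> is a superposition of characters with frequencies in the unit
  cube. Shifting \<open>v\<close> by such a frequency costs at most 1 of the budget, so the
  hypothesis on \<open>g\<close> applies under the integral; Fubini moves it there.\<close>

lemma reproduced_mult:
  fixes f :: "real^'d::finite \<Rightarrow> real"
  assumes K: "flat_top_kernel K" and f: "integrable lborel f" and g: "reproduced K \<eta> (R + 1) g"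
  shows "reproduced K \<eta> R (\<lambda>x. g x * mollify K f x)"
proof -
  obtain F :: "real^'d \<Rightarrow> complex" where F: "integrable lborel F" "\<And>u i. \<bar>u $ i\<bar> > 1 \<Longrightarrow> F u = 0"
    "\<And>x. complex_of_real (mollify K f x) = (CLBINT u. F u * iexp (- (u \<bullet> x)))"
    using mollify_band_limited[OF K f] by blast
  have [measurable]: "F \<in> borel_measurable borel" "f \<in> borel_measurable borel" "g \<in> borel_measurable borel"
      "kernel_nd K \<in> borel_measurable (borel :: (real^'d) measure)"
    using F(1) f g kernel_nd_measurable[OF K] by (simp_all add: reproduced_def)
  have meas [measurable]: "mollify K f \<in> borel_measurable borel"
    unfolding mollify_def by measurable
  obtain c where c: "\<bar>g x\<bar> \<le> c" for x
    using g by (auto simp: reproduced_def bounded_iff)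
  have "\<bar>mollify K f x\<bar> \<le> (LBINT u. cmod (F u))" for x
  proof -
    have "\<bar>mollify K f x\<bar> = cmod (CLBINT u. F u * iexp (- (u \<bullet> x)))"
      by (simp only: F(3)[symmetric] norm_of_real)
    also have "\<dots> \<le> (LBINT u. cmod (F u * iexp (- (u \<bullet> x))))"
      by (rule integral_norm_bound)
    finally show ?thesis
      by (simp add: norm_mult)
  qed
  then have "\<bar>g x * mollify K f x\<bar> \<le> c * (LBINT u. cmod (F u))" for x
    unfolding abs_mult by (intro mult_mono c) (use c[of x] in auto)
  then have bdd: "bounded (range (\<lambda>x. g x * mollify K f x))"
    by (auto simp: bounded_iff)
  have "(CLBINT z. (g (x - \<eta> *\<^sub>R z) * mollify K f (x - \<eta> *\<^sub>R z)) * iexp (- (v \<bullet> (x - \<eta> *\<^sub>R z))) * kernel_nd K z) =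
      (g x * mollify K f x) * iexp (- (v \<bullet> x))" if v: "\<And>i. \<bar>v $ i\<bar> \<le> R" for v x
  proof -
    have int: "integrable (lborel \<Otimes>\<^sub>M lborel) (\<lambda>(z, u). F u *
        (g (x - \<eta> *\<^sub>R z) * iexp (- ((u + v) \<bullet> (x - \<eta> *\<^sub>R z))) * kernel_nd K z))"
    proof (rule integrable_pair_bound[OF kernel_nd_integrable[OF K] F(1), where C=c])
      fix z u
      have "cmod (F u * (g (x - \<eta> *\<^sub>R z) * iexp (- ((u + v) \<bullet> (x - \<eta> *\<^sub>R z))) * kernel_nd K z)) =
          \<bar>g (x - \<eta> *\<^sub>R z)\<bar> * (\<bar>kernel_nd K z\<bar> * cmod (F u))"
        by (simp add: norm_mult)
      also have "\<dots> \<le> c * (\<bar>kernel_nd K z\<bar> * cmod (F u))"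
        by (intro mult_right_mono c) auto
      finally show "norm (case (z, u) of (z, u) \<Rightarrow> F u *
          (g (x - \<eta> *\<^sub>R z) * iexp (- ((u + v) \<bullet> (x - \<eta> *\<^sub>R z))) * kernel_nd K z)) \<le>
          c * (norm (kernel_nd K z) * norm (F u))"
        by simp
    qed measurable
    have "(CLBINT z. (g (x - \<eta> *\<^sub>R z) * mollify K f (x - \<eta> *\<^sub>R z)) * iexp (- (v \<bullet> (x - \<eta> *\<^sub>R z))) * kernel_nd K z) =
        (CLBINT z. CLBINT u. F u * (g (x - \<eta> *\<^sub>R z) * iexp (- ((u + v) \<bullet> (x - \<eta> *\<^sub>R z))) * kernel_nd K z))"
    proof (rule Bochner_Integration.integral_cong[OF refl])
      fix z
      let ?y = "x - \<eta> *\<^sub>R z"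
      have "F u * (g ?y * iexp (- ((u + v) \<bullet> ?y)) * kernel_nd K z) =
          (g ?y * iexp (- (v \<bullet> ?y)) * kernel_nd K z) * (F u * iexp (- (u \<bullet> ?y)))" for u
        by (simp only: inner_add_left minus_add_distrib of_real_add ring_distribs exp_add mult_ac)
      then have "(CLBINT u. F u * (g ?y * iexp (- ((u + v) \<bullet> ?y)) * kernel_nd K z)) =
          (g ?y * iexp (- (v \<bullet> ?y)) * kernel_nd K z) * mollify K f ?y"
        by (simp only: F(3) integral_mult_right_zero)
      then show "(g ?y * mollify K f ?y) * iexp (- (v \<bullet> ?y)) * kernel_nd K z =
          (CLBINT u. F u * (g ?y * iexp (- ((u + v) \<bullet> ?y)) * kernel_nd K z))"
        by (simp add: mult_ac)
    qed
    also have "\<dots> = (CLBINT u. CLBINT z. F u * (g (x - \<eta> *\<^sub>R z) * iexp (- ((u + v) \<bullet> (x - \<eta> *\<^sub>R z))) * kernel_nd K z))"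
      by (rule lborel_pair.Fubini_integral[OF int, symmetric])
    also have "\<dots> = (CLBINT u. (g x * iexp (- (v \<bullet> x))) * (F u * iexp (- (u \<bullet> x))))"
    proof (rule Bochner_Integration.integral_cong[OF refl])
      fix u
      show "(CLBINT z. F u * (g (x - \<eta> *\<^sub>R z) * iexp (- ((u + v) \<bullet> (x - \<eta> *\<^sub>R z))) * kernel_nd K z)) =
          (g x * iexp (- (v \<bullet> x))) * (F u * iexp (- (u \<bullet> x)))"
      proof (cases "\<forall>i. \<bar>u $ i\<bar> \<le> 1")
        case True
        have "\<bar>(u + v) $ i\<bar> \<le> R + 1" for i
          using abs_triangle_ineq[of "u $ i" "v $ i"] True[rule_format, of i] v[of i] by simp
        then have "(CLBINT z. g (x - \<eta> *\<^sub>R z) * iexp (- ((u + v) \<bullet> (x - \<eta> *\<^sub>R z))) * kernel_nd K z) =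
            g x * iexp (- ((u + v) \<bullet> x))"
          using g unfolding reproduced_def by blast
        moreover have "F u * (g x * iexp (- ((u + v) \<bullet> x))) = (g x * iexp (- (v \<bullet> x))) * (F u * iexp (- (u \<bullet> x)))"
          by (simp only: inner_add_left minus_add_distrib of_real_add ring_distribs exp_add mult_ac)
        ultimately show ?thesis
          by (simp only: integral_mult_right_zero)
      next
        case False
        then obtain i where "\<bar>u $ i\<bar> > 1"
          by (auto simp: not_le)
        then show ?thesis
          using F(2) by simp
      qed
    qed
    also have "\<dots> = (g x * iexp (- (v \<bullet> x))) * mollify K f x"
      by (simp only: F(3) integral_mult_right_zero)
    finally show ?thesis
      by (simp add: mult_ac)
  qed
  then show ?thesis
    using bdd by (auto simp: reproduced_def)
qed

lemma reproduced_integrable: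
  fixes g :: "real^'d::finite \<Rightarrow> real"
  assumes K: "flat_top_kernel K" and g: "reproduced K \<eta> R g"
  shows "integrable lborel (\<lambda>z. g (x - \<eta> *\<^sub>R z) * iexp (- (v \<bullet> (x - \<eta> *\<^sub>R z))) * kernel_nd K z)"
proof -
  have [measurable]: "g \<in> borel_measurable borel" "kernel_nd K \<in> borel_measurable (borel :: (real^'d) measure)"
    using g kernel_nd_measurable[OF K] by (simp_all add: reproduced_def)
  obtain c where c: "\<bar>g x\<bar> \<le> c" for x
    using g by (auto simp: reproduced_def bounded_iff)
  have "integrable lborel (\<lambda>z::real^'d. c * kernel_nd K z)"
    using kernel_nd_integrable[OF K] by (rule integrable_mult_right)
  then show ?thesis
    by (rule Bochner_Integration.integrable_bound)
      (auto simp: norm_mult abs_mult intro!: mult_right_mono order_trans[OF c abs_ge_self])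
qed

lemma reproduced_sum:
  fixes g :: "'i \<Rightarrow> real^'d::finite \<Rightarrow> real"
  assumes K: "flat_top_kernel K" and g: "\<And>i. i \<in> I \<Longrightarrow> reproduced K \<eta> R (g i)"
  shows "reproduced K \<eta> R (\<lambda>x. \<Sum>i\<in>I. g i x)"
proof -
  have "\<forall>i\<in>I. \<exists>c. \<forall>x. \<bar>g i x\<bar> \<le> c"
    using g by (auto simp: reproduced_def bounded_iff)
  then obtain c where c: "\<And>i x. i \<in> I \<Longrightarrow> \<bar>g i x\<bar> \<le> c i"
    by metis
  have "\<bar>\<Sum>i\<in>I. g i x\<bar> \<le> (\<Sum>i\<in>I. c i)" for x
    by (rule order_trans[OF sum_abs sum_mono[OF c]])
  then have "bounded (range (\<lambda>x. \<Sum>i\<in>I. g i x))"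
    by (auto simp: bounded_iff)
  moreover have "(\<lambda>x. \<Sum>i\<in>I. g i x) \<in> borel_measurable borel"
    using g by (intro borel_measurable_sum) (auto simp: reproduced_def)
  moreover have "(CLBINT z. (\<Sum>i\<in>I. g i (x - \<eta> *\<^sub>R z)) * iexp (- (v \<bullet> (x - \<eta> *\<^sub>R z))) * kernel_nd K z) =
      (\<Sum>i\<in>I. g i x) * iexp (- (v \<bullet> x))" if v: "\<forall>i. \<bar>v $ i\<bar> \<le> R" for v x
  proof -
    have "(CLBINT z. (\<Sum>i\<in>I. g i (x - \<eta> *\<^sub>R z)) * iexp (- (v \<bullet> (x - \<eta> *\<^sub>R z))) * kernel_nd K z) =
        (CLBINT z. (\<Sum>i\<in>I. g i (x - \<eta> *\<^sub>R z) * iexp (- (v \<bullet> (x - \<eta> *\<^sub>R z))) * kernel_nd K z))"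
      by (simp only: of_real_sum sum_distrib_right)
    also have "\<dots> = (\<Sum>i\<in>I. CLBINT z. g i (x - \<eta> *\<^sub>R z) * iexp (- (v \<bullet> (x - \<eta> *\<^sub>R z))) * kernel_nd K z)"
      by (intro Bochner_Integration.integral_sum reproduced_integrable[OF K g])
    also have "\<dots> = (\<Sum>i\<in>I. g i x * iexp (- (v \<bullet> x)))"
      using g v by (intro sum.cong refl) (simp add: reproduced_def)
    finally show ?thesis
      by (simp add: sum_distrib_right)
  qed
  ultimately show ?thesis
    by (simp add: reproduced_def)
qed

text \<open>Each square consumes two units of the budget, hence the \<open>2 * m\<close> in the
  hypothesis; \<open>R\<close> is generalised in the induction.\<close>

lemma reproduced_sum_squares_power:
  fixes f :: "'i \<Rightarrow> real^'d::finite \<Rightarrow> real"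
  assumes K: "flat_top_kernel K" and f: "\<And>i. i \<in> I \<Longrightarrow> integrable lborel (f i)"
    and \<eta>: "\<bar>\<eta>\<bar> * (R + 2 * real m) \<le> 1 / 2"
  shows "reproduced K \<eta> R (\<lambda>x. (\<Sum>i\<in>I. (mollify K (f i) x)\<^sup>2) ^ m)"
  using \<eta>
proof (induction m arbitrary: R)
  case 0
  then show ?case
    using reproduced_one[OF K, of \<eta> R] by simp
next
  case (Suc m)
  let ?g = "\<lambda>x. (\<Sum>i\<in>I. (mollify K (f i) x)\<^sup>2) ^ m"
  have "reproduced K \<eta> (R + 1 + 1) ?g"
    using Suc.prems by (intro Suc.IH) (simp add: algebra_simps)
  then have "reproduced K \<eta> R (\<lambda>x. ?g x * mollify K (f i) x * mollify K (f i) x)" if "i \<in> I" for i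
    using f[OF that] by (intro reproduced_mult K)
  then have "reproduced K \<eta> R (\<lambda>x. \<Sum>i\<in>I. ?g x * mollify K (f i) x * mollify K (f i) x)"
    by (intro reproduced_sum K)
  moreover have "(\<Sum>i\<in>I. ?g x * mollify K (f i) x * mollify K (f i) x) = (\<Sum>i\<in>I. (mollify K (f i) x)\<^sup>2) ^ Suc m" for x
    by (simp add: sum_distrib_right power2_eq_square mult_ac)
  ultimately show ?case
    by (simp only:)
qed

lemma mollify_sum_squares_power_reproduced:
  fixes f :: "'i \<Rightarrow> real^'d::finite \<Rightarrow> real"
  assumes K: "flat_top_kernel K" and f: "\<And>i. i \<in> I \<Longrightarrow> integrable lborel (f i)"
  shows "(LBINT z. (\<Sum>i\<in>I. (mollify K (f i) (x - (1 / (4 * real m)) *\<^sub>R z))\<^sup>2) ^ m * kernel_nd K z) =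
    (\<Sum>i\<in>I. (mollify K (f i) x)\<^sup>2) ^ m"
proof -
  let ?g = "\<lambda>x. (\<Sum>i\<in>I. (mollify K (f i) x)\<^sup>2) ^ m"
  let ?\<eta> = "1 / (4 * real m)"
  \<comment> \<open>No budget is left over: \<open>1 / (4 m)\<close> times \<open>2 m\<close> is
    exactly the edge 1/2 of the flat part, which is the origin of the bandwidth in
    \<open>Q1\<close>. For \<open>m = 0\<close> the quotient is 0 by convention and the bound still
    holds.\<close>
  have "reproduced K ?\<eta> 0 ?g"
    by (intro reproduced_sum_squares_power K f) auto
  then have "(CLBINT z. ?g (x - ?\<eta> *\<^sub>R z) * iexp (- (0 \<bullet> (x - ?\<eta> *\<^sub>R z))) * kernel_nd K z) =
      ?g x * iexp (- (0 \<bullet> x))"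
    unfolding reproduced_def by (elim conjE allE[of _ 0] allE[of _ x] impE) simp_all
  then have "(CLBINT z. complex_of_real (?g (x - ?\<eta> *\<^sub>R z) * kernel_nd K z)) = complex_of_real (?g x)"
    by simp
  then show ?thesis
    by (simp only: integral_complex_of_real of_real_eq_iff)
qed

section \<open>Approximation of Hoelder functions\<close>

lemma Ck_imp_continuous: "Ck k f \<Longrightarrow> continuous_on UNIV f"
  by (cases k) (auto intro!: differentiable_imp_continuous_on simp: differentiable_on_def)

lemma Ck_Suc_imp: "Ck (Suc k) f \<Longrightarrow> Ck k f"
proof (induction k arbitrary: f)
  case 0
  then show ?case
    using Ck_imp_continuous[OF 0] by simp
next
  case (Suc k)
  have "Ck k (partial i f)" for i
    using Suc.prems by (intro Suc.IH) simp
  then show ?case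
    using Suc.prems by simp
qed

lemma Ck_mono: "k \<le> l \<Longrightarrow> Ck l f \<Longrightarrow> Ck k f"
proof (induction l arbitrary: f)
  case (Suc l)
  then show ?case
    using Ck_Suc_imp[of l f] by (cases "k = Suc l") auto
qed simp

text \<open>The recursion replaces \<open>f\<close> by a partial derivative, in parallel with
  \<open>Ck\<close> and \<open>partials\<close>, so smoothness passes to the recursive calls. With
  the direction fixed this is the \<open>k\<close>-th derivative of \<open>f\<close> along the line
  through \<open>x\<close> in direction \<open>y\<close>.\<close>

primrec dir_deriv :: "nat \<Rightarrow> (real ^ 'd::finite \<Rightarrow> real) \<Rightarrow> real ^ 'd \<Rightarrow> real ^ 'd \<Rightarrow> real" where
  "dir_deriv 0 f y x = f x"
| "dir_deriv (Suc k) f y x = (\<Sum>i\<in>UNIV. y $ i * dir_deriv k (partial i f) y x)"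

lemma dir_deriv_has_derivative:
  "Ck (Suc k) f \<Longrightarrow>
    ((\<lambda>t. dir_deriv k f y (x + t *\<^sub>R y)) has_real_derivative dir_deriv (Suc k) f y (x + t *\<^sub>R y)) (at t)"
proof (induction k arbitrary: f)
  case 0
  let ?D = "frechet_derivative f (at (x + t *\<^sub>R y))"
  have D: "(f has_derivative ?D) (at (x + t *\<^sub>R y))"
    using 0 by (simp add: frechet_derivative_works)
  then interpret D: linear ?D
    by (rule has_derivative_linear)
  have "((\<lambda>t. x + t *\<^sub>R y) has_derivative (\<lambda>s. s *\<^sub>R y)) (at t)"
    by (auto intro!: derivative_eq_intros)
  from diff_chain_at[OF this D]
  have "((\<lambda>t. f (x + t *\<^sub>R y)) has_derivative (\<lambda>s. s * ?D y)) (at t)"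
    by (simp add: o_def D.scaleR)
  moreover have "?D y = (\<Sum>i\<in>UNIV. y $ i * partial i f (x + t *\<^sub>R y))"
  proof -
    have "?D y = ?D (\<Sum>i\<in>UNIV. y $ i *\<^sub>R axis i 1)"
      using basis_expansion[of y] by (simp add: scalar_mult_eq_scaleR)
    then show ?thesis
      by (simp add: D.sum D.scaleR partial_def)
  qed
  ultimately show ?case
    by (simp add: has_field_derivative_def mult.commute[of _ "sum _ _"] cong: if_cong)
next
  case (Suc k)
  have "((\<lambda>t. dir_deriv k (partial i f) y (x + t *\<^sub>R y)) has_real_derivative
      dir_deriv (Suc k) (partial i f) y (x + t *\<^sub>R y)) (at t)" for i
    using Suc.prems by (intro Suc.IH) auto
  then have "((\<lambda>t. \<Sum>i\<in>UNIV. y $ i * dir_deriv k (partial i f) y (x + t *\<^sub>R y)) has_real_derivative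
      (\<Sum>i\<in>UNIV. y $ i * dir_deriv (Suc k) (partial i f) y (x + t *\<^sub>R y))) (at t)"
    by (intro DERIV_sum DERIV_cmult)
  then show ?case
    by simp
qed

lemma finite_lists_length: "finite {js :: 'd::finite list. length js = k}"
  using finite_lists_length_eq[of "UNIV :: 'd set" k] by simp

lemma sum_lists_length_Suc:
  fixes g :: "'d::finite list \<Rightarrow> 'a::comm_monoid_add"
  shows "(\<Sum>js | length js = Suc k. g js) = (\<Sum>i\<in>UNIV. \<Sum>js | length js = k. g (i # js))"
proof -
  have "{js :: 'd list. length js = Suc k} = (\<lambda>(i, js). i # js) ` (UNIV \<times> {js. length js = k})"
    by (auto simp: length_Suc_conv image_iff)
  moreover have "inj_on (\<lambda>(i, js). i # js) (UNIV \<times> {js :: 'd list. length js = k})"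
    by (auto simp: inj_on_def)
  ultimately show ?thesis
    by (simp add: sum.reindex sum.cartesian_product case_prod_unfold o_def)
qed

lemma dir_deriv_eq_sum_partials:
  "dir_deriv k f y x = (\<Sum>js | length js = k. prod_list (map (($) y) js) * partials js f x)"
proof (induction k arbitrary: f)
  case (Suc k)
  then show ?case
    by (simp add: sum_lists_length_Suc sum_distrib_left mult.assoc)
qed simp

lemma prod_list_component_le:
  fixes y :: "real^'d::finite"
  shows "\<bar>prod_list (map (($) y) js)\<bar> \<le> norm y ^ length js"
  by (induction js) (auto simp: abs_mult intro!: mult_mono component_le_norm_cart)

definition taylor_poly :: "nat \<Rightarrow> (real ^ 'd::finite \<Rightarrow> real) \<Rightarrow> real ^ 'd \<Rightarrow> real ^ 'd \<Rightarrow> real" where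
  "taylor_poly l f x y = (\<Sum>k\<le>l. dir_deriv k f y x / fact k)"

text \<open>On the segment from \<open>x\<close> to \<open>x + y\<close> the one-dimensional
  expansion is stopped one order early, with the Lagrange remainder of order \<open>l\<close> at an
  intermediate point. Against the full Taylor polynomial this leaves a difference of
  \<open>l\<close>-th derivatives at two points, to which the Hoelder condition applies; the
  cardinality counts the terms of the derivative tensor.\<close>

lemma taylor_remainder:
  fixes f :: "real^'d::finite \<Rightarrow> real"
  assumes f: "Ck l f" and \<gamma>: "\<gamma> \<ge> 0" and c: "c \<ge> 0"
    and H: "\<And>js u v. length js = l \<Longrightarrow> \<bar>partials js f u - partials js f v\<bar> \<le> c * norm (u - v) powr \<gamma>"
  shows "\<bar>f (x + y) - taylor_poly l f x y\<bar> \<le> real (card {js :: 'd list. length js = l}) * c * norm y powr (real l + \<gamma>)"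
proof -
  define diff where "diff = (\<lambda>m t. dir_deriv m f y (x + t *\<^sub>R y))"
  have "\<exists>t. 0 < t \<and> t \<le> 1 \<and> f (x + 1 *\<^sub>R y) = (\<Sum>m<l. diff m 0 / fact m * 1 ^ m) + diff l t / fact l * 1 ^ l"
  proof (rule Maclaurin2)
    show "diff 0 = (\<lambda>t. f (x + t *\<^sub>R y))"
      by (simp add: diff_def)
    show "\<forall>m t. m < l \<and> 0 \<le> t \<and> t \<le> 1 \<longrightarrow> DERIV (diff m) t :> diff (Suc m) t"
      unfolding diff_def using f by (blast intro: dir_deriv_has_derivative Ck_mono Suc_leI)
  qed simp
  then obtain t where t: "0 < t" "t \<le> 1"
    and eq: "f (x + y) = (\<Sum>m<l. diff m 0 / fact m) + diff l t / fact l"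
    by auto
  have "taylor_poly l f x y = (\<Sum>m<l. diff m 0 / fact m) + diff l 0 / fact l"
    by (simp add: taylor_poly_def diff_def lessThan_Suc_atMost[symmetric])
  then have "f (x + y) - taylor_poly l f x y = (diff l t - diff l 0) / fact l"
    by (simp add: eq diff_divide_distrib)
  then have "\<bar>f (x + y) - taylor_poly l f x y\<bar> = \<bar>diff l t - diff l 0\<bar> / fact l"
    by (simp add: abs_divide)
  also have "\<dots> \<le> \<bar>diff l t - diff l 0\<bar> / 1"
    by (intro divide_left_mono) (auto simp: fact_ge_1)
  also have "\<dots> \<le> (\<Sum>js\<in>{js :: 'd list. length js = l}. norm y ^ l * (c * norm y powr \<gamma>))"
  proof -
    have "diff l t - diff l 0 = (\<Sum>js | length js = l. prod_list (map (($) y) js) *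
        (partials js f (x + t *\<^sub>R y) - partials js f x))"
      by (simp add: diff_def dir_deriv_eq_sum_partials sum_subtractf right_diff_distrib)
    also have "\<bar>\<dots>\<bar> \<le> (\<Sum>js | length js = l. \<bar>prod_list (map (($) y) js) *
        (partials js f (x + t *\<^sub>R y) - partials js f x)\<bar>)"
      by (rule sum_abs)
    also have "\<dots> \<le> (\<Sum>js\<in>{js :: 'd list. length js = l}. norm y ^ l * (c * norm y powr \<gamma>))"
    proof (intro sum_mono)
      fix js :: "'d list" assume js: "js \<in> {js. length js = l}"
      have "\<bar>partials js f (x + t *\<^sub>R y) - partials js f x\<bar> \<le> c * norm (t *\<^sub>R y) powr \<gamma>"
        using H[of js "x + t *\<^sub>R y" x] js by simp
      also have "\<dots> \<le> c * norm y powr \<gamma>"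
        using t c \<gamma> by (intro mult_left_mono powr_mono2) (auto intro: mult_left_le_one_le)
      finally show "\<bar>prod_list (map (($) y) js) * (partials js f (x + t *\<^sub>R y) - partials js f x)\<bar> \<le>
          norm y ^ l * (c * norm y powr \<gamma>)"
        using prod_list_component_le[of y js] js unfolding abs_mult by (intro mult_mono) auto
    qed
    finally show ?thesis
      by simp
  qed
  also have "\<dots> = real (card {js :: 'd list. length js = l}) * c * (norm y ^ l * norm y powr \<gamma>)"
    by simp
  also have "norm y ^ l * norm y powr \<gamma> \<le> norm y powr (real l + \<gamma>)"
    by (cases "y = 0") (auto simp: powr_add powr_realpow)
  finally show ?thesis
    using c by (simp add: mult_left_mono)
qed

section \<open>What a bounded Hoelder norm provides\<close>

lemma abs_le_L2_set:
  assumes "finite A" "i \<in> A"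
  shows "\<bar>f i\<bar> \<le> L2_set f A"
  using member_le_L2_set[OF assms, of "\<lambda>i. \<bar>f i\<bar>"] by (simp add: L2_set_def)

lemma holder_norm_ge_abs: "ennreal \<bar>f x\<bar> \<le> holder_norm l \<gamma> f"
proof -
  have "ennreal \<bar>f x\<bar> = ennreal (L2_set (\<lambda>js. partials js f x) {js. length js = 0})"
    by (simp add: L2_set_def)
  also have "\<dots> \<le> (SUP x. ennreal (L2_set (\<lambda>js. partials js f x) {js. length js = 0}))"
    by (rule SUP_upper) simp
  also have "\<dots> \<le> (\<Sum>k\<le>l. SUP x. ennreal (L2_set (\<lambda>js. partials js f x) {js. length js = k}))"
    by (rule member_le_sum) auto
  also have "\<dots> \<le> holder_norm l \<gamma> f"
    unfolding holder_norm_def by simp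
  finally show ?thesis .
qed

lemma holder_norm_ge_quotient:
  assumes "length js = l" "u \<noteq> v"
  shows "ennreal (\<bar>partials js f u - partials js f v\<bar> / norm (u - v) powr \<gamma>) \<le> holder_norm l \<gamma> f"
proof -
  let ?q = "\<lambda>(x, y). ennreal (L2_set (\<lambda>js. partials js f x - partials js f y) {js. length js = l}
    / norm (x - y) powr \<gamma>)"
  have "ennreal (\<bar>partials js f u - partials js f v\<bar> / norm (u - v) powr \<gamma>) \<le> ?q (u, v)"
    using abs_le_L2_set[OF finite_lists_length, of js l "\<lambda>js. partials js f u - partials js f v"] assms
    by (auto intro!: ennreal_leI divide_right_mono)
  also have "\<dots> \<le> (SUP p\<in>{(x, y). x \<noteq> y}. ?q p)"
    using assms by (intro SUP_upper) auto
  also have "\<dots> \<le> holder_norm l \<gamma> f"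
    unfolding holder_norm_def by simp
  finally show ?thesis .
qed

lemma holder_boundedE:
  assumes "holder_bounded l \<gamma> B"
  obtains c where "c > 0" "\<And>f. f \<in> B \<Longrightarrow> Ck l f" "\<And>f x. f \<in> B \<Longrightarrow> \<bar>f x\<bar> \<le> c"
    "\<And>f js u v. f \<in> B \<Longrightarrow> length js = l \<Longrightarrow> \<bar>partials js f u - partials js f v\<bar> \<le> c * norm (u - v) powr \<gamma>"
proof -
  obtain c0 where c0: "\<And>f. f \<in> B \<Longrightarrow> holder_norm l \<gamma> f \<le> ennreal c0" and B: "B \<subseteq> holder_space l \<gamma>"
    using assms unfolding holder_bounded_def by blast
  \<comment> \<open>\<open>ennreal\<close> truncates a negative \<open>c0\<close> to 0; a positive
    constant makes it possible to return to inequalities between reals.\<close>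
  define c where "c = max c0 1"
  have c: "holder_norm l \<gamma> f \<le> ennreal c" if "f \<in> B" for f
    using c0[OF that] by (rule order_trans) (auto simp: c_def intro: ennreal_leI)
  have "c > 0"
    by (simp add: c_def)
  then show ?thesis
  proof (rule that)
    fix f assume f: "f \<in> B"
    show "Ck l f"
      using f B by (auto simp: holder_space_def)
    show "\<bar>f x\<bar> \<le> c" for x
      using order_trans[OF holder_norm_ge_abs c[OF f], of x] \<open>c > 0\<close> by (simp add: ennreal_le_iff)
    show "\<bar>partials js f u - partials js f v\<bar> \<le> c * norm (u - v) powr \<gamma>" if "length js = l" for js u v
    proof (cases "u = v")
      case False
      have "\<bar>partials js f u - partials js f v\<bar> / norm (u - v) powr \<gamma> \<le> c"
        using order_trans[OF holder_norm_ge_quotient[OF that False] c[OF f]] \<open>c > 0\<close>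
        by (simp add: ennreal_le_iff)
      then show ?thesis
        using False by (simp add: field_simps)
    qed simp
  qed
qed

section \<open>Error of kernel smoothing\<close>

definition kernel_conv :: "(real \<Rightarrow> real) \<Rightarrow> real \<Rightarrow> (real ^ 'd::finite \<Rightarrow> real) \<Rightarrow> real ^ 'd \<Rightarrow> real" where
  "kernel_conv K \<delta> f x = (LBINT z. f (x - \<delta> *\<^sub>R z) * kernel_nd K z)"

lemma bounded_times_kernel_integrable:
  fixes f :: "real^'d::finite \<Rightarrow> real"
  assumes K: "flat_top_kernel K" and [measurable]: "f \<in> borel_measurable borel" and c: "\<And>x. \<bar>f x\<bar> \<le> c"
  shows "integrable lborel (\<lambda>z. f (x - \<delta> *\<^sub>R z) * kernel_nd K z)"
proof -
  note [measurable] = kernel_nd_measurable[OF K]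
  have "integrable lborel (\<lambda>z::real^'d. c * kernel_nd K z)"
    using kernel_nd_integrable[OF K] by (rule integrable_mult_right)
  then show ?thesis
    by (rule Bochner_Integration.integrable_bound)
      (auto simp: abs_mult intro!: mult_right_mono order_trans[OF c abs_ge_self])
qed

lemma kernel_nd_norm_powr_moment:
  assumes K: "flat_top_kernel K" and \<beta>: "\<beta> \<ge> 0"
  shows "integrable lborel (\<lambda>z::real^'d::finite. norm z powr \<beta> * kernel_nd K z)"
proof -
  note [measurable] = kernel_nd_measurable[OF K]
  \<comment> \<open>Rounding the exponent up: the real power is at most 1 in the unit ball and at
    most \<open>norm z ^ p\<close> outside it.\<close>
  define p where "p = nat \<lceil>\<beta>\<rceil>"
  have le: "norm z powr \<beta> \<le> 1 + norm z ^ p" for z :: "real^'d"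
  proof (cases "norm z \<le> 1")
    case True
    then have "norm z powr \<beta> \<le> 1 powr \<beta>"
      using \<beta> by (intro powr_mono2) auto
    then show ?thesis
      by (simp add: add_increasing2)
  next
    case False
    then have "norm z powr \<beta> \<le> norm z powr real p"
      using \<beta> by (intro powr_mono) (auto simp: p_def of_nat_nat)
    also have "\<dots> = norm z ^ p"
      using False by (intro powr_realpow) auto
    finally show ?thesis
      by simp
  qed
  have "integrable lborel (\<lambda>z::real^'d. \<bar>kernel_nd K z\<bar> + \<bar>norm z ^ p * kernel_nd K z\<bar>)"
    by (intro Bochner_Integration.integrable_add integrable_abs kernel_nd_integrable kernel_nd_norm_moment K)
  then show ?thesis
  proof (rule Bochner_Integration.integrable_bound)
    show "AE z::real^'d in lborel. norm (norm z powr \<beta> * kernel_nd K z) \<le>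
        norm (\<bar>kernel_nd K z\<bar> + \<bar>norm z ^ p * kernel_nd K z\<bar>)"
    proof (intro AE_I2)
      fix z :: "real^'d"
      have "norm z powr \<beta> * \<bar>kernel_nd K z\<bar> \<le> (1 + norm z ^ p) * \<bar>kernel_nd K z\<bar>"
        by (intro mult_right_mono le) auto
      then show "norm (norm z powr \<beta> * kernel_nd K z) \<le> norm (\<bar>kernel_nd K z\<bar> + \<bar>norm z ^ p * kernel_nd K z\<bar>)"
        by (simp add: abs_mult algebra_simps)
    qed
  qed measurable
qed

lemma prod_list_map_mult:
  fixes c :: "'a::comm_monoid_mult"
  shows "prod_list (map (\<lambda>i. c * f i) js) = c ^ length js * prod_list (map f js)"
  by (induction js) (auto simp: mult_ac)

text \<open>All moments of the kernel of positive order vanish, so only the constant term survives.\<close>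

lemma taylor_poly_kernel_integral:
  fixes f :: "real^'d::finite \<Rightarrow> real"
  assumes K: "flat_top_kernel K"
  shows "integrable lborel (\<lambda>z. taylor_poly l f x (- (\<delta> *\<^sub>R z)) * kernel_nd K z)"
    and "(LBINT z. taylor_poly l f x (- (\<delta> *\<^sub>R z)) * kernel_nd K z) = f x"
proof -
  let ?m = "\<lambda>z js. prod_list (map (($) z) js) * kernel_nd K (z::real^'d)"
  define a where "a = (\<lambda>js. (- \<delta>) ^ length js * partials js f x)"
  have eq: "taylor_poly l f x (- (\<delta> *\<^sub>R z)) * kernel_nd K z =
      (\<Sum>k\<le>l. \<Sum>js | length js = k. a js / fact k * ?m z js)" for z
  proof -
    have "($) (- (\<delta> *\<^sub>R z)) = (\<lambda>i. - \<delta> * z $ i)"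
      by auto
    then have "prod_list (map (($) (- (\<delta> *\<^sub>R z))) js) = (- \<delta>) ^ length js * prod_list (map (($) z) js)" for js
      by (simp only: prod_list_map_mult)
    then show ?thesis
      by (simp add: taylor_poly_def dir_deriv_eq_sum_partials a_def sum_distrib_left sum_divide_distrib mult_ac)
  qed
  have int: "integrable lborel (\<lambda>z. a js / fact k * ?m z js)" for js and k :: nat
    by (intro integrable_mult_right kernel_nd_moment(1) K)
  show "integrable lborel (\<lambda>z. taylor_poly l f x (- (\<delta> *\<^sub>R z)) * kernel_nd K z)"
    unfolding eq by (intro Bochner_Integration.integrable_sum int)
  have "(LBINT z. taylor_poly l f x (- (\<delta> *\<^sub>R z)) * kernel_nd K z) =
      (\<Sum>k\<le>l. \<Sum>js | length js = k. a js / fact k * (if js = [] then 1 else 0))"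
    unfolding eq
    by (subst Bochner_Integration.integral_sum, intro Bochner_Integration.integrable_sum int,
        subst Bochner_Integration.integral_sum, rule int)
      (simp only: integral_mult_right_zero kernel_nd_moment(2)[OF K])
  also have "\<dots> = (\<Sum>k\<le>l. if k = 0 then f x else 0)"
  proof (rule sum.cong[OF refl])
    fix k
    show "(\<Sum>js | length js = k. a js / fact k * (if js = [] then 1 else 0)) = (if k = 0 then f x else 0)"
    proof (cases "k = 0")
      case False
      then have "(\<Sum>js | length js = k. a js / fact k * (if js = [] then 1 else 0)) = 0"
        by (intro sum.neutral) auto
      then show ?thesis
        using False by simp
    qed (simp add: a_def)
  qed
  also have "\<dots> = f x"
    by simp
  finally show "(LBINT z. taylor_poly l f x (- (\<delta> *\<^sub>R z)) * kernel_nd K z) = f x" .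
qed

text \<open>The Taylor polynomial integrates exactly to \<open>f x\<close>, so the error is the
  kernel integral of the Taylor remainder. The scaling by \<open>\<delta>\<close> pulls out the
  rate, and what remains is a moment of the absolute kernel times a bound for \<open>B\<close>,
  uniform in \<open>f\<close>, \<open>x\<close> and \<open>\<delta>\<close>.\<close>

lemma kernel_conv_error:
  fixes B :: "(real^'d::finite \<Rightarrow> real) set"
  assumes K: "flat_top_kernel K" and B: "holder_bounded l \<gamma> B" and \<gamma>: "\<gamma> \<ge> 0"
  obtains A where "A \<ge> 0"
    "\<And>f x \<delta>. f \<in> B \<Longrightarrow> \<delta> > 0 \<Longrightarrow> \<bar>kernel_conv K \<delta> f x - f x\<bar> \<le> A * \<delta> powr (real l + \<gamma>)"
proof -
  note [measurable] = kernel_nd_measurable[OF K]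
  obtain c where c: "c > 0" "\<And>f. f \<in> B \<Longrightarrow> Ck l f" "\<And>f x. f \<in> B \<Longrightarrow> \<bar>f x\<bar> \<le> c"
    "\<And>f js u v. f \<in> B \<Longrightarrow> length js = l \<Longrightarrow> \<bar>partials js f u - partials js f v\<bar> \<le> c * norm (u - v) powr \<gamma>"
    using holder_boundedE[OF B] by blast
  define b where "b = real (card {js :: 'd list. length js = l}) * c"
  define \<mu> where "\<mu> = (LBINT z::real^'d. norm z powr (real l + \<gamma>) * \<bar>kernel_nd K z\<bar>)"
  have b: "b \<ge> 0"
    using c(1) by (simp add: b_def)
  have \<mu>: "\<mu> \<ge> 0"
    unfolding \<mu>_def by (intro Bochner_Integration.integral_nonneg) auto
  have \<mu>_int: "integrable lborel (\<lambda>z::real^'d. norm z powr (real l + \<gamma>) * \<bar>kernel_nd K z\<bar>)"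
    using integrable_abs[OF kernel_nd_norm_powr_moment[OF K, of "real l + \<gamma>"]] \<gamma>
    by (simp add: abs_mult)
  have "\<bar>kernel_conv K \<delta> f x - f x\<bar> \<le> b * \<mu> * \<delta> powr (real l + \<gamma>)" if f: "f \<in> B" and \<delta>: "\<delta> > 0" for f x \<delta>
  proof -
    have [measurable]: "f \<in> borel_measurable borel"
      using c(2)[OF f] by (intro borel_measurable_continuous_onI Ck_imp_continuous)
    let ?r = "\<lambda>z. f (x - \<delta> *\<^sub>R z) * kernel_nd K z - taylor_poly l f x (- (\<delta> *\<^sub>R z)) * kernel_nd K z"
    have fint: "integrable lborel (\<lambda>z. f (x - \<delta> *\<^sub>R z) * kernel_nd K z)"
      by (rule bounded_times_kernel_integrable[OF K _ c(3)[OF f]]) measurable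
    have "kernel_conv K \<delta> f x - f x = (LBINT z. ?r z)"
      unfolding kernel_conv_def using taylor_poly_kernel_integral[OF K, of l f x \<delta>]
      by (subst Bochner_Integration.integral_diff[OF fint]) auto
    also have "\<bar>\<dots>\<bar> \<le> (LBINT z. \<bar>?r z\<bar>)"
      by (rule integral_abs_bound)
    also have "\<dots> \<le> (LBINT z::real^'d. b * \<delta> powr (real l + \<gamma>) * (norm z powr (real l + \<gamma>) * \<bar>kernel_nd K z\<bar>))"
    proof (rule Bochner_Integration.integral_mono)
      show "integrable lborel (\<lambda>z. \<bar>?r z\<bar>)"
        by (intro integrable_abs Bochner_Integration.integrable_diff fint taylor_poly_kernel_integral(1)[OF K])
      show "integrable lborel (\<lambda>z::real^'d. b * \<delta> powr (real l + \<gamma>) * (norm z powr (real l + \<gamma>) * \<bar>kernel_nd K z\<bar>))"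
        by (intro integrable_mult_right \<mu>_int)
      fix z :: "real^'d"
      have "\<bar>f (x + - (\<delta> *\<^sub>R z)) - taylor_poly l f x (- (\<delta> *\<^sub>R z))\<bar> \<le> b * norm (- (\<delta> *\<^sub>R z)) powr (real l + \<gamma>)"
        unfolding b_def using c f \<gamma> by (intro taylor_remainder) auto
      also have "\<dots> = b * \<delta> powr (real l + \<gamma>) * norm z powr (real l + \<gamma>)"
        using \<delta> by (simp add: powr_mult)
      finally have "\<bar>f (x + - (\<delta> *\<^sub>R z)) - taylor_poly l f x (- (\<delta> *\<^sub>R z))\<bar> * \<bar>kernel_nd K z\<bar> \<le>
          b * \<delta> powr (real l + \<gamma>) * norm z powr (real l + \<gamma>) * \<bar>kernel_nd K z\<bar>"
        by (rule mult_right_mono) simp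
      then show "\<bar>?r z\<bar> \<le> b * \<delta> powr (real l + \<gamma>) * (norm z powr (real l + \<gamma>) * \<bar>kernel_nd K z\<bar>)"
        by (simp add: left_diff_distrib[symmetric] abs_mult)
    qed
    also have "\<dots> = b * \<mu> * \<delta> powr (real l + \<gamma>)"
      by (simp add: \<mu>_def)
    finally show ?thesis .
  qed
  then show ?thesis
    using b \<mu> by (intro that[of "b * \<mu>"]) auto
qed

section \<open>Comparison of two samples along a path\<close>

lemma kernel_conv_eq_mollify:
  assumes "\<delta> \<noteq> 0"
  shows "kernel_conv K \<delta> f x = mollify K (\<lambda>y. f (\<delta> *\<^sub>R y)) (x /\<^sub>R \<delta>)"
  using assms by (simp add: kernel_conv_def mollify_def scaleR_right_diff_distrib)

lemma kernel_conv_measurable: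
  fixes f :: "real^'d::finite \<Rightarrow> real"
  assumes K: "flat_top_kernel K" and [measurable]: "f \<in> borel_measurable borel"
  shows "kernel_conv K \<delta> f \<in> borel_measurable borel"
proof -
  note [measurable] = kernel_nd_measurable[OF K]
  show ?thesis
    unfolding kernel_conv_def by measurable
qed

lemma kernel_conv_bound:
  fixes f :: "real^'d::finite \<Rightarrow> real"
  assumes K: "flat_top_kernel K" and f: "f \<in> borel_measurable borel" "\<And>x. \<bar>f x\<bar> \<le> c"
  shows "\<bar>kernel_conv K \<delta> f x\<bar> \<le> c * (LBINT z::real^'d. \<bar>kernel_nd K z\<bar>)"
proof -
  have "\<bar>kernel_conv K \<delta> f x\<bar> \<le> (LBINT z. \<bar>f (x - \<delta> *\<^sub>R z) * kernel_nd K z\<bar>)"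
    unfolding kernel_conv_def by (rule integral_abs_bound)
  also have "\<dots> \<le> (LBINT z::real^'d. c * \<bar>kernel_nd K z\<bar>)"
    using bounded_times_kernel_integrable[OF K f] kernel_nd_integrable[OF K] f(2)
    by (intro Bochner_Integration.integral_mono integrable_abs integrable_mult_right)
      (auto simp: abs_mult intro: mult_right_mono)
  finally show ?thesis
    by simp
qed

lemma kernel_scaled_eq:
  "kernel_scaled K \<eta> (x :: real^'d::finite) = 1 / \<eta> ^ CARD('d) * kernel_nd K (x /\<^sub>R \<eta>)"
  by (simp add: kernel_scaled_def kernel_nd_def divide_inverse mult.commute)

text \<open>Dilation by \<open>\<delta>\<close> brings the smoothed fields to unit bandwidth, where
  the bandwidth of the second kernel becomes \<open>1 / (4 m)\<close> and the reproduction formula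
  applies; the substitution \<open>a = x - \<eta> z\<close> rewrites it with the scaled
  kernel.\<close>

lemma kernel_scaled_reproduces:
  fixes f :: "'e::finite \<Rightarrow> real^'d::finite \<Rightarrow> real"
  assumes K: "flat_top_kernel K" and f: "\<And>i. integrable lborel (f i)" "\<And>i x. \<bar>f i x\<bar> \<le> c"
    and \<delta>: "\<delta> > 0" and m: "m \<ge> 1"
  defines "G \<equiv> \<lambda>x. (\<Sum>i\<in>UNIV. (kernel_conv K \<delta> (f i) x)\<^sup>2) ^ m"
  shows "integrable lborel (\<lambda>a. G a * kernel_scaled K (\<delta> / (4 * real m)) (x - a))"
    and "(LBINT a. G a * kernel_scaled K (\<delta> / (4 * real m)) (x - a)) = G x"
proof -
  define \<eta> where "\<eta> = \<delta> / (4 * real m)"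
  have \<eta>: "\<eta> > 0"
    using \<delta> m by (simp add: \<eta>_def)
  note [measurable] = kernel_nd_measurable[OF K]
  have fm [measurable]: "f i \<in> borel_measurable borel" for i
    using f(1)[of i] by simp
  note [measurable] = kernel_conv_measurable[OF K fm]
  have [measurable]: "G \<in> borel_measurable borel"
    unfolding G_def by measurable
  define b where "b = c * (LBINT z::real^'d. \<bar>kernel_nd K z\<bar>)"
  have Gb: "\<bar>G x\<bar> \<le> (\<Sum>i\<in>(UNIV::'e set). b\<^sup>2) ^ m" for x
  proof -
    have sq: "(kernel_conv K \<delta> (f i) x)\<^sup>2 \<le> b\<^sup>2" for i
      using kernel_conv_bound[OF K fm f(2), of \<delta> i x] unfolding b_def
      by (metis abs_ge_zero power2_abs power_mono)
    have "(\<Sum>i\<in>UNIV. (kernel_conv K \<delta> (f i) x)\<^sup>2) ^ m \<le> (\<Sum>i\<in>(UNIV::'e set). b\<^sup>2) ^ m"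
      by (rule power_mono[OF sum_mono[OF sq] sum_nonneg]) auto
    then show ?thesis
      by (simp add: G_def sum_nonneg)
  qed
  have int: "integrable lborel (\<lambda>z. G (x - \<eta> *\<^sub>R z) * kernel_nd K z)" for x
    by (rule bounded_times_kernel_integrable[OF K _ Gb]) measurable
  have rep: "(LBINT z. G (x - \<eta> *\<^sub>R z) * kernel_nd K z) = G x" for x
  proof -
    let ?f = "\<lambda>i y. f i (\<delta> *\<^sub>R y)"
    have "integrable lborel (?f i)" for i
      using lborel_integrable_affine[OF f(1), of \<delta> i 0] \<delta> by simp
    then have "(LBINT z. (\<Sum>i\<in>UNIV. (mollify K (?f i) (x /\<^sub>R \<delta> - (1 / (4 * real m)) *\<^sub>R z))\<^sup>2) ^ m * kernel_nd K z) =
        (\<Sum>i\<in>UNIV. (mollify K (?f i) (x /\<^sub>R \<delta>))\<^sup>2) ^ m"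
      by (intro mollify_sum_squares_power_reproduced K)
    moreover have "x /\<^sub>R \<delta> - (1 / (4 * real m)) *\<^sub>R z = (x - \<eta> *\<^sub>R z) /\<^sub>R \<delta>" for z
      using \<delta> by (simp add: \<eta>_def scaleR_right_diff_distrib)
    ultimately show ?thesis
      using \<delta> by (simp add: G_def kernel_conv_eq_mollify)
  qed
  have sub: "G (x + (- \<eta>) *\<^sub>R z) * kernel_scaled K \<eta> (x - (x + (- \<eta>) *\<^sub>R z)) =
      (1 / \<eta> ^ CARD('d)) * (G (x - \<eta> *\<^sub>R z) * kernel_nd K z)" for x z
    using \<eta> by (simp add: kernel_scaled_eq)
  have [measurable]: "kernel_scaled K \<eta> \<in> borel_measurable (borel :: (real^'d) measure)"
    unfolding kernel_scaled_eq[abs_def] by measurable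
  have inv: "integrable lborel (\<lambda>z. (1 / \<eta> ^ CARD('d)) * (G (x - \<eta> *\<^sub>R z) * kernel_nd K z))" for x
    by (intro integrable_mult_right int)
  \<comment> \<open>Integrability is transported by the inverse substitution
    \<open>z = (x - a) / \<eta>\<close>.\<close>
  define h where "h = (\<lambda>z. (1 / \<eta> ^ CARD('d)) * (G (x - \<eta> *\<^sub>R z) * kernel_nd K z))"
  have "integrable lborel (\<lambda>a. h ((1 / \<eta>) *\<^sub>R x + (- 1 / \<eta>) *\<^sub>R a))"
    using inv \<eta> unfolding h_def by (intro lborel_integrable_affine) auto
  moreover have "h ((1 / \<eta>) *\<^sub>R x + (- 1 / \<eta>) *\<^sub>R a) = G a * kernel_scaled K \<eta> (x - a)" for a
    using \<eta> by (simp add: h_def kernel_scaled_eq scaleR_right_distrib scaleR_right_diff_distrib divide_inverse_commute)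
  ultimately show "integrable lborel (\<lambda>a. G a * kernel_scaled K (\<delta> / (4 * real m)) (x - a))"
    by (simp add: \<eta>_def)
  have "(LBINT a. G a * kernel_scaled K \<eta> (x - a)) =
      \<bar>- \<eta>\<bar> ^ DIM(real^'d) *\<^sub>R (LBINT z. (1 / \<eta> ^ CARD('d)) * (G (x - \<eta> *\<^sub>R z) * kernel_nd K z))"
    using \<eta> by (subst lborel_integral_affine[where c="- \<eta>" and t=x]) (simp_all only: sub, simp_all)
  also have "\<dots> = G x"
    using \<eta> by (simp only: integral_mult_right_zero rep) simp
  finally show "(LBINT a. G a * kernel_scaled K (\<delta> / (4 * real m)) (x - a)) = G x"
    by (simp add: \<eta>_def)
qed

text \<open>Away from the support of \<open>f\<close> the smoothed function only sees kernel arguments of norm at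
  least \<open>r / \<delta>\<close>, hence the factor \<open>(\<delta> * norm z / r) ^ N\<close> comes for free.\<close>

lemma kernel_conv_tail:
  fixes f :: "real^'d::finite \<Rightarrow> real"
  assumes K: "flat_top_kernel K" and f: "integrable lborel f" and c: "\<And>x. \<bar>f x\<bar> \<le> c"
    and r: "r > 0" and \<delta>: "\<delta> > 0" and [measurable]: "U \<in> sets borel"
    and far: "\<And>a y. a \<notin> U \<Longrightarrow> f y \<noteq> 0 \<Longrightarrow> r \<le> dist a y"
  shows "integrable lborel (\<lambda>a. indicator (- U) a * \<bar>kernel_conv K \<delta> f a\<bar>)"
    and "(LBINT a. indicator (- U) a * \<bar>kernel_conv K \<delta> f a\<bar>) \<le>
      (LBINT y. \<bar>f y\<bar>) * ((\<delta> / r) ^ N * (LBINT z::real^'d. norm z ^ N * \<bar>kernel_nd K z\<bar>))"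
proof -
  note [measurable] = kernel_nd_measurable[OF K]
  have fm [measurable]: "f \<in> borel_measurable borel"
    using f by simp
  note [measurable] = kernel_conv_measurable[OF K fm]
  define w where "w = (\<lambda>z::real^'d. (\<delta> / r) ^ N * (norm z ^ N * \<bar>kernel_nd K z\<bar>))"
  have w0: "w z \<ge> 0" for z
    using r \<delta> by (simp add: w_def)
  have [measurable]: "w \<in> borel_measurable borel"
    unfolding w_def by measurable
  have w: "integrable lborel w"
    unfolding w_def using integrable_abs[OF kernel_nd_norm_moment[OF K, of N]]
    by (intro integrable_mult_right) (simp add: abs_mult)
  have shift_int: "integrable lborel (\<lambda>a. \<bar>f (a - \<delta> *\<^sub>R z)\<bar>)" for z
    using lborel_integrable_affine[OF integrable_abs[OF f], of 1 "- (\<delta> *\<^sub>R z)"] by simp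
  have shift: "(LBINT a. \<bar>f (a - \<delta> *\<^sub>R z)\<bar>) = (LBINT y. \<bar>f y\<bar>)" for z
    by (subst lborel_integral_affine[where c=1 and t="- (\<delta> *\<^sub>R z)" and f="\<lambda>y. \<bar>f y\<bar>"]) auto
  have pair: "integrable (lborel \<Otimes>\<^sub>M lborel) (\<lambda>(z, a). \<bar>f (a - \<delta> *\<^sub>R z)\<bar> * w z)"
  proof (rule lborel_pair.Fubini_integrable)
    show "integrable lborel (\<lambda>z. LBINT a. norm (case (z, a) of (z, a) \<Rightarrow> \<bar>f (a - \<delta> *\<^sub>R z)\<bar> * w z))"
      using w by (simp add: abs_mult w0 shift)
    show "AE z in lborel. integrable lborel (\<lambda>a. case (z, a) of (z, a) \<Rightarrow> \<bar>f (a - \<delta> *\<^sub>R z)\<bar> * w z)"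
      using shift_int by simp
  qed measurable
  \<comment> \<open>Convolution of \<open>\<bar>f\<bar>\<close> with the moment-weighted kernel;
    translation invariance makes its integral the product of the two integrals.\<close>
  define \<Psi> where "\<Psi> = (\<lambda>a. LBINT z. \<bar>f (a - \<delta> *\<^sub>R z)\<bar> * w z)"
  have \<Psi>: "integrable lborel \<Psi>"
    using lborel_pair.integrable_snd[OF pair] by (simp add: \<Psi>_def)
  have "(LBINT a. \<Psi> a) = (LBINT z. LBINT a. \<bar>f (a - \<delta> *\<^sub>R z)\<bar> * w z)"
    unfolding \<Psi>_def by (rule lborel_pair.Fubini_integral[OF pair])
  also have "\<dots> = (LBINT y. \<bar>f y\<bar>) * ((\<delta> / r) ^ N * (LBINT z::real^'d. norm z ^ N * \<bar>kernel_nd K z\<bar>))"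
    by (simp add: shift w_def)
  finally have \<Psi>_eq: "(LBINT a. \<Psi> a) =
      (LBINT y. \<bar>f y\<bar>) * ((\<delta> / r) ^ N * (LBINT z::real^'d. norm z ^ N * \<bar>kernel_nd K z\<bar>))" .
  have bound: "indicator (- U) a * \<bar>kernel_conv K \<delta> f a\<bar> \<le> \<Psi> a" for a
  proof (cases "a \<in> U")
    case True
    then show ?thesis
      by (simp add: \<Psi>_def w0)
  next
    case False
    have "\<bar>kernel_conv K \<delta> f a\<bar> \<le> (LBINT z. \<bar>f (a - \<delta> *\<^sub>R z) * kernel_nd K z\<bar>)"
      unfolding kernel_conv_def by (rule integral_abs_bound)
    also have "\<dots> \<le> \<Psi> a"
      unfolding \<Psi>_def
    proof (rule Bochner_Integration.integral_mono)
      show "integrable lborel (\<lambda>z. \<bar>f (a - \<delta> *\<^sub>R z) * kernel_nd K z\<bar>)"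
        by (intro integrable_abs bounded_times_kernel_integrable[OF K fm c])
      show "integrable lborel (\<lambda>z. \<bar>f (a - \<delta> *\<^sub>R z)\<bar> * w z)"
      proof (rule Bochner_Integration.integrable_bound)
        show "integrable lborel (\<lambda>z. c * w z)"
          using w by simp
        show "AE z in lborel. norm (\<bar>f (a - \<delta> *\<^sub>R z)\<bar> * w z) \<le> norm (c * w z)"
          using w0 c by (auto simp: abs_mult intro!: mult_right_mono order_trans[OF c abs_ge_self])
      qed measurable
      fix z
      show "\<bar>f (a - \<delta> *\<^sub>R z) * kernel_nd K z\<bar> \<le> \<bar>f (a - \<delta> *\<^sub>R z)\<bar> * w z"
      proof (cases "f (a - \<delta> *\<^sub>R z) = 0")
        case nz: False
        have "r \<le> \<delta> * norm z"
          using far[OF False nz] \<delta> by (simp add: dist_norm)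
        then have "1 \<le> (\<delta> * norm z / r) ^ N"
          using r by (intro one_le_power) simp
        then have "1 * \<bar>kernel_nd K z\<bar> \<le> (\<delta> * norm z / r) ^ N * \<bar>kernel_nd K z\<bar>"
          by (rule mult_right_mono) simp
        also have "\<dots> = w z"
          by (simp add: w_def power_mult_distrib power_divide)
        finally show ?thesis
          by (simp add: abs_mult mult_left_mono)
      qed simp
    qed
    finally show ?thesis
      using False by simp
  qed
  show int: "integrable lborel (\<lambda>a. indicator (- U) a * \<bar>kernel_conv K \<delta> f a\<bar>)"
    using \<Psi> by (rule Bochner_Integration.integrable_bound)
      (auto intro: order_trans[OF bound abs_ge_self])
  show "(LBINT a. indicator (- U) a * \<bar>kernel_conv K \<delta> f a\<bar>) \<le>
      (LBINT y. \<bar>f y\<bar>) * ((\<delta> / r) ^ N * (LBINT z::real^'d. norm z ^ N * \<bar>kernel_nd K z\<bar>))"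
    unfolding \<Psi>_eq[symmetric] by (intro Bochner_Integration.integral_mono int \<Psi> bound)
qed

text \<open>The hypothesis is symmetric in \<open>u\<close> and \<open>v\<close>, so the estimate
  serves in both directions between a field and its smoothing. The power of a sum is bounded through
  the maximum: \<open>2 S + 2 T \<le> 4 max S T\<close>, whence the factor
  \<open>4 ^ m\<close>.\<close>

lemma sum_squares_power_approx:
  fixes u v :: "'e::finite \<Rightarrow> real"
  assumes "\<And>i. \<bar>u i - v i\<bar> \<le> \<tau>"
  shows "(\<Sum>i\<in>UNIV. (u i)\<^sup>2) ^ m \<le> 4 ^ m * ((\<Sum>i\<in>UNIV. (v i)\<^sup>2) ^ m + (real CARD('e) * \<tau>\<^sup>2) ^ m)"
proof -
  define S where "S = (\<Sum>i\<in>UNIV. (v i)\<^sup>2)"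
  define T where "T = real CARD('e) * \<tau>\<^sup>2"
  have S: "S \<ge> 0" and T: "T \<ge> 0"
    by (auto simp: S_def T_def intro: sum_nonneg)
  have "(u i)\<^sup>2 \<le> 2 * (v i)\<^sup>2 + 2 * \<tau>\<^sup>2" for i
  proof -
    have "(u i - v i)\<^sup>2 \<le> \<tau>\<^sup>2"
      using assms[of i] by (metis abs_ge_zero power2_abs power_mono)
    \<comment> \<open>Since \<open>u^2 - 2 v^2 = 2 (u - v)^2 - (u - 2 v)^2\<close>, discarding this
      square yields the claim.\<close>
    moreover have "0 \<le> (u i - 2 * v i)\<^sup>2"
      by simp
    ultimately show ?thesis
      by (simp add: power2_eq_square algebra_simps)
  qed
  then have "(\<Sum>i\<in>UNIV. (u i)\<^sup>2) \<le> (\<Sum>i\<in>UNIV. 2 * (v i)\<^sup>2 + 2 * \<tau>\<^sup>2)"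
    by (intro sum_mono) auto
  also have "\<dots> = 2 * S + 2 * T"
    by (simp add: sum.distrib S_def T_def sum_distrib_left)
  also have "\<dots> \<le> 4 * max S T"
    by simp
  finally have "(\<Sum>i\<in>UNIV. (u i)\<^sup>2) ^ m \<le> (4 * max S T) ^ m"
    by (intro power_mono sum_nonneg) auto
  also have "\<dots> \<le> 4 ^ m * (S ^ m + T ^ m)"
    using S T by (auto simp: power_mult_distrib max_def)
  finally show ?thesis
    by (simp add: S_def T_def)
qed

text \<open>The deterministic core, for two point configurations \<open>x\<close> and
  \<open>y\<close>. By reproduction, the difference of the weighted \<open>G\<close>-averages is the
  integral of \<open>G a\<close> times the difference of the density estimates. That difference is
  at most 0 on \<open>U - S\<close>, and \<open>G \<ge> 0\<close> preserves the sign. On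
  \<open>U \<inter> S\<close> and outside \<open>U\<close> it is only bounded by \<open>w\<close>;
  there the smallness must come from the measure of the set or from \<open>G\<close> itself.\<close>

lemma smoothed_sample_comparison:
  fixes f :: "'e::finite \<Rightarrow> real^'d::finite \<Rightarrow> real" and x y :: "nat \<Rightarrow> real^'d" and \<psi> :: "real^'d \<Rightarrow> real"
  assumes K: "flat_top_kernel K" and f: "\<And>i. integrable lborel (f i)" and c: "\<And>i x. \<bar>f i x\<bar> \<le> c"
    and \<delta>: "\<delta> > 0" and m: "m \<ge> 1" and r: "r > 0"
    and U [measurable]: "U \<in> sets borel" and U_fin: "emeasure lborel U < \<infinity>"
    and far: "\<And>i a y. a \<notin> U \<Longrightarrow> f i y \<noteq> 0 \<Longrightarrow> r \<le> dist a y"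
    and \<psi>: "\<And>x. 0 \<le> \<psi> x" "\<And>x. \<psi> x \<le> p"
    and k: "\<And>z::real^'d. \<bar>kernel_nd K z\<bar> \<le> k"
    and \<epsilon>: "\<epsilon> > 0"
    and S [measurable]: "S \<in> sets borel"
    and good: "\<And>a. a \<in> U - S \<Longrightarrow>
      1 / real n * (\<Sum>j=1..n. kernel_scaled K (\<delta> / (4 * real m)) (x j - a) * \<psi> (x j)) \<le>
      (1 + \<epsilon>) * (1 / real n * (\<Sum>j=1..n. kernel_scaled K (\<delta> / (4 * real m)) (y j - a) * \<psi> (y j)))"
  defines "G \<equiv> \<lambda>x. (\<Sum>i\<in>UNIV. (kernel_conv K \<delta> (f i) x)\<^sup>2) ^ m"
    and "w \<equiv> (2 + \<epsilon>) * (p * k * (4 * real m / \<delta>) ^ CARD('d))"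
    and "b \<equiv> c * (LBINT z::real^'d. \<bar>kernel_nd K z\<bar>)"
  shows "1 / real n * (\<Sum>j=1..n. G (x j) * \<psi> (x j)) \<le>
    (1 + \<epsilon>) * (1 / real n * (\<Sum>j=1..n. G (y j) * \<psi> (y j)))
    + w * ((real CARD('e) * b\<^sup>2) ^ m * measure lborel (U \<inter> S)
      + (real CARD('e) * b\<^sup>2) ^ (m - 1) * b *
        (\<Sum>i\<in>UNIV. (LBINT y. \<bar>f i y\<bar>) * ((\<delta> / r) ^ N * (LBINT z::real^'d. norm z ^ N * \<bar>kernel_nd K z\<bar>))))"
proof -
  define \<eta> where "\<eta> = \<delta> / (4 * real m)"
  have \<eta>: "\<eta> > 0" and inv_\<eta>: "1 / \<eta> = 4 * real m / \<delta>"
    using \<delta> m by (simp_all add: \<eta>_def)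
  have fm [measurable]: "f i \<in> borel_measurable borel" for i
    using f[of i] by simp
  define W where "W = (\<lambda>x a. 1 / real n * (\<Sum>j=1..n. kernel_scaled K \<eta> (x j - a) * \<psi> (x j)))"
  have G0: "0 \<le> G x" for x
    by (simp add: G_def sum_nonneg)
  have c0: "0 \<le> c"
    using c[of undefined 0] by (rule order_trans[OF abs_ge_zero])
  have b0: "0 \<le> b"
    unfolding b_def using c0 by (intro mult_nonneg_nonneg Bochner_Integration.integral_nonneg) auto
  have conv_b: "\<bar>kernel_conv K \<delta> (f i) x\<bar> \<le> b" for i x
    unfolding b_def by (rule kernel_conv_bound[OF K fm c])
  have sq_b: "(\<Sum>i\<in>UNIV. (kernel_conv K \<delta> (f i) x)\<^sup>2) \<le> real CARD('e) * b\<^sup>2" for x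
  proof -
    have "(kernel_conv K \<delta> (f i) x)\<^sup>2 \<le> b\<^sup>2" for i
      using conv_b[of i x] by (metis abs_ge_zero power2_abs power_mono)
    then have "(\<Sum>i\<in>UNIV. (kernel_conv K \<delta> (f i) x)\<^sup>2) \<le> (\<Sum>i\<in>(UNIV::'e set). b\<^sup>2)"
      by (intro sum_mono)
    then show ?thesis
      by simp
  qed
  have G_bound: "G x \<le> (real CARD('e) * b\<^sup>2) ^ m" for x
    unfolding G_def by (rule power_mono[OF sq_b sum_nonneg]) auto
  \<comment> \<open>Outside \<open>U\<close> only the integral of the absolute smoothed fields is
    under control, so \<open>G\<close> is bounded linearly in them; \<open>m \<ge> 1\<close>
    provides the one square to be split.\<close>
  have G_lin: "G x \<le> (real CARD('e) * b\<^sup>2) ^ (m - 1) * b * (\<Sum>i\<in>UNIV. \<bar>kernel_conv K \<delta> (f i) x\<bar>)" for x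
  proof -
    have "G x = (\<Sum>i\<in>UNIV. (kernel_conv K \<delta> (f i) x)\<^sup>2) ^ (m - 1) * (\<Sum>i\<in>UNIV. (kernel_conv K \<delta> (f i) x)\<^sup>2)"
      using m by (cases m) (auto simp: G_def mult.commute)
    also have "\<dots> \<le> (real CARD('e) * b\<^sup>2) ^ (m - 1) * (\<Sum>i\<in>UNIV. b * \<bar>kernel_conv K \<delta> (f i) x\<bar>)"
    proof (intro mult_mono)
      show "(\<Sum>i\<in>UNIV. (kernel_conv K \<delta> (f i) x)\<^sup>2) ^ (m - 1) \<le> (real CARD('e) * b\<^sup>2) ^ (m - 1)"
        by (rule power_mono[OF sq_b sum_nonneg]) auto
      show "(\<Sum>i\<in>UNIV. (kernel_conv K \<delta> (f i) x)\<^sup>2) \<le> (\<Sum>i\<in>UNIV. b * \<bar>kernel_conv K \<delta> (f i) x\<bar>)"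
      proof (rule sum_mono)
        fix i
        have "(kernel_conv K \<delta> (f i) x)\<^sup>2 = \<bar>kernel_conv K \<delta> (f i) x\<bar> * \<bar>kernel_conv K \<delta> (f i) x\<bar>"
          by (simp add: power2_eq_square)
        also have "\<dots> \<le> b * \<bar>kernel_conv K \<delta> (f i) x\<bar>"
          by (intro mult_right_mono conv_b) auto
        finally show "(kernel_conv K \<delta> (f i) x)\<^sup>2 \<le> b * \<bar>kernel_conv K \<delta> (f i) x\<bar>" .
      qed
    qed (auto intro!: sum_nonneg)
    finally show ?thesis
      by (simp add: sum_distrib_left mult.assoc)
  qed
  have W_int: "integrable lborel (\<lambda>a. G a * W x a)"
    and W_rep: "(LBINT a. G a * W x a) = 1 / real n * (\<Sum>j=1..n. G (x j) * \<psi> (x j))" for x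
  proof -
    have eq: "G a * W x a = 1 / real n * (\<Sum>j=1..n. \<psi> (x j) * (G a * kernel_scaled K \<eta> (x j - a)))" for a
      by (simp add: W_def sum_distrib_left mult_ac)
    have int: "integrable lborel (\<lambda>a. \<psi> (x j) * (G a * kernel_scaled K \<eta> (x j - a)))" for j
      unfolding G_def \<eta>_def by (intro integrable_mult_right kernel_scaled_reproduces[OF K f c \<delta> m])
    show "integrable lborel (\<lambda>a. G a * W x a)"
      unfolding eq by (intro integrable_mult_right Bochner_Integration.integrable_sum int)
    have "(LBINT a. G a * W x a) = 1 / real n * (\<Sum>j=1..n. LBINT a. \<psi> (x j) * (G a * kernel_scaled K \<eta> (x j - a)))"
      unfolding eq by (subst integral_mult_right_zero, subst Bochner_Integration.integral_sum, rule int, rule refl)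
    also have "\<dots> = 1 / real n * (\<Sum>j=1..n. G (x j) * \<psi> (x j))"
    proof -
      have "(LBINT a. G a * kernel_scaled K \<eta> (x j - a)) = G (x j)" for j
        unfolding G_def \<eta>_def by (rule kernel_scaled_reproduces(2)[OF K f c \<delta> m])
      then show ?thesis
        by (simp add: mult.commute)
    qed
    finally show "(LBINT a. G a * W x a) = 1 / real n * (\<Sum>j=1..n. G (x j) * \<psi> (x j))" .
  qed
  have k0: "0 \<le> k"
    using k[of 0] by (rule order_trans[OF abs_ge_zero])
  have p0: "0 \<le> p"
    using \<psi>(1)[of 0] \<psi>(2)[of 0] by linarith
  \<comment> \<open>Uniform bound of a density estimate: bound of the kernel times bound of
    \<open>\<psi>\<close> times \<open>1 / \<eta>\<close> to the power of the dimension. Two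
    estimates, one with weight \<open>1 + \<epsilon>\<close>, give the \<open>2 + \<epsilon>\<close>
    in \<open>w\<close>.\<close>
  define w0 where "w0 = p * k * (4 * real m / \<delta>) ^ CARD('d)"
  have w0: "0 \<le> w0"
    using k0 p0 \<delta> by (simp add: w0_def)
  have W_bound: "\<bar>W x a\<bar> \<le> w0" for x a
  proof -
    have "\<bar>kernel_scaled K \<eta> (x j - a) * \<psi> (x j)\<bar> \<le> w0" for j
    proof -
      have "\<bar>kernel_scaled K \<eta> (x j - a) * \<psi> (x j)\<bar> =
          (1 / \<eta>) ^ CARD('d) * (\<bar>kernel_nd K ((x j - a) /\<^sub>R \<eta>)\<bar> * \<psi> (x j))"
        using \<eta> \<psi>(1)[of "x j"] by (simp add: kernel_scaled_eq abs_mult power_divide)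
      also have "\<dots> \<le> (1 / \<eta>) ^ CARD('d) * (k * p)"
        using \<eta> k k0 \<psi> by (intro mult_left_mono mult_mono) auto
      finally show ?thesis
        by (simp only: inv_\<eta> w0_def mult_ac)
    qed
    then have "\<bar>\<Sum>j=1..n. kernel_scaled K \<eta> (x j - a) * \<psi> (x j)\<bar> \<le> (\<Sum>j=1..n. w0)"
      by (intro order_trans[OF sum_abs] sum_mono)
    then have "1 / real n * \<bar>\<Sum>j=1..n. kernel_scaled K \<eta> (x j - a) * \<psi> (x j)\<bar> \<le> 1 / real n * (real n * w0)"
      by (intro mult_left_mono) auto
    \<comment> \<open>An inequality rather than an equation, because for \<open>n = 0\<close> the
      left side is 0 by the division convention.\<close>
    also have "\<dots> \<le> w0"
      using w0 by simp
    finally show ?thesis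
      by (simp add: W_def abs_mult)
  qed
  have ww: "w = (2 + \<epsilon>) * w0"
    by (simp add: w_def w0_def)
  have diff_bound: "W x a - (1 + \<epsilon>) * W y a \<le> w" for a
  proof -
    have "W x a - (1 + \<epsilon>) * W y a \<le> \<bar>W x a\<bar> + (1 + \<epsilon>) * \<bar>W y a\<bar>"
      using \<epsilon> mult_left_mono[OF abs_ge_minus_self[of "W y a"], of "1 + \<epsilon>"] abs_ge_self[of "W x a"] by simp
    also have "\<dots> \<le> w0 + (1 + \<epsilon>) * w0"
      using \<epsilon> by (intro add_mono mult_left_mono W_bound) auto
    finally show ?thesis
      by (simp add: ww algebra_simps)
  qed
  have w_nonneg: "0 \<le> w"
    using \<epsilon> w0 by (simp add: ww)
  let ?g = "(real CARD('e) * b\<^sup>2) ^ m" and ?h = "(real CARD('e) * b\<^sup>2) ^ (m - 1) * b"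
  have h0: "0 \<le> ?h"
    using b0 by simp
  define R where "R = (\<lambda>a. w * (?g * indicator (U \<inter> S) a
    + ?h * (\<Sum>i\<in>UNIV. indicator (- U) a * \<bar>kernel_conv K \<delta> (f i) a\<bar>)))"
  have pointwise: "G a * W x a - (1 + \<epsilon>) * (G a * W y a) \<le> R a" for a
  proof -
    have eq: "G a * W x a - (1 + \<epsilon>) * (G a * W y a) = G a * (W x a - (1 + \<epsilon>) * W y a)"
      by (simp add: algebra_simps)
    have le: "G a * (W x a - (1 + \<epsilon>) * W y a) \<le> G a * w"
      by (intro mult_left_mono diff_bound G0)
    consider "a \<in> U - S" | "a \<in> U \<inter> S" | "a \<notin> U"
      by blast
    then show ?thesis
    proof cases
      case 1
      have "W x a - (1 + \<epsilon>) * W y a \<le> 0"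
        using good[OF 1] unfolding W_def \<eta>_def diff_le_0_iff_le .
      then have "G a * (W x a - (1 + \<epsilon>) * W y a) \<le> 0"
        by (rule mult_nonneg_nonpos[OF G0])
      then show ?thesis
        using 1 unfolding eq by (simp add: R_def)
    next
      case 2
      have "G a * w \<le> ?g * w"
        by (intro mult_right_mono G_bound w_nonneg)
      then show ?thesis
        using 2 le unfolding eq by (simp add: R_def mult.commute)
    next
      case 3
      have "G a * w \<le> ?h * (\<Sum>i\<in>UNIV. \<bar>kernel_conv K \<delta> (f i) a\<bar>) * w"
        by (intro mult_right_mono G_lin w_nonneg)
      then show ?thesis
        using 3 le unfolding eq by (simp add: R_def mult.commute)
    qed
  qed
  define J where "J = (\<lambda>i a. indicator (- U) a * \<bar>kernel_conv K \<delta> (f i) a\<bar>)"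
  have J_int: "integrable lborel (J i)" for i
    unfolding J_def by (rule kernel_conv_tail(1)[OF K f c r \<delta> U far])
  have J_le: "(LBINT a. J i a) \<le> (LBINT y. \<bar>f i y\<bar>) * ((\<delta> / r) ^ N * (LBINT z::real^'d. norm z ^ N * \<bar>kernel_nd K z\<bar>))" for i
    unfolding J_def by (rule kernel_conv_tail(2)[OF K f c r \<delta> U far])
  have R_eq: "R = (\<lambda>a. w * (?g * indicator (U \<inter> S) a + ?h * (\<Sum>i\<in>UNIV. J i a)))"
    by (simp only: R_def J_def)
  have US: "integrable lborel (indicator (U \<inter> S) :: real^'d \<Rightarrow> real)"
    using U_fin by (intro integrable_real_indicator) (auto intro: le_less_trans[OF emeasure_mono])
  have R_int: "integrable lborel R"
    unfolding R_eq
    by (intro integrable_mult_right Bochner_Integration.integrable_add Bochner_Integration.integrable_sum US J_int)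
  have "1 / real n * (\<Sum>j=1..n. G (x j) * \<psi> (x j)) - (1 + \<epsilon>) * (1 / real n * (\<Sum>j=1..n. G (y j) * \<psi> (y j))) =
      (LBINT a. G a * W x a - (1 + \<epsilon>) * (G a * W y a))"
    using W_int[of x] W_int[of y] by (simp add: W_rep)
  also have "\<dots> \<le> (LBINT a. R a)"
    by (intro Bochner_Integration.integral_mono pointwise R_int Bochner_Integration.integrable_diff
        integrable_mult_right W_int)
  also have "\<dots> = w * (?g * measure lborel (U \<inter> S) +
      ?h * (\<Sum>i\<in>UNIV. LBINT a. J i a))"
    unfolding R_eq using US J_int by (simp add: Bochner_Integration.integral_sum)
  also have "\<dots> \<le> w * (?g * measure lborel (U \<inter> S) +
      ?h * (\<Sum>i\<in>UNIV. (LBINT y. \<bar>f i y\<bar>) * ((\<delta> / r) ^ N * (LBINT z::real^'d. norm z ^ N * \<bar>kernel_nd K z\<bar>))))"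
    by (intro mult_left_mono add_left_mono sum_mono J_le h0 w_nonneg)
  finally show ?thesis
    by simp
qed

section \<open>Measurability and distributional facts\<close>

lemma space_holder_borel: "space (holder_borel l \<gamma>) = holder_space l \<gamma>"
  by (simp add: holder_borel_def space_measure_of_conv)

lemma holder_open_in_sets: "holder_open l \<gamma> U \<Longrightarrow> U \<in> sets (holder_borel l \<gamma>)"
  unfolding holder_borel_def by (intro in_measure_of) (auto simp: holder_open_def)

text \<open>The Hoelder norm dominates the sup norm, so evaluation at a point is continuous and
  preimages of open sets are open.\<close>

lemma eval_measurable_holder_borel: "(\<lambda>f. f x) \<in> borel_measurable (holder_borel l \<gamma>)"
proof (rule borel_measurableI)
  fix S :: "real set" assume S: "open S"
  have "holder_open l \<gamma> ((\<lambda>f. f x) -` S \<inter> holder_space l \<gamma>)"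
    unfolding holder_open_def
  proof (intro conjI ballI)
    fix f assume "f \<in> (\<lambda>f. f x) -` S \<inter> holder_space l \<gamma>"
    then obtain r where r: "r > 0" "ball (f x) r \<subseteq> S"
      using S open_contains_ball by blast
    have "g \<in> (\<lambda>f. f x) -` S \<inter> holder_space l \<gamma>"
      if g: "g \<in> holder_space l \<gamma>" "holder_norm l \<gamma> (\<lambda>x. g x - f x) < ennreal r" for g
    proof -
      have "ennreal \<bar>g x - f x\<bar> < ennreal r"
        using le_less_trans[OF holder_norm_ge_abs[of "\<lambda>x. g x - f x" x] g(2)] .
      then have "g x \<in> ball (f x) r"
        using r by (simp add: ennreal_less_iff dist_real_def abs_minus_commute)
      then show ?thesis
        using r g by auto
    qed
    then show "\<exists>r>0. \<forall>g\<in>holder_space l \<gamma>. holder_norm l \<gamma> (\<lambda>x. g x - f x) < ennreal r \<longrightarrow>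
        g \<in> (\<lambda>f. f x) -` S \<inter> holder_space l \<gamma>"
      using r by blast
  qed simp
  then show "(\<lambda>f. f x) -` S \<inter> space (holder_borel l \<gamma>) \<in> sets (holder_borel l \<gamma>)"
    unfolding space_holder_borel by (rule holder_open_in_sets)
qed

text \<open>Approximate the random point by simple functions.\<close>

lemma measurable_eval_random_point:
  fixes D :: "'w \<Rightarrow> 'a::{second_countable_topology, metric_space} \<Rightarrow> 'b::metric_space"
  assumes D: "\<And>x. (\<lambda>\<omega>. D \<omega> x) \<in> borel_measurable M"
    and cont: "\<And>\<omega>. \<omega> \<in> space M \<Longrightarrow> continuous_on UNIV (D \<omega>)"
    and \<xi>: "\<xi> \<in> borel_measurable M"
  shows "(\<lambda>\<omega>. D \<omega> (\<xi> \<omega>)) \<in> borel_measurable M"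
proof -
  obtain F where F: "\<And>i. simple_function M (F i)"
    "\<And>\<omega>. \<omega> \<in> space M \<Longrightarrow> (\<lambda>i. F i \<omega>) \<longlonglongrightarrow> \<xi> \<omega>"
    using borel_measurable_implies_sequence_metric[OF \<xi>] by blast
  show ?thesis
  proof (rule borel_measurable_LIMSEQ_metric)
    fix i
    have "F i \<in> measurable M (count_space (F i ` space M))"
      using F(1)[of i] by (subst measurable_count_space_eq2) (auto simp: simple_function_def)
    then show "(\<lambda>\<omega>. D \<omega> (F i \<omega>)) \<in> borel_measurable M"
      using F(1)[of i] D
      by (intro measurable_compose_countable'[where f="\<lambda>x \<omega>. D \<omega> x" and g="F i"])
        (auto simp: simple_function_def intro: countable_finite)
  next
    fix \<omega> assume \<omega>: "\<omega> \<in> space M"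
    have "isCont (D \<omega>) (\<xi> \<omega>)"
      using cont[OF \<omega>] by (simp add: continuous_on_eq_continuous_at)
    then show "(\<lambda>i. D \<omega> (F i \<omega>)) \<longlonglongrightarrow> D \<omega> (\<xi> \<omega>)"
      using F(2)[OF \<omega>] by (rule isCont_tendsto_compose)
  qed
qed

section \<open>Equality in law and random bad sets\<close>

lemma integral_component_eq_distr:
  fixes \<xi> \<xi>' :: "nat \<Rightarrow> 'w \<Rightarrow> 'a::topological_space" and w :: "'a \<Rightarrow> real"
  assumes \<xi>: "\<And>j. j \<in> J \<Longrightarrow> \<xi> j \<in> borel_measurable M"
    and \<xi>': "\<And>j. j \<in> J \<Longrightarrow> \<xi>' j \<in> borel_measurable M"
    and eq: "distr M (\<Pi>\<^sub>M j\<in>J. borel) (\<lambda>\<omega>. \<lambda>j\<in>J. \<xi> j \<omega>) = distr M (\<Pi>\<^sub>M j\<in>J. borel) (\<lambda>\<omega>. \<lambda>j\<in>J. \<xi>' j \<omega>)"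
    and [measurable]: "w \<in> borel_measurable borel" and j: "j \<in> J"
  shows "(LINT \<omega>|M. w (\<xi> j \<omega>)) = (LINT \<omega>|M. w (\<xi>' j \<omega>))"
proof -
  have [measurable]: "(\<lambda>p. w (p j)) \<in> borel_measurable (\<Pi>\<^sub>M j\<in>J. borel)"
    using j by measurable
  have [measurable]: "(\<lambda>\<omega>. \<lambda>j\<in>J. \<xi> j \<omega>) \<in> M \<rightarrow>\<^sub>M (\<Pi>\<^sub>M j\<in>J. borel)"
      "(\<lambda>\<omega>. \<lambda>j\<in>J. \<xi>' j \<omega>) \<in> M \<rightarrow>\<^sub>M (\<Pi>\<^sub>M j\<in>J. borel)"
    by (auto intro!: measurable_restrict \<xi> \<xi>')
  have "(LINT \<omega>|M. w (\<xi> j \<omega>)) = (LINT p|distr M (\<Pi>\<^sub>M j\<in>J. borel) (\<lambda>\<omega>. \<lambda>j\<in>J. \<xi> j \<omega>). w (p j))"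
    using j by (subst integral_distr) auto
  also have "\<dots> = (LINT \<omega>|M. w (\<xi>' j \<omega>))"
    unfolding eq using j by (subst integral_distr) auto
  finally show ?thesis .
qed

text \<open>The means and the event depend on the sample only through its joint law, so one
  deviation bound serves both samples.\<close>

lemma deviation_prob_eq_distr:
  fixes \<xi> \<xi>' :: "nat \<Rightarrow> 'w \<Rightarrow> real^'d::finite"
  assumes \<xi>: "\<And>j. j \<in> {1..n} \<Longrightarrow> \<xi> j \<in> borel_measurable M"
    and \<xi>': "\<And>j. j \<in> {1..n} \<Longrightarrow> \<xi>' j \<in> borel_measurable M"
    and eq: "distr M (\<Pi>\<^sub>M j\<in>{1..n}. borel) (\<lambda>\<omega>. \<lambda>j\<in>{1..n}. \<xi> j \<omega>) =
      distr M (\<Pi>\<^sub>M j\<in>{1..n}. borel) (\<lambda>\<omega>. \<lambda>j\<in>{1..n}. \<xi>' j \<omega>)"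
    and w [measurable]: "w \<in> borel_measurable borel"
  shows "deviation_prob M w \<epsilon> n \<xi> = deviation_prob M w \<epsilon> n \<xi>'"
proof -
  define e where "e = (\<lambda>j. LINT \<omega>|M. w (\<xi> j \<omega>))"
  have e': "(LINT \<omega>|M. w (\<xi>' j \<omega>)) = e j" if "j \<in> {1..n}" for j
    unfolding e_def by (rule integral_component_eq_distr[OF \<xi> \<xi>' eq w that, symmetric])
  let ?P = "\<lambda>p. \<bar>1 / real n * (\<Sum>j=1..n. w (p j) - e j)\<bar> \<ge> \<epsilon> / (2 * (1 + \<epsilon>)) * (1 / real n * (\<Sum>j=1..n. e j))"
  let ?N = "\<Pi>\<^sub>M j\<in>{1..n}. (borel :: (real^'d) measure)"
  have [measurable]: "(\<lambda>p. w (p j)) \<in> borel_measurable ?N" if "j \<in> {1..n}" for j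
    using that by measurable
  have P [measurable]: "{p \<in> space ?N. ?P p} \<in> sets ?N"
    by measurable
  have *: "measure M {\<omega> \<in> space M. ?P (\<lambda>j. \<zeta> j \<omega>)} = measure (distr M ?N (\<lambda>\<omega>. \<lambda>j\<in>{1..n}. \<zeta> j \<omega>)) {p \<in> space ?N. ?P p}"
    if \<zeta>: "\<And>j. j \<in> {1..n} \<Longrightarrow> \<zeta> j \<in> borel_measurable M" for \<zeta> :: "nat \<Rightarrow> 'w \<Rightarrow> real^'d"
  proof -
    have \<zeta>_meas: "(\<lambda>\<omega>. \<lambda>j\<in>{1..n}. \<zeta> j \<omega>) \<in> M \<rightarrow>\<^sub>M ?N"
      by (auto intro!: measurable_restrict \<zeta>)
    have "(\<lambda>\<omega>. \<lambda>j\<in>{1..n}. \<zeta> j \<omega>) -` {p \<in> space ?N. ?P p} \<inter> space M = {\<omega> \<in> space M. ?P (\<lambda>j. \<zeta> j \<omega>)}"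
      by (auto simp: space_PiM)
    then show ?thesis
      by (simp only: measure_distr[OF \<zeta>_meas P])
  qed
  have "deviation_prob M w \<epsilon> n \<xi> = measure M {\<omega> \<in> space M. ?P (\<lambda>j. \<xi> j \<omega>)}"
    by (simp add: deviation_prob_def e_def)
  also have "\<dots> = measure M {\<omega> \<in> space M. ?P (\<lambda>j. \<xi>' j \<omega>)}"
    by (simp only: *[OF \<xi>] *[OF \<xi>'] eq)
  also have "\<dots> = deviation_prob M w \<epsilon> n \<xi>'"
    unfolding deviation_prob_def by (simp add: e' cong: sum.cong_simp)
  finally show ?thesis .
qed

text \<open>By Fubini the expected Lebesgue measure of the random set of bad \<open>a\<close> in
  \<open>U\<close> is the integral over \<open>U\<close> of the probability that a fixed
  \<open>a\<close> is bad. A bound for each fixed \<open>a\<close> is thus enough although the bad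
  set varies with the outcome.\<close>

lemma (in prob_space) expectation_slice_measure_le:
  fixes U :: "'b::euclidean_space set"
  assumes A [measurable]: "A \<in> sets (M \<Otimes>\<^sub>M borel)" and U [measurable]: "U \<in> sets borel"
    and fin: "emeasure lborel U < \<infinity>"
    and s: "\<And>a. a \<in> U \<Longrightarrow> measure M {\<omega> \<in> space M. (\<omega>, a) \<in> A} \<le> s"
  shows "integrable M (\<lambda>\<omega>. measure lborel (U \<inter> {a. (\<omega>, a) \<in> A}))"
    and "(LINT \<omega>|M. measure lborel (U \<inter> {a. (\<omega>, a) \<in> A})) \<le> measure lborel U * s"
proof -
  interpret P: pair_sigma_finite M "lborel :: 'b measure" ..
  have A' [measurable]: "A \<in> sets (M \<Otimes>\<^sub>M lborel)"
    using A by (simp cong: sets_pair_measure_cong)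
  let ?f = "\<lambda>\<omega> a. indicator U a * indicator A (\<omega>, a) :: real"
  have U_int: "integrable lborel (indicator U :: 'b \<Rightarrow> real)"
    using fin by (intro integrable_real_indicator) auto
  have int: "integrable (M \<Otimes>\<^sub>M lborel) (\<lambda>(\<omega>, a). ?f \<omega> a)"
  proof (rule Bochner_Integration.integrable_bound)
    show "integrable (M \<Otimes>\<^sub>M lborel) (\<lambda>(\<omega>, a). indicator U a :: real)"
      using U_int by (intro P.Fubini_integrable) auto
  qed (auto simp: indicator_def)
  have slice [measurable]: "U \<inter> {a. (\<omega>, a) \<in> A} \<in> sets borel" if "\<omega> \<in> space M" for \<omega>
    using sets_Pair1[OF A, of \<omega>] by (auto simp: vimage_def)
  have eq: "measure lborel (U \<inter> {a. (\<omega>, a) \<in> A}) = (LBINT a. ?f \<omega> a)" if "\<omega> \<in> space M" for \<omega>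
  proof -
    have "?f \<omega> = indicator (U \<inter> {a. (\<omega>, a) \<in> A})"
      by (auto simp: indicator_def fun_eq_iff)
    then show ?thesis
      using slice[OF that] by simp
  qed
  have int1: "integrable M (\<lambda>\<omega>. LBINT a. ?f \<omega> a)"
    using P.integrable_fst[OF int] by simp
  then show "integrable M (\<lambda>\<omega>. measure lborel (U \<inter> {a. (\<omega>, a) \<in> A}))"
    using eq by (simp cong: Bochner_Integration.integrable_cong)
  have "(LINT \<omega>|M. measure lborel (U \<inter> {a. (\<omega>, a) \<in> A})) = (LINT \<omega>|M. (LBINT a. ?f \<omega> a))"
    by (intro Bochner_Integration.integral_cong refl eq)
  also have "\<dots> = (LBINT a. (LINT \<omega>|M. ?f \<omega> a))"
    by (rule P.Fubini_integral[OF int, symmetric])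
  also have "\<dots> \<le> (LBINT a. indicator U a * s)"
  proof (rule Bochner_Integration.integral_mono)
    show "integrable lborel (\<lambda>a. LINT \<omega>|M. ?f \<omega> a)"
      using P.integrable_snd[OF int] by simp
    show "integrable lborel (\<lambda>a. indicator U a * s)"
      using U_int by (rule integrable_mult_left)
    fix a :: 'b
    have "(\<lambda>\<omega>. indicator A (\<omega>, a) :: real) = indicator {\<omega>. (\<omega>, a) \<in> A}"
      by (auto simp: indicator_def)
    then have "(LINT \<omega>|M. (indicator A (\<omega>, a) :: real)) = measure M ({\<omega>. (\<omega>, a) \<in> A} \<inter> space M)"
      by simp
    also have "{\<omega>. (\<omega>, a) \<in> A} \<inter> space M = {\<omega> \<in> space M. (\<omega>, a) \<in> A}"
      by auto
    finally show "(LINT \<omega>|M. ?f \<omega> a) \<le> indicator U a * s"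
      using s[of a] by (auto simp: indicator_def)
  qed
  also have "\<dots> = measure lborel U * s"
    by simp
  finally show "(LINT \<omega>|M. measure lborel (U \<inter> {a. (\<omega>, a) \<in> A})) \<le> measure lborel U * s" .
qed

text \<open>With \<open>e = \<epsilon> / (2 (1 + \<epsilon>))\<close> one has
  \<open>(1 + \<epsilon>) e = \<epsilon> / 2\<close> and \<open>e \<le> \<epsilon> / 2\<close>,
  hence \<open>1 + e \<le> (1 + \<epsilon>) (1 - e)\<close>.\<close>

lemma relative_deviation_ratio:
  fixes u v w \<epsilon> :: real
  assumes \<epsilon>: "\<epsilon> > 0" and u: "\<bar>u - w\<bar> < \<epsilon> / (2 * (1 + \<epsilon>)) * w" and v: "\<bar>v - w\<bar> < \<epsilon> / (2 * (1 + \<epsilon>)) * w"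
  shows "u \<le> (1 + \<epsilon>) * v"
proof -
  define e where "e = \<epsilon> / (2 * (1 + \<epsilon>))"
  have e: "e > 0" "(1 + \<epsilon>) * e = \<epsilon> / 2" "e \<le> \<epsilon> / 2"
    using \<epsilon> by (simp_all add: e_def field_simps)
  \<comment> \<open>The strict bound excludes a nonpositive mean, which a sign-changing kernel would
    allow; in the application such points count as bad.\<close>
  have "0 < e * w"
    using u by (simp add: e_def)
  then have w: "w > 0"
    using e by (simp add: zero_less_mult_iff)
  have "u \<le> w + e * w"
    using u unfolding e_def[symmetric] by linarith
  also have "\<dots> \<le> w + (\<epsilon> / 2) * w"
    using e w by simp
  also have "\<dots> = (1 + \<epsilon>) * w - (1 + \<epsilon>) * e * w"
    by (simp only: e) (simp add: algebra_simps)
  also have "\<dots> = (1 + \<epsilon>) * (w - e * w)"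
    by (simp add: algebra_simps)
  also have "\<dots> \<le> (1 + \<epsilon>) * v"
    using v \<epsilon> unfolding e_def[symmetric] by (intro mult_left_mono) auto
  finally show ?thesis .
qed

section \<open>The risk bound for a fixed sample size\<close>

lemma norm_vec_power_even:
  "norm (\<chi> i. u i :: real^'e::finite) ^ (2 * m) = (\<Sum>i\<in>UNIV. (u i)\<^sup>2) ^ m"
  by (simp add: norm_vec_def L2_set_def power_mult sum_nonneg)

lemma powr_power_mult:
  assumes "\<delta> > 0"
  shows "((A * \<delta> powr \<beta>)\<^sup>2) ^ m = (A\<^sup>2) ^ m * \<delta> powr (2 * real m * \<beta>)"
proof -
  have "(\<delta> powr \<beta>) ^ (2 * m) = \<delta> powr (real (2 * m) * \<beta>)"
    using assms by (simp add: powr_power mult.commute)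
  then show ?thesis
    by (simp add: power_mult[symmetric] power_mult_distrib)
qed

text \<open>The constants are explicit and depend on \<open>n\<close> only through
  \<open>\<delta>\<close> and \<open>s\<close>, and the decay order \<open>N\<close> stays free, so
  that one \<open>C\<close> can be extracted afterwards. The inequality is proved for almost every
  outcome and then integrated, since fields and samples may be dependent. The factor
  \<open>4 ^ m\<close> occurs twice: for replacing \<open>D\<close> by its smoothing at
  \<open>\<xi>'\<close> and for returning at \<open>\<xi>\<close>. The 2 before
  \<open>measure lborel U * s\<close> counts the bad sets of the two samples.\<close>

lemma (in prob_space) emp_risk_bound_fixed:
  fixes D :: "'e::finite \<Rightarrow> 'a \<Rightarrow> real^'d::finite \<Rightarrow> real" and \<psi> :: "real^'d \<Rightarrow> real"
    and \<xi> \<xi>' :: "nat \<Rightarrow> 'a \<Rightarrow> real^'d"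
  assumes K: "flat_top_kernel K" and B: "holder_bounded l \<gamma> B"
    and c: "\<And>f x. f \<in> B \<Longrightarrow> \<bar>f x\<bar> \<le> c"
    and err: "\<And>f x \<delta>. f \<in> B \<Longrightarrow> \<delta> > 0 \<Longrightarrow> \<bar>kernel_conv K \<delta> f x - f x\<bar> \<le> A * \<delta> powr \<beta>"
    and \<delta>: "\<delta> > 0" and m: "m \<ge> 1" and r: "r > 0" and \<epsilon>: "\<epsilon> > 0"
    and U [measurable]: "U \<in> sets borel" and U_fin: "emeasure lborel U < \<infinity>"
    and X: "compact X" and far: "\<And>a y. a \<notin> U \<Longrightarrow> y \<in> X \<Longrightarrow> r \<le> dist a y"
    and \<psi>: "\<And>x. 0 \<le> \<psi> x" "\<And>x. \<psi> x \<le> p" and \<psi>_meas [measurable]: "\<psi> \<in> borel_measurable borel"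
    and k: "\<And>z::real^'d. \<bar>kernel_nd K z\<bar> \<le> k"
    and D_meas: "\<And>i. D i \<in> M \<rightarrow>\<^sub>M holder_borel l \<gamma>"
    and D_B: "\<And>i \<omega>. \<omega> \<in> space M \<Longrightarrow> D i \<omega> \<in> B"
    and D_supp: "\<And>i. AE \<omega> in M. supp (D i \<omega>) \<subseteq> X"
    and \<xi>: "\<And>j. j \<in> {1..n} \<Longrightarrow> \<xi> j \<in> borel_measurable M"
    and \<xi>': "\<And>j. j \<in> {1..n} \<Longrightarrow> \<xi>' j \<in> borel_measurable M"
    and eq: "distr M (\<Pi>\<^sub>M j\<in>{1..n}. borel) (\<lambda>\<omega>. \<lambda>j\<in>{1..n}. \<xi> j \<omega>) =
      distr M (\<Pi>\<^sub>M j\<in>{1..n}. borel) (\<lambda>\<omega>. \<lambda>j\<in>{1..n}. \<xi>' j \<omega>)"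
    and s: "\<And>a. a \<in> U \<Longrightarrow> Q1 M K \<psi> m \<epsilon> \<delta> n \<xi> a \<le> s"
  defines "w \<equiv> (2 + \<epsilon>) * (p * k * (4 * real m / \<delta>) ^ CARD('d))"
    and "b \<equiv> c * (LBINT z::real^'d. \<bar>kernel_nd K z\<bar>)"
    and "q \<equiv> (real CARD('e) * (A * \<delta> powr \<beta>)\<^sup>2) ^ m * p"
  shows "emp_risk M D m \<psi> n \<xi>' \<le>
    4 ^ m * ((1 + \<epsilon>) * (4 ^ m * (emp_risk M D m \<psi> n \<xi> + q))
      + w * ((real CARD('e) * b\<^sup>2) ^ m * (2 * (measure lborel U * s))
        + (real CARD('e) * b\<^sup>2) ^ (m - 1) * b *
          (real CARD('e) * (c * measure lborel X * ((\<delta> / r) ^ N * (LBINT z::real^'d. norm z ^ N * \<bar>kernel_nd K z\<bar>))))) + q)"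
proof -
  note [measurable] = kernel_nd_measurable[OF K]
  define \<eta> where "\<eta> = \<delta> / (4 * real m)"
  have ks_meas [measurable]: "kernel_scaled K \<eta> \<in> borel_measurable (borel :: (real^'d) measure)"
    unfolding kernel_scaled_eq[abs_def] by measurable
  have D_cont: "continuous_on UNIV (D i \<omega>)" if "\<omega> \<in> space M" for i \<omega>
    using D_B[OF that, of i] B by (intro Ck_imp_continuous[of l]) (auto simp: holder_bounded_def holder_space_def)
  have D_eval [measurable]: "(\<lambda>\<omega>. D i \<omega> (\<zeta> \<omega>)) \<in> borel_measurable M" if "\<zeta> \<in> borel_measurable M" for i \<zeta>
  proof (rule measurable_eval_random_point[OF _ D_cont that])
    show "(\<lambda>\<omega>. D i \<omega> x) \<in> borel_measurable M" for x
      using D_meas eval_measurable_holder_borel by (rule measurable_compose)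
  qed
  define e where "e = (\<lambda>j a. LINT \<omega>|M. kernel_scaled K \<eta> (\<xi> j \<omega> - a) * \<psi> (\<xi> j \<omega>))"
  have e': "(LINT \<omega>|M. kernel_scaled K \<eta> (\<xi>' j \<omega> - a) * \<psi> (\<xi>' j \<omega>)) = e j a" if "j \<in> {1..n}" for j a
    unfolding e_def
    by (rule integral_component_eq_distr[where w="\<lambda>x. kernel_scaled K \<eta> (x - a) * \<psi> x",
          OF \<xi> \<xi>' eq _ that, symmetric]) measurable
  define W where "W = (\<lambda>(\<zeta> :: nat \<Rightarrow> 'a \<Rightarrow> real^'d) \<omega> a. 1 / real n * (\<Sum>j=1..n. kernel_scaled K \<eta> (\<zeta> j \<omega> - a) * \<psi> (\<zeta> j \<omega>)))"
  define E where "E = (\<lambda>a. 1 / real n * (\<Sum>j=1..n. e j a))"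
  \<comment> \<open>A set of pairs of outcome and point: its sections at fixed \<open>a\<close> are
    the events of \<open>Q1\<close>, those at fixed \<open>\<omega>\<close> are the sets
    \<open>S\<close> below. Both samples are measured against the same mean
    \<open>E\<close>.\<close>
  define Bad where "Bad = (\<lambda>(\<zeta> :: nat \<Rightarrow> 'a \<Rightarrow> real^'d). {z \<in> space (M \<Otimes>\<^sub>M (borel :: (real^'d) measure)). \<bar>W \<zeta> (fst z) (snd z) - E (snd z)\<bar> \<ge> \<epsilon> / (2 * (1 + \<epsilon>)) * E (snd z)})"
  have e_meas: "e j \<in> borel_measurable borel" if "j \<in> {1..n}" for j
    unfolding e_def using \<xi>[OF that] by measurable
  have E_meas [measurable]: "E \<in> borel_measurable borel"
    unfolding E_def using e_meas by measurable
  have Bad_meas: "Bad \<zeta> \<in> sets (M \<Otimes>\<^sub>M borel)" if \<zeta>: "\<And>j. j \<in> {1..n} \<Longrightarrow> \<zeta> j \<in> borel_measurable M"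
    for \<zeta> :: "nat \<Rightarrow> 'a \<Rightarrow> real^'d"
  proof -
    have "(\<lambda>z. kernel_scaled K \<eta> (\<zeta> j (fst z) - snd z) * \<psi> (\<zeta> j (fst z))) \<in> borel_measurable (M \<Otimes>\<^sub>M borel)"
      if "j \<in> {1..n}" for j
      using \<zeta>[OF that] by measurable
    then have [measurable]: "(\<lambda>z. \<Sum>j=1..n. kernel_scaled K \<eta> (\<zeta> j (fst z) - snd z) * \<psi> (\<zeta> j (fst z)))
        \<in> borel_measurable (M \<Otimes>\<^sub>M borel)"
      by (rule borel_measurable_sum)
    have [measurable]: "(\<lambda>z. W \<zeta> (fst z) (snd z)) \<in> borel_measurable (M \<Otimes>\<^sub>M borel)"
      unfolding W_def by measurable
    show ?thesis
      unfolding Bad_def by measurable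
  qed
  have slice: "measure M {\<omega> \<in> space M. (\<omega>, a) \<in> Bad \<zeta>} = Q1 M K \<psi> m \<epsilon> \<delta> n \<xi> a"
    if \<zeta>: "\<zeta> = \<xi> \<or> \<zeta> = \<xi>'" for \<zeta> a
  proof -
    let ?w = "\<lambda>x. kernel_scaled K \<eta> (x - a) * \<psi> x"
    have ez: "(LINT \<omega>|M. ?w (\<zeta> j \<omega>)) = e j a" if "j \<in> {1..n}" for j
      using \<zeta> e'[OF that] by (auto simp: e_def)
    have "deviation_prob M ?w \<epsilon> n \<zeta> = measure M {\<omega> \<in> space M. (\<omega>, a) \<in> Bad \<zeta>}"
      unfolding deviation_prob_def Bad_def W_def E_def
      by (simp add: space_pair_measure ez sum_subtractf right_diff_distrib cong: sum.cong_simp)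
    moreover have "deviation_prob M ?w \<epsilon> n \<xi>' = deviation_prob M ?w \<epsilon> n \<xi>"
      by (rule deviation_prob_eq_distr[OF \<xi> \<xi>' eq, symmetric]) measurable
    ultimately show ?thesis
      using \<zeta> by (auto simp: Q1_def \<eta>_def)
  qed
  define S where "S = (\<lambda>\<zeta> \<omega>. {a. (\<omega>, a) \<in> Bad \<zeta>})"
  have S_sets: "S \<zeta> \<omega> \<in> sets borel" if "\<zeta> = \<xi> \<or> \<zeta> = \<xi>'" for \<zeta> \<omega>
    using sets_Pair1[OF Bad_meas, of \<zeta> \<omega>] \<xi> \<xi>' that by (auto simp: S_def vimage_def)
  have S_int: "integrable M (\<lambda>\<omega>. measure lborel (U \<inter> S \<zeta> \<omega>))"
    and S_le: "(LINT \<omega>|M. measure lborel (U \<inter> S \<zeta> \<omega>)) \<le> measure lborel U * s"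
    if "\<zeta> = \<xi> \<or> \<zeta> = \<xi>'" for \<zeta>
  proof -
    have Bm: "Bad \<zeta> \<in> sets (M \<Otimes>\<^sub>M borel)"
      using that \<xi> \<xi>' by (auto intro!: Bad_meas)
    have le: "measure M {\<omega> \<in> space M. (\<omega>, a) \<in> Bad \<zeta>} \<le> s" if "a \<in> U" for a
      using slice \<open>\<zeta> = \<xi> \<or> \<zeta> = \<xi>'\<close> s[OF that] by simp
    show "integrable M (\<lambda>\<omega>. measure lborel (U \<inter> S \<zeta> \<omega>))"
      unfolding S_def by (rule expectation_slice_measure_le(1)[OF Bm U U_fin le])
    show "(LINT \<omega>|M. measure lborel (U \<inter> S \<zeta> \<omega>)) \<le> measure lborel U * s"
      unfolding S_def by (rule expectation_slice_measure_le(2)[OF Bm U U_fin le])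
  qed
  define risk where "risk = (\<lambda>(\<zeta> :: nat \<Rightarrow> 'a \<Rightarrow> real^'d) \<omega>. 1 / real n * (\<Sum>j=1..n. norm (\<chi> i. D i \<omega> (\<zeta> j \<omega>)) ^ (2 * m) * \<psi> (\<zeta> j \<omega>)))"
  have risk_int: "integrable M (risk \<zeta>)" if "\<zeta> = \<xi> \<or> \<zeta> = \<xi>'" for \<zeta>
  proof -
    have \<zeta>: "\<zeta> j \<in> borel_measurable M" if "j \<in> {1..n}" for j
      using \<open>\<zeta> = \<xi> \<or> \<zeta> = \<xi>'\<close> \<xi>[OF that] \<xi>'[OF that] by auto
    have "integrable M (\<lambda>\<omega>. (\<Sum>i\<in>UNIV. (D i \<omega> (\<zeta> j \<omega>))\<^sup>2) ^ m * \<psi> (\<zeta> j \<omega>))" if j: "j \<in> {1..n}" for j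
    proof (rule integrable_const_bound[where B="(real CARD('e) * c\<^sup>2) ^ m * p"])
      note [measurable] = \<zeta>[OF j]
      show "(\<lambda>\<omega>. (\<Sum>i\<in>UNIV. (D i \<omega> (\<zeta> j \<omega>))\<^sup>2) ^ m * \<psi> (\<zeta> j \<omega>)) \<in> borel_measurable M"
        by measurable
      show "AE \<omega> in M. norm ((\<Sum>i\<in>UNIV. (D i \<omega> (\<zeta> j \<omega>))\<^sup>2) ^ m * \<psi> (\<zeta> j \<omega>)) \<le> (real CARD('e) * c\<^sup>2) ^ m * p"
      proof (intro AE_I2)
        fix \<omega> assume \<omega>: "\<omega> \<in> space M"
        have "(D i \<omega> (\<zeta> j \<omega>))\<^sup>2 \<le> c\<^sup>2" for i
          using c[OF D_B[OF \<omega>], of i "\<zeta> j \<omega>"] by (metis abs_ge_zero power2_abs power_mono)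
        then have "(\<Sum>i\<in>UNIV. (D i \<omega> (\<zeta> j \<omega>))\<^sup>2) \<le> (\<Sum>i\<in>(UNIV::'e set). c\<^sup>2)"
          by (rule sum_mono)
        then have "(\<Sum>i\<in>UNIV. (D i \<omega> (\<zeta> j \<omega>))\<^sup>2) ^ m \<le> (real CARD('e) * c\<^sup>2) ^ m"
          by (intro power_mono) (auto simp: sum_nonneg)
        then have "(\<Sum>i\<in>UNIV. (D i \<omega> (\<zeta> j \<omega>))\<^sup>2) ^ m * \<psi> (\<zeta> j \<omega>) \<le> (real CARD('e) * c\<^sup>2) ^ m * p"
          by (intro mult_mono \<psi>) auto
        then show "norm ((\<Sum>i\<in>UNIV. (D i \<omega> (\<zeta> j \<omega>))\<^sup>2) ^ m * \<psi> (\<zeta> j \<omega>)) \<le> (real CARD('e) * c\<^sup>2) ^ m * p"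
          using \<psi>(1) by (simp add: abs_mult sum_nonneg)
      qed
    qed
    then show ?thesis
      unfolding risk_def norm_vec_power_even by (intro integrable_mult_right Bochner_Integration.integrable_sum)
  qed
  let ?q0 = "(real CARD('e) * (A * \<delta> powr \<beta>)\<^sup>2) ^ m"
  have p0: "0 \<le> p"
    using \<psi>(1)[of 0] \<psi>(2)[of 0] by linarith
  have q0: "0 \<le> ?q0"
    by simp
  \<comment> \<open>Shared by both passages between field and smoothing: \<open>?q0\<close> is the
    power of the smoothing error, and \<open>\<psi> \<le> p\<close> turns its weighted average into
    at most \<open>q\<close>.\<close>
  have avg: "1 / real n * (\<Sum>j=1..n. g j * \<psi> (x j)) \<le> 4 ^ m * (1 / real n * (\<Sum>j=1..n. h j * \<psi> (x j)) + q)"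
    if gh: "\<And>j. g j \<le> 4 ^ m * (h j + ?q0)" for g h :: "nat \<Rightarrow> real" and x :: "nat \<Rightarrow> real^'d"
  proof -
    have "(\<Sum>j=1..n. g j * \<psi> (x j)) \<le> (\<Sum>j=1..n. 4 ^ m * (h j * \<psi> (x j) + q))"
    proof (rule sum_mono)
      fix j
      have "g j * \<psi> (x j) \<le> 4 ^ m * (h j + ?q0) * \<psi> (x j)"
        by (intro mult_right_mono gh \<psi>)
      also have "\<dots> = 4 ^ m * (h j * \<psi> (x j) + ?q0 * \<psi> (x j))"
        by (simp add: algebra_simps)
      also have "\<dots> \<le> 4 ^ m * (h j * \<psi> (x j) + ?q0 * p)"
        by (intro mult_left_mono add_left_mono \<psi> q0) auto
      finally show "g j * \<psi> (x j) \<le> 4 ^ m * (h j * \<psi> (x j) + q)"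
        by (simp add: q_def)
    qed
    then have "1 / real n * (\<Sum>j=1..n. g j * \<psi> (x j)) \<le> 1 / real n * (\<Sum>j=1..n. 4 ^ m * (h j * \<psi> (x j) + q))"
      by (intro mult_left_mono) auto
    also have "(\<Sum>j=1..n. 4 ^ m * (h j * \<psi> (x j) + q)) = 4 ^ m * ((\<Sum>j=1..n. h j * \<psi> (x j)) + real n * q)"
      by (simp add: sum_distrib_left[symmetric] sum.distrib)
    also have "1 / real n * \<dots> = 4 ^ m * (1 / real n * (\<Sum>j=1..n. h j * \<psi> (x j)) + 1 / real n * (real n * q))"
      by (simp only: distrib_left mult_ac)
    also have "\<dots> \<le> 4 ^ m * (1 / real n * (\<Sum>j=1..n. h j * \<psi> (x j)) + q)"
      using q0 p0 by (intro mult_left_mono add_left_mono) (auto simp: q_def)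
    finally show ?thesis .
  qed
  let ?t = "(real CARD('e) * b\<^sup>2) ^ (m - 1) * b *
          (real CARD('e) * (c * measure lborel X * ((\<delta> / r) ^ N * (LBINT z::real^'d. norm z ^ N * \<bar>kernel_nd K z\<bar>))))"
  let ?g = "(real CARD('e) * b\<^sup>2) ^ m"
  have pathwise: "risk \<xi>' \<omega> \<le> 4 ^ m * ((1 + \<epsilon>) * (4 ^ m * (risk \<xi> \<omega> + q))
      + w * (?g * (measure lborel (U \<inter> S \<xi> \<omega>) + measure lborel (U \<inter> S \<xi>' \<omega>)) + ?t) + q)"
    if \<omega>: "\<omega> \<in> space M" and supp: "\<And>i. supp (D i \<omega>) \<subseteq> X" for \<omega>
  proof -
    define G where "G = (\<lambda>x. (\<Sum>i\<in>UNIV. (kernel_conv K \<delta> (D i \<omega>) x)\<^sup>2) ^ m)"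
    have conv_err: "\<bar>kernel_conv K \<delta> (D i \<omega>) x - D i \<omega> x\<bar> \<le> A * \<delta> powr \<beta>" for i x
      by (rule err[OF D_B[OF \<omega>] \<delta>])
    have zero: "D i \<omega> y = 0" if "y \<notin> X" for i y
      using that supp[of i] closure_subset[of "{x. D i \<omega> x \<noteq> 0}"] by (auto simp: supp_def)
    have D_borel: "D i \<omega> \<in> borel_measurable borel" for i
      by (intro borel_measurable_continuous_onI D_cont \<omega>)
    have X_meas: "X \<in> sets borel"
      using X by (intro borel_closed compact_imp_closed)
    have X_int: "integrable lborel (\<lambda>y. c * indicator X y :: real)"
      using emeasure_bounded_finite[OF compact_imp_bounded[OF X]] X_meas
      by (intro integrable_mult_right integrable_real_indicator) auto
    have D_le: "\<bar>D i \<omega> y\<bar> \<le> c * indicator X y" for i y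
      using c[OF D_B[OF \<omega>], of i y] zero[of y i] by (auto simp: indicator_def)
    have D_int: "integrable lborel (D i \<omega>)" for i
      using X_int by (rule Bochner_Integration.integrable_bound)
        (auto simp: D_borel intro: order_trans[OF D_le abs_ge_self])
    have D_L1: "(LBINT y. \<bar>D i \<omega> y\<bar>) \<le> c * measure lborel X" for i
    proof -
      have "(LBINT y. \<bar>D i \<omega> y\<bar>) \<le> (LBINT y. c * indicator X y)"
        by (intro Bochner_Integration.integral_mono integrable_abs D_int X_int D_le)
      then show ?thesis
        by simp
    qed
    have far': "r \<le> dist a y" if "a \<notin> U" "D i \<omega> y \<noteq> 0" for i a y
      using far[OF that(1)] zero[of y i] that(2) by blast
    \<comment> \<open>Off both bad sets the two estimates are strictly within the relative error of
      the common mean \<open>E a\<close>.\<close>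
    have good: "W \<xi>' \<omega> a \<le> (1 + \<epsilon>) * W \<xi> \<omega> a" if "a \<in> U - (S \<xi> \<omega> \<union> S \<xi>' \<omega>)" for a
      using that \<omega> by (intro relative_deviation_ratio[OF \<epsilon>, where w="E a"])
        (auto simp: S_def Bad_def space_pair_measure not_le)
    have cmp: "1 / real n * (\<Sum>j=1..n. G (\<xi>' j \<omega>) * \<psi> (\<xi>' j \<omega>)) \<le>
        (1 + \<epsilon>) * (1 / real n * (\<Sum>j=1..n. G (\<xi> j \<omega>) * \<psi> (\<xi> j \<omega>)))
        + w * (?g * measure lborel (U \<inter> (S \<xi> \<omega> \<union> S \<xi>' \<omega>)) + (real CARD('e) * b\<^sup>2) ^ (m - 1) * b *
          (\<Sum>i\<in>UNIV. (LBINT y. \<bar>D i \<omega> y\<bar>) * ((\<delta> / r) ^ N * (LBINT z::real^'d. norm z ^ N * \<bar>kernel_nd K z\<bar>))))"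
      unfolding G_def w_def b_def
      by (rule smoothed_sample_comparison[OF K D_int c[OF D_B[OF \<omega>]] \<delta> m r U U_fin far' \<psi> k \<epsilon>])
        (use S_sets good in \<open>auto simp: W_def \<eta>_def\<close>)
    have b0: "0 \<le> b"
      unfolding b_def using c[OF D_B[OF \<omega>], of undefined 0]
      by (intro mult_nonneg_nonneg Bochner_Integration.integral_nonneg) auto
    have w0: "0 \<le> w"
      unfolding w_def using \<epsilon> p0 \<delta> k[of 0] by simp
    have meas_le: "measure lborel (U \<inter> (S \<xi> \<omega> \<union> S \<xi>' \<omega>)) \<le> measure lborel (U \<inter> S \<xi> \<omega>) + measure lborel (U \<inter> S \<xi>' \<omega>)"
    proof -
      have "emeasure lborel (U \<inter> T) \<noteq> \<infinity>" if "T \<in> sets borel" for T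
        using U_fin emeasure_mono[of "U \<inter> T" U lborel] by (auto simp: top_unique)
      then have "measure lborel ((U \<inter> S \<xi> \<omega>) \<union> (U \<inter> S \<xi>' \<omega>)) \<le> measure lborel (U \<inter> S \<xi> \<omega>) + measure lborel (U \<inter> S \<xi>' \<omega>)"
        using S_sets by (intro measure_subadditive) auto
      then show ?thesis
        by (simp add: Int_Un_distrib)
    qed
    have tail_le: "(\<Sum>i\<in>UNIV. (LBINT y. \<bar>D i \<omega> y\<bar>) * ((\<delta> / r) ^ N * (LBINT z::real^'d. norm z ^ N * \<bar>kernel_nd K z\<bar>))) \<le>
        real CARD('e) * (c * measure lborel X * ((\<delta> / r) ^ N * (LBINT z::real^'d. norm z ^ N * \<bar>kernel_nd K z\<bar>)))"
    proof -
      have "0 \<le> (\<delta> / r) ^ N * (LBINT z::real^'d. norm z ^ N * \<bar>kernel_nd K z\<bar>)"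
        using \<delta> r by (intro mult_nonneg_nonneg Bochner_Integration.integral_nonneg) auto
      then show ?thesis
        by (intro order_trans[OF sum_mono[OF mult_right_mono[OF D_L1]]]) auto
    qed
    have G_le: "1 / real n * (\<Sum>j=1..n. G (\<xi> j \<omega>) * \<psi> (\<xi> j \<omega>)) \<le> 4 ^ m * (risk \<xi> \<omega> + q)"
      unfolding risk_def norm_vec_power_even G_def by (intro avg sum_squares_power_approx conv_err)
    have risk_le: "risk \<xi>' \<omega> \<le> 4 ^ m * (1 / real n * (\<Sum>j=1..n. G (\<xi>' j \<omega>) * \<psi> (\<xi>' j \<omega>)) + q)"
      unfolding risk_def norm_vec_power_even G_def
      by (intro avg sum_squares_power_approx) (simp only: abs_minus_commute[of "D _ _ _"] conv_err)
    have "1 / real n * (\<Sum>j=1..n. G (\<xi>' j \<omega>) * \<psi> (\<xi>' j \<omega>)) \<le> (1 + \<epsilon>) * (4 ^ m * (risk \<xi> \<omega> + q))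
        + w * (?g * (measure lborel (U \<inter> S \<xi> \<omega>) + measure lborel (U \<inter> S \<xi>' \<omega>)) + ?t)"
      using \<epsilon> w0 b0
      by (intro order_trans[OF cmp] add_mono mult_left_mono G_le meas_le tail_le) auto
    then show ?thesis
      by (intro order_trans[OF risk_le] mult_left_mono add_right_mono) auto
  qed
  have AE_path: "AE \<omega> in M. risk \<xi>' \<omega> \<le> 4 ^ m * ((1 + \<epsilon>) * (4 ^ m * (risk \<xi> \<omega> + q))
      + w * (?g * (measure lborel (U \<inter> S \<xi> \<omega>) + measure lborel (U \<inter> S \<xi>' \<omega>)) + ?t) + q)"
  proof -
    have "AE \<omega> in M. \<forall>i. supp (D i \<omega>) \<subseteq> X"
      using D_supp by (simp add: AE_all_countable)
    then show ?thesis
      by (rule AE_mp) (intro AE_I2 impI pathwise, simp_all)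
  qed
  have w0: "0 \<le> w"
    unfolding w_def using \<epsilon> p0 \<delta> k[of 0] by simp
  have "emp_risk M D m \<psi> n \<xi>' = (LINT \<omega>|M. risk \<xi>' \<omega>)"
    by (simp add: emp_risk_def risk_def)
  also have "\<dots> \<le> (LINT \<omega>|M. 4 ^ m * ((1 + \<epsilon>) * (4 ^ m * (risk \<xi> \<omega> + q))
      + w * (?g * (measure lborel (U \<inter> S \<xi> \<omega>) + measure lborel (U \<inter> S \<xi>' \<omega>)) + ?t) + q))"
    by (intro integral_mono_AE AE_path risk_int integrable_mult_right Bochner_Integration.integrable_add
        S_int integrable_const) auto
  also have "\<dots> = 4 ^ m * ((1 + \<epsilon>) * (4 ^ m * ((LINT \<omega>|M. risk \<xi> \<omega>) + q))
      + w * (?g * ((LINT \<omega>|M. measure lborel (U \<inter> S \<xi> \<omega>)) + (LINT \<omega>|M. measure lborel (U \<inter> S \<xi>' \<omega>))) + ?t) + q)"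
    using risk_int[of \<xi>] S_int[of \<xi>] S_int[of \<xi>'] by (simp add: prob_space)
  also have "\<dots> \<le> 4 ^ m * ((1 + \<epsilon>) * (4 ^ m * ((LINT \<omega>|M. risk \<xi> \<omega>) + q))
      + w * (?g * (measure lborel U * s + measure lborel U * s) + ?t) + q)"
    using w0 by (intro mult_left_mono add_left_mono add_right_mono add_mono S_le) auto
  also have "(LINT \<omega>|M. risk \<xi> \<omega>) = emp_risk M D m \<psi> n \<xi>"
    by (simp add: emp_risk_def risk_def)
  finally show ?thesis
    by (simp only: mult_2)
qed

section \<open>Uniform constants\<close>

text \<open>\<open>GREATEST\<close> is informative only once its value is exhibited; here it is
  \<open>\<lceil>\<beta>\<rceil> - 1\<close>. The strict inequality makes the Hoelder exponent
  \<open>\<beta> - l\<close> positive.\<close>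

lemma holder_index_less:
  fixes \<beta> :: real
  assumes "int l = (GREATEST k::int. real_of_int k < \<beta>)"
  shows "real l < \<beta>"
proof -
  have "(GREATEST k::int. real_of_int k < \<beta>) = \<lceil>\<beta>\<rceil> - 1"
  proof (rule Greatest_equality)
    show "real_of_int (\<lceil>\<beta>\<rceil> - 1) < \<beta>"
      by linarith
    show "y \<le> \<lceil>\<beta>\<rceil> - 1" if "real_of_int y < \<beta>" for y
    proof -
      have "y < \<lceil>\<beta>\<rceil>"
        using that by (simp add: less_ceiling_iff)
      then show ?thesis
        by simp
    qed
  qed
  then have "real_of_int (int l) = real_of_int \<lceil>\<beta>\<rceil> - 1"
    using assms by simp
  then show ?thesis
    by linarith
qed

lemma deviation_prob_bounds:
  assumes "prob_space M"
  shows "0 \<le> deviation_prob M w \<epsilon> n \<xi>" and "deviation_prob M w \<epsilon> n \<xi> \<le> 1"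
  using assms by (simp_all add: deviation_prob_def prob_space.prob_le_1)

lemma emp_risk_nonneg:
  assumes "\<And>x. 0 \<le> \<psi> x"
  shows "0 \<le> emp_risk M D m \<psi> n \<zeta>"
  unfolding emp_risk_def using assms
  by (intro Bochner_Integration.integral_nonneg mult_nonneg_nonneg sum_nonneg) auto

text \<open>The given open set may have infinite measure, so a bounded
  \<open>r\<close>-neighbourhood \<open>U\<close> of \<open>X\<close> inside it takes over.
  Boundedness gives finite measure, \<open>U \<subseteq> X'\<close> keeps the supremum of the
  deviation probabilities valid on \<open>U\<close>, and points off \<open>U\<close> keep the
  distance \<open>r\<close> that the tail estimate demands.\<close>

lemma compact_bounded_neighbourhood:
  fixes X X' :: "'a::euclidean_space set"
  assumes X: "compact X" "X \<noteq> {}" and X': "open X'" "X \<subseteq> X'"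
  obtains U r where "r > 0" "open U" "bounded U" "U \<subseteq> X'"
    "\<And>a y. a \<notin> U \<Longrightarrow> y \<in> X \<Longrightarrow> r \<le> dist a y"
proof -
  obtain r where r: "r > 0" "{x. infdist x X \<le> r} \<subseteq> X'"
    using compact_in_open_separated[OF X(2,1) X'] by blast
  define U where "U = (\<Union>y\<in>X. ball y r)"
  show ?thesis
  proof (rule that[OF r(1), of U])
    show "open U"
      by (auto simp: U_def)
    obtain b where b: "\<And>y. y \<in> X \<Longrightarrow> norm y \<le> b"
      using compact_imp_bounded[OF X(1)] by (auto simp: bounded_iff)
    have "norm x \<le> b + r" if x: "x \<in> U" for x
    proof -
      obtain y where y: "y \<in> X" "dist y x < r"
        using x by (auto simp: U_def)
      have "norm x \<le> norm y + norm (x - y)"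
        by (rule norm_triangle_sub)
      then show ?thesis
        using b[OF y(1)] y(2) by (simp add: dist_norm norm_minus_commute)
    qed
    then show "bounded U"
      by (auto simp: bounded_iff)
    show "U \<subseteq> X'"
    proof
      fix x assume "x \<in> U"
      then obtain y where y: "y \<in> X" "dist y x < r"
        by (auto simp: U_def)
      then have "infdist x X \<le> r"
        using infdist_le[OF y(1), of x] by (simp add: dist_commute)
      then show "x \<in> X'"
        using r(2) by blast
    qed
    show "r \<le> dist a y" if "a \<notin> U" "y \<in> X" for a y
      using that by (auto simp: U_def dist_commute not_less)
  qed
qed

text \<open>The exponent \<open>N\<close> is split and the surplus power bounded by a constant;
  \<open>\<Delta>\<close> takes care of \<open>\<delta>\<close> larger than 1.\<close>

lemma power_le_powr_mult_power:
  fixes \<delta> \<Delta> \<rho> :: real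
  assumes \<delta>: "0 < \<delta>" "\<delta> \<le> \<Delta>" and N: "real k + \<rho> \<le> real N"
  shows "\<delta> ^ N \<le> \<Delta> powr (real N - real k - \<rho>) * \<delta> powr \<rho> * \<delta> ^ k"
proof -
  have "\<delta> powr real N = \<delta> powr (real N - real k - \<rho>) * \<delta> powr \<rho> * \<delta> powr real k"
    by (simp only: powr_add[symmetric]) simp
  then have "\<delta> ^ N = \<delta> powr (real N - real k - \<rho>) * \<delta> powr \<rho> * \<delta> ^ k"
    by (simp only: powr_realpow[OF \<delta>(1)])
  also have "\<dots> \<le> \<Delta> powr (real N - real k - \<rho>) * \<delta> powr \<rho> * \<delta> ^ k"
    using \<delta> N by (intro mult_right_mono powr_mono2) auto
  finally show ?thesis .
qed

text \<open>All coefficients are nonnegative, so each of the three terms may be enlarged to their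
  sum. In the application \<open>e\<close> is \<open>(1 + \<epsilon>) * 4 ^ m\<close> and
  \<open>F\<close> is \<open>4 ^ m\<close>.\<close>

lemma combine_risk_terms:
  fixes F :: real
  assumes "0 \<le> R" "0 \<le> P" "0 \<le> Z" "0 \<le> F" "0 \<le> e" "0 \<le> q" "0 \<le> g" "0 \<le> t"
  shows "F * (e * (R + q * P) + (g * Z + t * P) + q * P) \<le> F * (e * (1 + q) + (g + t) + q) * (R + P + Z)"
proof -
  have "R + q * P \<le> (1 + q) * (R + P + Z)"
    using assms by (simp add: algebra_simps add_nonneg_nonneg)
  then have "e * (R + q * P) \<le> e * ((1 + q) * (R + P + Z))"
    using assms by (intro mult_left_mono) auto
  moreover have "g * Z \<le> g * (R + P + Z)" "t * P \<le> t * (R + P + Z)" "q * P \<le> q * (R + P + Z)"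
    using assms by (auto intro!: mult_left_mono)
  ultimately have "e * (R + q * P) + (g * Z + t * P) + q * P \<le> (e * (1 + q) + (g + t) + q) * (R + P + Z)"
    by (simp add: distrib_right mult.assoc)
  then show ?thesis
    using assms by (simp add: mult.assoc mult_left_mono)
qed

theorem theorem2p3:
  fixes M :: "'w measure"
    and K0 :: "real \<Rightarrow> real"
    and \<beta> \<epsilon> :: real
    and l m :: nat
    and B :: "(real ^ 'd::finite \<Rightarrow> real) set"
    and X X' :: "(real ^ 'd) set"
    and d :: "nat \<Rightarrow> real"
    and \<psi> :: "real ^ 'd \<Rightarrow> real"
    and D :: "nat \<Rightarrow> 'e::finite \<Rightarrow> 'w \<Rightarrow> real ^ 'd \<Rightarrow> real"
    and \<xi> \<xi>' :: "nat \<Rightarrow> nat \<Rightarrow> 'w \<Rightarrow> real ^ 'd"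
  assumes "prob_space M"
    and "flat_top_kernel K0"
    and "\<beta> > 0" and "int l = (GREATEST k::int. real_of_int k < \<beta>)"
    and "holder_bounded l (\<beta> - real l) B"
    and "compact X" and "open X'" and "X \<subseteq> X'"
    and "m \<ge> 1" and "\<epsilon> > 0"
    and "\<And>n. n \<ge> 1 \<Longrightarrow> d n > 0" and "d \<longlonglongrightarrow> 0"
    and "\<And>x. \<psi> x \<ge> 0" and "bounded (range \<psi>)" and "\<psi> \<in> borel_measurable borel"
    and "\<And>n i. n \<ge> 1 \<Longrightarrow> D n i \<in> M \<rightarrow>\<^sub>M holder_borel l (\<beta> - real l)"
    and "\<And>n i \<omega>. n \<ge> 1 \<Longrightarrow> \<omega> \<in> space M \<Longrightarrow> D n i \<omega> \<in> B"
    and "\<And>n i. n \<ge> 1 \<Longrightarrow> AE \<omega> in M. supp (D n i \<omega>) \<subseteq> X"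
    and "\<And>n j. n \<ge> 1 \<Longrightarrow> j \<in> {1..n} \<Longrightarrow> \<xi> n j \<in> borel_measurable M"
    and "\<And>n j. n \<ge> 1 \<Longrightarrow> j \<in> {1..n} \<Longrightarrow> \<xi>' n j \<in> borel_measurable M"
    and "\<And>n. n \<ge> 1 \<Longrightarrow>
           distr M (\<Pi>\<^sub>M j\<in>{1..n}. borel) (\<lambda>\<omega>. \<lambda>j\<in>{1..n}. \<xi> n j \<omega>) =
           distr M (\<Pi>\<^sub>M j\<in>{1..n}. borel) (\<lambda>\<omega>. \<lambda>j\<in>{1..n}. \<xi>' n j \<omega>)"
  shows "\<exists>C::real. \<forall>n\<ge>1.
           emp_risk M (D n) m \<psi> n (\<xi>' n) \<le>
             C * (emp_risk M (D n) m \<psi> n (\<xi> n) + d n powr (2 * real m * \<beta>)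
                  + 1 / d n ^ CARD('d) * (SUP a\<in>X'. Q1 M K0 \<psi> m \<epsilon> (d n) n (\<xi> n) a))"
proof -
  interpret prob_space M by fact
  note K = assms(2) and hB = assms(5) and \<psi>0 = assms(13)
  show ?thesis
  \<comment> \<open>For empty \<open>X\<close> the fields vanish almost surely and
    \<open>C = 0\<close> works. \<open>X'\<close> may then be empty too, in which case nothing
    useful is known about the supremum on the right.\<close>
  proof (cases "X = {}")
    case True
    have "emp_risk M (D n) m \<psi> n (\<xi>' n) = 0" if n: "n \<ge> 1" for n
    proof -
      have "AE \<omega> in M. \<forall>i. supp (D n i \<omega>) \<subseteq> X"
        using assms(18)[OF n] by (simp add: AE_all_countable)
      then have "AE \<omega> in M. 1 / real n * (\<Sum>j=1..n. norm (\<chi> i. D n i \<omega> (\<xi>' n j \<omega>)) ^ (2 * m) * \<psi> (\<xi>' n j \<omega>)) = 0"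
      proof eventually_elim
        fix \<omega> assume "\<forall>i. supp (D n i \<omega>) \<subseteq> X"
        then have "D n i \<omega> x = 0" for i x
          using True by (auto simp: supp_def)
        then show "1 / real n * (\<Sum>j=1..n. norm (\<chi> i. D n i \<omega> (\<xi>' n j \<omega>)) ^ (2 * m) * \<psi> (\<xi>' n j \<omega>)) = 0"
          using assms(9) by (simp add: norm_vec_power_even power_0_left)
      qed
      then show ?thesis
        unfolding emp_risk_def by (rule integral_eq_zero_AE)
    qed
    then show ?thesis
      by (intro exI[of _ 0]) simp
  next
    case False
    have l: "real l < \<beta>"
      by (rule holder_index_less) fact
    obtain c where c: "c > 0" "\<And>f x. f \<in> B \<Longrightarrow> \<bar>f x\<bar> \<le> c"
      by (rule holder_boundedE[OF hB]) (rule that)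
    have "0 \<le> \<beta> - real l"
      using l by simp
    then obtain A where A: "A \<ge> 0"
      "\<And>f x \<delta>. f \<in> B \<Longrightarrow> \<delta> > 0 \<Longrightarrow> \<bar>kernel_conv K0 \<delta> f x - f x\<bar> \<le> A * \<delta> powr (real l + (\<beta> - real l))"
      by (rule kernel_conv_error[OF K hB]) (rule that)
    then have err: "\<bar>kernel_conv K0 \<delta> f x - f x\<bar> \<le> A * \<delta> powr \<beta>" if "f \<in> B" "\<delta> > 0" for f x \<delta>
      using that by simp
    obtain k where k: "k > 0" "\<And>z :: real^'d. \<bar>kernel_nd K0 z\<bar> \<le> k"
      by (rule kernel_nd_bounded[OF K]) (rule that)
    obtain p where "\<forall>y\<in>range \<psi>. norm y \<le> p"
      using assms(14) unfolding bounded_iff by blast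
    then have p: "\<psi> x \<le> p" for x
      by (simp add: abs_le_iff)
    have p0: "0 \<le> p"
      using \<psi>0[of 0] p[of 0] by linarith
    obtain U r where r: "r > 0" and U: "open U" "bounded U" "U \<subseteq> X'"
      and far: "\<And>a y. a \<notin> U \<Longrightarrow> y \<in> X \<Longrightarrow> r \<le> dist a y"
      by (rule compact_bounded_neighbourhood[OF assms(6) False assms(7,8)]) (rule that)
    \<comment> \<open>Convergence bounds all bandwidths at once, including those above 1.\<close>
    obtain \<Delta> where "\<forall>y\<in>range d. norm y \<le> \<Delta>"
      using convergent_imp_bounded[OF assms(12)] unfolding bounded_iff by blast
    then have \<Delta>: "d n \<le> \<Delta>" for n
      by (simp add: abs_le_iff)
    \<comment> \<open>Decay order of the tail: after division by \<open>d n ^ CARD('d)\<close> the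
      power \<open>d n ^ N\<close> must still be at most a constant times
      \<open>d n powr (2 * m * \<beta>)\<close>.\<close>
    define N where "N = CARD('d) + nat \<lceil>2 * real m * \<beta>\<rceil>"
    have N: "real CARD('d) + 2 * real m * \<beta> \<le> real N"
      by (simp add: N_def) linarith
    define \<kappa> where "\<kappa> = (LBINT z::real^'d. norm z ^ N * \<bar>kernel_nd K0 z\<bar>)"
    define b where "b = c * (LBINT z::real^'d. \<bar>kernel_nd K0 z\<bar>)"
    define g where "g = (real CARD('e) * b\<^sup>2) ^ m"
    define h where "h = (real CARD('e) * b\<^sup>2) ^ (m - 1) * b * (real CARD('e) * (c * measure lborel X))"
    define L where "L = \<Delta> powr (real N - real CARD('d) - 2 * real m * \<beta>)"
    define w1 where "w1 = (2 + \<epsilon>) * (p * k * (4 * real m) ^ CARD('d))"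
    define q0 where "q0 = (real CARD('e)) ^ m * (A\<^sup>2) ^ m * p"
    \<comment> \<open>Coefficients free of \<open>n\<close>: \<open>g1\<close> goes with the
      deviation term, \<open>t1\<close> with the tail, which is absorbed into
      \<open>d n powr (2 * m * \<beta>)\<close>.\<close>
    define g1 where "g1 = w1 * g * (2 * measure lborel U)"
    define t1 where "t1 = w1 * h * (\<kappa> / r ^ N) * L"
    have b0: "0 \<le> b"
      unfolding b_def using c(1) by (intro mult_nonneg_nonneg Bochner_Integration.integral_nonneg) auto
    have \<kappa>0: "0 \<le> \<kappa>"
      unfolding \<kappa>_def by (intro Bochner_Integration.integral_nonneg) auto
    have nonneg: "0 \<le> w1" "0 \<le> q0" "0 \<le> g" "0 \<le> h" "0 \<le> L"
      using p0 k(1) assms(10) b0 c(1) by (simp_all add: w1_def q0_def g_def h_def L_def)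
    have nonneg': "0 \<le> g1" "0 \<le> t1"
      using nonneg \<kappa>0 r by (simp_all add: g1_def t1_def)
    define C where "C = 4 ^ m * ((1 + \<epsilon>) * 4 ^ m * (1 + q0) + (g1 + t1) + q0)"
    have "emp_risk M (D n) m \<psi> n (\<xi>' n) \<le>
        C * (emp_risk M (D n) m \<psi> n (\<xi> n) + d n powr (2 * real m * \<beta>)
          + 1 / d n ^ CARD('d) * (SUP a\<in>X'. Q1 M K0 \<psi> m \<epsilon> (d n) n (\<xi> n) a))" if n: "n \<ge> 1" for n
    proof -
      define s where "s = (SUP a\<in>X'. Q1 M K0 \<psi> m \<epsilon> (d n) n (\<xi> n) a)"
      define P where "P = d n powr (2 * real m * \<beta>)"
      define R where "R = emp_risk M (D n) m \<psi> n (\<xi> n)"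
      have \<delta>: "d n > 0"
        by (rule assms(11)[OF n])
      \<comment> \<open>The supremum of a real family is an upper bound only if the family is
        bounded above; probabilities are at most 1.\<close>
      have bdd: "bdd_above ((\<lambda>a. Q1 M K0 \<psi> m \<epsilon> (d n) n (\<xi> n) a) ` X')"
        unfolding Q1_def by (intro bdd_aboveI2[where M=1] deviation_prob_bounds(2)[OF assms(1)])
      have s: "Q1 M K0 \<psi> m \<epsilon> (d n) n (\<xi> n) a \<le> s" if "a \<in> U" for a
        unfolding s_def using that U(3) by (intro cSUP_upper bdd) auto
      \<comment> \<open>This needs a point of \<open>X'\<close>, which the nonempty \<open>X\<close>
        supplies.\<close>
      have s0: "0 \<le> s"
      proof -
        obtain a where "a \<in> X'"
          using False assms(8) by blast
        then have "Q1 M K0 \<psi> m \<epsilon> (d n) n (\<xi> n) a \<le> s"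
          unfolding s_def by (intro cSUP_upper bdd)
        then show ?thesis
          unfolding Q1_def by (rule order_trans[OF deviation_prob_bounds(1)[OF assms(1)]])
      qed
      have fixed: "emp_risk M (D n) m \<psi> n (\<xi>' n) \<le>
          4 ^ m * ((1 + \<epsilon>) * (4 ^ m * (R + (real CARD('e) * (A * d n powr \<beta>)\<^sup>2) ^ m * p))
          + (2 + \<epsilon>) * (p * k * (4 * real m / d n) ^ CARD('d)) * (g * (2 * (measure lborel U * s))
            + (real CARD('e) * b\<^sup>2) ^ (m - 1) * b * (real CARD('e) * (c * measure lborel X * ((d n / r) ^ N * \<kappa>))))
          + (real CARD('e) * (A * d n powr \<beta>)\<^sup>2) ^ m * p)"
        unfolding R_def g_def b_def \<kappa>_def
      proof (rule emp_risk_bound_fixed[where A=A and \<beta>=\<beta> and c=c and l=l and \<gamma>="\<beta> - real l" and B=B and \<delta>="d n"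
            and U=U and X=X and r=r and k=k and p=p and s=s, OF K hB])
        show "\<bar>f x\<bar> \<le> c" if "f \<in> B" for f x
          using that by (rule c(2))
        show "\<bar>kernel_conv K0 \<delta> f x - f x\<bar> \<le> A * \<delta> powr \<beta>" if "f \<in> B" "\<delta> > 0" for f x \<delta>
          using that by (rule err)
        show "0 < d n" "1 \<le> m" "0 < r" "0 < \<epsilon>"
          by fact+
        show "U \<in> sets borel"
          using U(1) by (rule borel_open)
        show "emeasure lborel U < \<infinity>"
          using U(2) by (rule emeasure_bounded_finite)
        show "compact X" "\<psi> \<in> borel_measurable borel"
          by fact+
        show "r \<le> dist a y" if "a \<notin> U" "y \<in> X" for a y
          using that by (rule far)
        show "D n i \<in> M \<rightarrow>\<^sub>M holder_borel l (\<beta> - real l)" for i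
          by (rule assms(16)[OF n])
        show "D n i \<omega> \<in> B" if "\<omega> \<in> space M" for i \<omega>
          by (rule assms(17)[OF n that])
        show "AE \<omega> in M. supp (D n i \<omega>) \<subseteq> X" for i
          by (rule assms(18)[OF n])
        show "\<xi> n j \<in> borel_measurable M" "\<xi>' n j \<in> borel_measurable M" if "j \<in> {1..n}" for j
          using assms(19)[OF n that] assms(20)[OF n that] .
        show "distr M (\<Pi>\<^sub>M j\<in>{1..n}. borel) (\<lambda>\<omega>. \<lambda>j\<in>{1..n}. \<xi> n j \<omega>) =
            distr M (\<Pi>\<^sub>M j\<in>{1..n}. borel) (\<lambda>\<omega>. \<lambda>j\<in>{1..n}. \<xi>' n j \<omega>)"
          by (rule assms(21)[OF n])
              show "0 \<le> \<psi> x" "\<psi> x \<le> p" for x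
          by (rule \<psi>0, rule p)
        show "\<bar>kernel_nd K0 z\<bar> \<le> k" for z :: "real^'d"
          by (rule k(2))
        show "Q1 M K0 \<psi> m \<epsilon> (d n) n (\<xi> n) a \<le> s" if "a \<in> U" for a
          using that by (rule s)
      qed
      have q: "(real CARD('e) * (A * d n powr \<beta>)\<^sup>2) ^ m * p = q0 * P"
        unfolding power_mult_distrib[of "real CARD('e)"] powr_power_mult[OF \<delta>] q0_def P_def
        by (simp only: mult_ac)
      have w: "(2 + \<epsilon>) * (p * k * (4 * real m / d n) ^ CARD('d)) = w1 / d n ^ CARD('d)"
        by (simp add: w1_def power_divide)
      have tail: "w1 / d n ^ CARD('d) * (h * ((d n / r) ^ N * \<kappa>)) \<le> t1 * P"
      proof -
        have "d n ^ N \<le> L * P * d n ^ CARD('d)"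
          unfolding L_def P_def by (rule power_le_powr_mult_power[OF \<delta> \<Delta> N])
        then have "d n ^ N / d n ^ CARD('d) \<le> L * P"
          using \<delta> by (simp add: pos_divide_le_eq)
        then have "w1 * h * (\<kappa> / r ^ N) * (d n ^ N / d n ^ CARD('d)) \<le> w1 * h * (\<kappa> / r ^ N) * (L * P)"
          using nonneg \<kappa>0 r by (intro mult_left_mono mult_nonneg_nonneg) auto
        moreover have "w1 / d n ^ CARD('d) * (h * ((d n / r) ^ N * \<kappa>)) =
            w1 * h * (\<kappa> / r ^ N) * (d n ^ N / d n ^ CARD('d))"
          by (simp add: power_divide mult_ac)
        ultimately show ?thesis
          by (simp add: t1_def mult_ac)
      qed
      have "emp_risk M (D n) m \<psi> n (\<xi>' n) \<le>
          4 ^ m * ((1 + \<epsilon>) * (4 ^ m * (R + q0 * P)) + w1 / d n ^ CARD('d) * (g * (2 * (measure lborel U * s))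
            + h * ((d n / r) ^ N * \<kappa>)) + q0 * P)"
        using fixed unfolding q w by (simp add: h_def mult_ac)
      also have "\<dots> = 4 ^ m * ((1 + \<epsilon>) * 4 ^ m * (R + q0 * P) + (g1 * (1 / d n ^ CARD('d) * s)
            + w1 / d n ^ CARD('d) * (h * ((d n / r) ^ N * \<kappa>))) + q0 * P)"
        by (simp add: g1_def distrib_left mult_ac)
      also have "\<dots> \<le> 4 ^ m * ((1 + \<epsilon>) * 4 ^ m * (R + q0 * P) + (g1 * (1 / d n ^ CARD('d) * s) + t1 * P) + q0 * P)"
        by (intro mult_left_mono add_left_mono add_right_mono tail) auto
      also have "\<dots> \<le> C * (R + P + 1 / d n ^ CARD('d) * s)"
        unfolding C_def
      proof (rule combine_risk_terms)
        show "0 \<le> R"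
          unfolding R_def by (rule emp_risk_nonneg[OF \<psi>0])
      qed (use \<delta> s0 nonneg nonneg' assms(10) in \<open>auto simp: P_def\<close>)
      finally show ?thesis
        by (simp only: R_def P_def s_def)
    qed
    then show ?thesis
      by blast
  qed
qed

end
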